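(* Let $\Omega\subset\mathbb R^2$ be a domain. The topology induced on $\Omega$ by the conformal capacitary metric $\rho_{(F,V)}$ coincides with the Euclidean topology.
   Context: For disjoint sets $F_0,F_1\subset\Omega$, the conformal capacity is $\mathrm{cap}(F_0,F_1;\Omega)=\inf\int_\Omega|\nabla v|^2dx$, where the infimum is over nonnegative $v\in C(\Omega)$ with square integrable weak gradient, $v=0$ in a neighborhood of $F_0$, and $v\ge1$ in a neighborhood of $F_1$. Fix a continuum $F\subset\Omega$ and a domain $V$ with $F\subset V\subset\overline V\subset\Omega$, $\overline V$ compact, and $\partial V$ the image of the unit circle under a quasiconformal homeomorphism of $\mathbb R^2$. For $x,y\in\Omega$, $$\rho_{(F,V)}(x,y)=\inf_{l(x,y)}\big\{\mathrm{cap}^{1/2}(F,l(x,y)\setminus V;\Omega)+\mathrm{cap}^{1/2}(\partial\Omega,l(x,y)\cap V;\Omega)\big\},$$ where the infimum is over rectifiable curves $l(x,y)$ in $\Omega$ joining $x$ and $y$.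
   Formalization: Adds the hypothesis cap(∂Ω,F;Ω)>0 (so ∂Ω has positive capacity and F is more than one point); without it, e.g. for Ω=ℝ², ρ_(F,V) vanishes between distinct points and the claim fails. *)

theory Defs
  imports "HOL-Analysis.Analysis"
begin

type_synonym R2 = "real^2"

fun Ck_fun :: "nat \<Rightarrow> (R2 \<Rightarrow> real) \<Rightarrow> bool" where
  "Ck_fun 0 f = continuous_on UNIV f"
| "Ck_fun (Suc k) f = ((\<forall>x. f differentiable (at x)) \<and> continuous_on UNIV f \<and>
      (\<forall>i. Ck_fun k (\<lambda>x. frechet_derivative f (at x) (axis i 1))))"

definition smooth_fun :: "(R2 \<Rightarrow> real) \<Rightarrow> bool" where
  "smooth_fun f \<longleftrightarrow> (\<forall>k. Ck_fun k f)"

definition test_fun :: "R2 set \<Rightarrow> (R2 \<Rightarrow> real) \<Rightarrow> bool" where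
  "test_fun \<Omega> \<phi> \<longleftrightarrow> smooth_fun \<phi> \<and> compact (closure {x. \<phi> x \<noteq> 0}) \<and>
      closure {x. \<phi> x \<noteq> 0} \<subseteq> \<Omega>"

definition locally_integrable_on :: "R2 set \<Rightarrow> (R2 \<Rightarrow> real) \<Rightarrow> bool" where
  "locally_integrable_on \<Omega> f \<longleftrightarrow>
     (\<forall>K. compact K \<and> K \<subseteq> \<Omega> \<longrightarrow> set_integrable lborel K f)"

definition weak_gradient :: "R2 set \<Rightarrow> (R2 \<Rightarrow> real) \<Rightarrow> (R2 \<Rightarrow> R2) \<Rightarrow> bool" where
  "weak_gradient \<Omega> v g \<longleftrightarrow>
     locally_integrable_on \<Omega> v \<and> (\<forall>i. locally_integrable_on \<Omega> (\<lambda>x. g x $ i)) \<and>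
     (\<forall>\<phi> i. test_fun \<Omega> \<phi> \<longrightarrow>
        (LINT x:\<Omega>|lborel. v x * frechet_derivative \<phi> (at x) (axis i 1))
          = - (LINT x:\<Omega>|lborel. g x $ i * \<phi> x))"

definition conf_cap :: "R2 set \<Rightarrow> R2 set \<Rightarrow> R2 set \<Rightarrow> real" where
  "conf_cap F0 F1 \<Omega> = Inf {LINT x:\<Omega>|lborel. (norm (g x))\<^sup>2 | v g.
      continuous_on \<Omega> v \<and> (\<forall>x\<in>\<Omega>. 0 \<le> v x) \<and> weak_gradient \<Omega> v g \<and>
      set_integrable lborel \<Omega> (\<lambda>x. (norm (g x))\<^sup>2) \<and>
      (\<exists>U. open U \<and> F0 \<subseteq> U \<and> (\<forall>x\<in>U \<inter> \<Omega>. v x = 0)) \<and>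
      (\<exists>U. open U \<and> F1 \<subseteq> U \<and> (\<forall>x\<in>U \<inter> \<Omega>. 1 \<le> v x))}"

definition rectifiable_path :: "(real \<Rightarrow> R2) \<Rightarrow> bool" where
  "rectifiable_path \<gamma> \<longleftrightarrow> path \<gamma> \<and>
     (\<exists>B. \<forall>ts. sorted ts \<and> set ts \<subseteq> {0..1} \<longrightarrow>
        (\<Sum>i<length ts - 1. dist (\<gamma> (ts ! i)) (\<gamma> (ts ! Suc i))) \<le> B)"

definition lin_dilatation :: "(R2 \<Rightarrow> R2) \<Rightarrow> R2 \<Rightarrow> ereal" where
  "lin_dilatation h x = Limsup (at_right 0) (\<lambda>r.
      ereal (Sup {dist (h y) (h x) | y. dist y x = r} / Inf {dist (h y) (h x) | y. dist y x = r}))"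

definition quasiconformal_homeo :: "(R2 \<Rightarrow> R2) \<Rightarrow> bool" where
  "quasiconformal_homeo h \<longleftrightarrow> (\<exists>h'. homeomorphism UNIV UNIV h h') \<and>
     (\<exists>K::real. \<forall>x. lin_dilatation h x \<le> ereal K)"

definition cap_metric :: "R2 set \<Rightarrow> R2 set \<Rightarrow> R2 set \<Rightarrow> R2 \<Rightarrow> R2 \<Rightarrow> real" where
  "cap_metric \<Omega> F V x y = Inf {sqrt (conf_cap F (path_image \<gamma> - V) \<Omega>)
        + sqrt (conf_cap (frontier \<Omega>) (path_image \<gamma> \<inter> V) \<Omega>) | \<gamma>.
      rectifiable_path \<gamma> \<and> path_image \<gamma> \<subseteq> \<Omega> \<and> pathstart \<gamma> = x \<and> pathfinish \<gamma> = y}"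

end

theory Submission
  imports Defs
begin

text \<open>
  A continuous function with small Dirichlet energy on a square oscillates little along almost every
  line parallel to an axis, hence along the boundary of a suitable concentric square, and it is
  \<open>L\<^sup>2\<close>-close to a constant \<open>m\<close>. Every connected set that joins the centre to the complement
  of the square meets that boundary, so it contains a point where the function is close to \<open>m\<close>. By
  connectedness of \<open>\<Omega>\<close> the same constant serves on all compact subsets.

  Suppose paths \<open>\<gamma>\<close> leaving a fixed neighbourhood of \<open>x\<close> have capacitary cost tending to 0, and let
  \<open>v\<close>, \<open>w\<close> be almost optimal for \<open>(F, \<gamma> - V)\<close> and \<open>(\<partial>\<Omega>, \<gamma> \<inter> V)\<close>. The constant of \<open>v\<close> tends to 0
  since \<open>v\<close> vanishes on the nondegenerate continuum \<open>F\<close>; that of \<open>w\<close> tends to 0 because otherwise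
  \<open>\<eta> + (1 - \<eta>) w / m\<close>, with a cutoff \<open>\<eta>\<close> equal to 1 near \<open>F\<close>, would have energy below the capacity
  of \<open>(\<partial>\<Omega>, F)\<close>. But \<open>v + w \<ge> 1\<close> on all of \<open>\<gamma>\<close>, a contradiction. Conversely, points have capacity 0
  in the plane (logarithmic cutoffs), so short segments have small cost.
\<close>

section \<open>A smooth step function\<close>

text \<open>A weak gradient speaks only about integrals, while a rectifiable curve is a null set;
  the difficulty is to get information at points of a given curve. Test functions of product form
  provide it: the derivative of such a function in one direction is a difference of two mollifiers,
  so the weak identity becomes a fundamental theorem of calculus averaged over a strip of parallel
  lines, and Lebesgue differentiation isolates single lines. Squares take the place of discs because
  all of this happens in Cartesian coordinates.

  The same positivity prevents \<open>F\<close> from being a single point, which the first potential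
  needs.

  Limits of sequences replace estimates, so that a constant can be carried through \<Omega> without
  counting squares. As \<open>Inf\<close> on the reals says nothing about the empty set, each choice
  of an almost optimal function or curve rests on a proof that some candidate exists.\<close>

fun Ck1 :: "nat \<Rightarrow> (real \<Rightarrow> real) \<Rightarrow> bool" where
  "Ck1 0 f = continuous_on UNIV f"
| "Ck1 (Suc k) f = (\<exists>f'. (\<forall>x. (f has_real_derivative f' x) (at x)) \<and> Ck1 k f')"

lemma Ck1_continuous: "Ck1 k f \<Longrightarrow> continuous_on UNIV f"
  by (cases k) (auto intro!: continuous_at_imp_continuous_on intro: DERIV_isCont)

lemma Ck1_SucD: "Ck1 (Suc k) f \<Longrightarrow> Ck1 k f"
proof (induction k arbitrary: f)
  case 0
  then show ?case using Ck1_continuous[of "Suc 0" f] by simp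
next
  case (Suc k)
  then show ?case by (metis Ck1.simps(2))
qed

lemma Ck1_const: "Ck1 k (\<lambda>x. c)"
proof (induction k arbitrary: c)
  case (Suc k)
  then show ?case by (auto intro!: exI[of _ "\<lambda>x. 0"])
qed auto

lemma Ck1_add: "Ck1 k f \<Longrightarrow> Ck1 k g \<Longrightarrow> Ck1 k (\<lambda>x. f x + g x)"
proof (induction k arbitrary: f g)
  case (Suc k)
  then obtain f' g' where "\<forall>x. (f has_real_derivative f' x) (at x)" "Ck1 k f'"
    "\<forall>x. (g has_real_derivative g' x) (at x)" "Ck1 k g'" by auto
  then show ?case using Suc.IH[of f' g']
    by (auto intro!: exI[of _ "\<lambda>x. f' x + g' x"] derivative_eq_intros)
qed (auto intro: continuous_intros)

lemma Ck1_mult: "Ck1 k f \<Longrightarrow> Ck1 k g \<Longrightarrow> Ck1 k (\<lambda>x. f x * g x)"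
proof (induction k arbitrary: f g)
  case (Suc k)
  then obtain f' g' where d: "\<forall>x. (f has_real_derivative f' x) (at x)" "Ck1 k f'"
    "\<forall>x. (g has_real_derivative g' x) (at x)" "Ck1 k g'" by auto
  have "Ck1 k f" "Ck1 k g" using Suc.prems Ck1_SucD by blast+
  then have "Ck1 k (\<lambda>x. f' x * g x + f x * g' x)"
    using d Suc.IH by (intro Ck1_add) auto
  moreover have "\<forall>x. ((\<lambda>x. f x * g x) has_real_derivative (f' x * g x + f x * g' x)) (at x)"
    using d by (auto intro!: derivative_eq_intros)
  ultimately show ?case unfolding Ck1.simps
    by (intro exI[of _ "\<lambda>x. f' x * g x + f x * g' x"] conjI)
qed (auto intro: continuous_intros)

lemma Ck1_affine: "Ck1 k f \<Longrightarrow> Ck1 k (\<lambda>x. f (a * x + b))"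
proof (induction k arbitrary: f)
  case 0
  then show ?case
    by (auto intro!: continuous_intros continuous_on_compose2[of UNIV f])
next
  case (Suc k)
  then obtain f' where d: "\<And>x. (f has_real_derivative f' x) (at x)" "Ck1 k f'" by auto
  have "((\<lambda>x. f (a * x + b)) has_real_derivative (a * f' (a * x + b))) (at x)" for x
    by (rule DERIV_cong[OF DERIV_chain2[OF d(1), of "\<lambda>x. a * x + b" a]])
       (auto intro!: derivative_eq_intros)
  moreover have "Ck1 k (\<lambda>x. a * f' (a * x + b))"
    using Suc.IH[OF d(2)] by (intro Ck1_mult Ck1_const)
  ultimately show ?case unfolding Ck1.simps
    by (intro exI[of _ "\<lambda>x. a * f' (a * x + b)"] conjI allI)
qed

text \<open>The iterated derivatives of \<open>exp (- (1 / y))\<close>, extended by 0, are linear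
  combinations of these functions. Admitting all exponents at once closes the family under
  differentiation, so smoothness, including at 0, is a single induction.\<close>

definition flat :: "nat \<Rightarrow> real \<Rightarrow> real" where
  "flat k y = (if y > 0 then (1 / y) ^ k * exp (- (1 / y)) else 0)"

lemma flat_tendsto_0: "(flat k \<longlongrightarrow> 0) (at_right 0)"
proof -
  have "((\<lambda>y::real. inverse y ^ k / exp (inverse y)) \<longlongrightarrow> 0) (at_right 0)"
    using filterlim_compose[OF tendsto_power_div_exp_0 filterlim_inverse_at_top_right] .
  then show ?thesis
    by (rule Lim_transform_eventually)
       (auto simp: eventually_at_right_less flat_def exp_minus field_simps inverse_eq_divide
             intro!: eventually_mono[OF eventually_at_right_less])
qed

lemma flat_has_derivative:
  "(flat k has_real_derivative (flat (k + 2) y - real k * flat (k + 1) y)) (at y)"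
proof -
  consider "y > 0" | "y < 0" | "y = 0" by linarith
  then show ?thesis
  proof cases
    case 1
    have "((\<lambda>y. (1 / y) ^ k * exp (- (1 / y))) has_real_derivative
        (flat (k + 2) y - real k * flat (k + 1) y)) (at y)"
    proof -
      have w: "((\<lambda>y. 1 / y) has_real_derivative - ((1 / y)\<^sup>2)) (at y)"
        using 1 by (auto intro!: derivative_eq_intros simp: power2_eq_square)
      have e: "((\<lambda>w. w ^ k * exp (- w)) has_real_derivative
          (real k * w ^ (k - 1) * exp (- w) - w ^ k * exp (- w))) (at w)" for w :: real
        by (auto intro!: derivative_eq_intros)
      have "(real k * w ^ (k - 1) * exp (- w) - w ^ k * exp (- w)) * - (w\<^sup>2)
          = w ^ (k + 2) * exp (- w) - real k * (w ^ (k + 1) * exp (- w))" for w :: real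
        by (cases k) (simp_all add: algebra_simps power2_eq_square)
      then show ?thesis
        using DERIV_chain2[OF e w] 1 by (simp add: flat_def)
    qed
    then show ?thesis
      by (rule has_field_derivative_transform_within_open[of _ _ _ "{0<..}"])
         (use 1 in \<open>auto simp: flat_def\<close>)
  next
    case 2
    have "((\<lambda>y. 0) has_real_derivative (flat (k + 2) y - real k * flat (k + 1) y)) (at y)"
      using 2 by (auto simp: flat_def)
    then show ?thesis
      by (rule has_field_derivative_transform_within_open[of _ _ _ "{..<0}"])
         (use 2 in \<open>auto simp: flat_def\<close>)
  next
    case 3
    \<comment> \<open>For \<open>h > 0\<close> this quotient is \<open>flat (k + 1) h\<close>, the
      next member of the family; for \<open>h < 0\<close> it is 0.\<close>
    have "((\<lambda>h. (flat k (0 + h) - flat k 0) / h) \<longlongrightarrow> 0) (at_right 0)"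
      using flat_tendsto_0[of "k + 1"]
      by (rule Lim_transform_eventually)
         (auto simp: flat_def intro!: eventually_mono[OF eventually_at_right_less])
    moreover have "((\<lambda>h. (flat k (0 + h) - flat k 0) / h) \<longlongrightarrow> 0) (at_left 0)"
      by (rule Lim_transform_eventually[of "\<lambda>_. 0"])
         (auto simp: flat_def eventually_at_filter)
    ultimately show ?thesis using 3 unfolding DERIV_def
      by (simp add: filterlim_split_at flat_def)
  qed
qed

lemma Ck1_flat: "Ck1 n (flat k)"
proof (induction n arbitrary: k)
  case 0
  then show ?case
    by (auto intro!: continuous_at_imp_continuous_on DERIV_isCont flat_has_derivative)
next
  case (Suc n)
  have "Ck1 n (\<lambda>y. flat (k + 2) y + (- real k) * flat (k + 1) y)"
    by (intro Ck1_add Ck1_mult Ck1_const Suc.IH)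
  then show ?case
    using flat_has_derivative[of k]
    by (auto intro!: exI[of _ "\<lambda>y. flat (k + 2) y + (- real k) * flat (k + 1) y"])
qed

text \<open>The derivative is carried along because it has a use of its own: \<open>S\<close> yields
  cutoffs and plateaus, while \<open>b\<close>, a nonnegative bump of total mass 1, is the
  mollifying kernel.\<close>

definition is_step :: "(real \<Rightarrow> real) \<Rightarrow> (real \<Rightarrow> real) \<Rightarrow> bool" where
  "is_step S b \<longleftrightarrow> (\<forall>k. Ck1 k S) \<and> (\<forall>k. Ck1 k b) \<and> (\<forall>x. (S has_real_derivative b x) (at x)) \<and>
     (\<forall>x. 0 \<le> b x) \<and> (\<forall>x. x \<le> 0 \<or> x \<ge> 1 \<longrightarrow> b x = 0) \<and>
     (\<forall>x\<le>0. S x = 0) \<and> (\<forall>x\<ge>1. S x = 1) \<and> (\<forall>x. 0 \<le> S x \<and> S x \<le> 1)"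

lemma is_step_exists: "\<exists>S b. is_step S b"
proof -
  \<comment> \<open>Positive exactly on the open unit interval; the step is its antiderivative,
    normalised to rise from 0 to 1.\<close>
  define b0 where "b0 y = flat 0 y * flat 0 (1 - y)" for y
  have b0s: "Ck1 k b0" for k
    unfolding b0_def using Ck1_affine[of k "flat 0" "-1" 1, OF Ck1_flat]
    by (intro Ck1_mult Ck1_flat) (simp add: add.commute)
  have b0_pos: "b0 y > 0" if "0 < y" "y < 1" for y
    using that by (auto simp: b0_def flat_def)
  have b0_0: "b0 y = 0" if "y \<le> 0 \<or> y \<ge> 1" for y
    using that by (auto simp: b0_def flat_def)
  have b0_ge: "b0 y \<ge> 0" for y by (auto simp: b0_def flat_def)
  \<comment> \<open>Taking the whole line as the interval gives a derivative at every real point,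
    with no one-sided cases at end points.\<close>
  have "\<exists>F. \<forall>x. (-\<infinity>::ereal) < ereal x \<longrightarrow> ereal x < \<infinity> \<longrightarrow> (F has_vector_derivative b0 x) (at x)"
    by (rule einterval_antiderivative)
       (use Ck1_continuous[OF b0s] in \<open>auto simp: continuous_on_eq_continuous_at\<close>)
  then obtain F where F: "\<And>x. (F has_real_derivative b0 x) (at x)"
    by (auto simp: has_real_derivative_iff_has_vector_derivative)
  have mono: "F x \<le> F y" if "x \<le> y" for x y
    using DERIV_nonneg_imp_nondecreasing[OF that] F b0_ge by blast
  have F0: "F x = F 0" if "x \<le> 0" for x
  proof (cases "x = 0")
    case False
    then have "x < 0" using that by auto
    then obtain z where "z < 0" "F 0 - F x = (0 - x) * b0 z" using MVT2[of x 0 F b0] F by auto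
    then show ?thesis using b0_0[of z] by auto
  qed auto
  have F1: "F x = F 1" if "x \<ge> 1" for x
  proof (cases "x = 1")
    case False
    then have "x > 1" using that by auto
    then obtain z where "z > 1" "F x - F 1 = (x - 1) * b0 z" using MVT2[of 1 x F b0] F by auto
    then show ?thesis using b0_0[of z] by auto
  qed auto
  \<comment> \<open>The increment is the value of \<open>b0\<close> at an interior point, hence
    positive, so that dividing by it is legitimate.\<close>
  obtain z where z: "0 < z" "z < 1" "F 1 - F 0 = (1 - 0) * b0 z" using MVT2[of 0 1 F b0] F by auto
  then have c: "F 1 - F 0 > 0" using b0_pos[of z] by auto
  define S where "S x = (F x - F 0) / (F 1 - F 0)" for x
  define b where "b x = b0 x / (F 1 - F 0)" for x
  have bs: "Ck1 k b" for k
    unfolding b_def divide_inverse by (intro Ck1_mult b0s Ck1_const)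
  have dS: "(S has_real_derivative b x) (at x)" for x
    unfolding S_def b_def using c F[of x] by (auto intro!: derivative_eq_intros)
  have "Ck1 (Suc k) S" for k using bs dS by auto
  then have Ss: "Ck1 k S" for k using Ck1_SucD by blast
  have "0 \<le> S x \<and> S x \<le> 1" for x
  proof -
    have "F 0 \<le> F x" using mono[of 0 x] F0[of x] by linarith
    moreover have "F x \<le> F 1" using mono[of x 1] F1[of x] by linarith
    ultimately show ?thesis using c by (auto simp: S_def field_simps)
  qed
  moreover have "S x = 0" if "x \<le> 0" for x using F0[OF that] by (simp add: S_def)
  moreover have "S x = 1" if "x \<ge> 1" for x using F1[OF that] c by (simp add: S_def)
  moreover have "b x = 0" if "x \<le> 0 \<or> x \<ge> 1" for x using b0_0[OF that] by (simp add: b_def)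
  moreover have "0 \<le> b x" for x using b0_ge[of x] c by (simp add: b_def)
  ultimately have "is_step S b"
    unfolding is_step_def using bs Ss dS by blast
  then show ?thesis by blast
qed

definition step :: "real \<Rightarrow> real" where "step = (SOME S. \<exists>b. is_step S b)"
definition dstep :: "real \<Rightarrow> real" where "dstep = (SOME b. is_step step b)"

lemma is_step_step: "is_step step dstep"
proof -
  have "\<exists>b. is_step step b"
    unfolding step_def using is_step_exists by (rule someI_ex)
  then show ?thesis unfolding dstep_def by (rule someI_ex)
qed

lemma
  shows Ck1_step: "Ck1 k step"
    and Ck1_dstep: "Ck1 k dstep"
    and step_deriv: "(step has_real_derivative dstep x) (at x)"
    and dstep_nonneg: "0 \<le> dstep x"
    and dstep_eq_0: "x \<le> 0 \<or> x \<ge> 1 \<Longrightarrow> dstep x = 0"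
    and step_eq_0: "x \<le> 0 \<Longrightarrow> step x = 0"
    and step_eq_1: "x \<ge> 1 \<Longrightarrow> step x = 1"
    and step_nonneg: "0 \<le> step x"
    and step_le_1: "step x \<le> 1"
  using is_step_step unfolding is_step_def by blast+

lemma dstep_continuous: "continuous_on A dstep"
  using Ck1_continuous[OF Ck1_dstep] continuous_on_subset by blast

lemma dstep_has_integral: "has_bochner_integral lborel dstep 1"
proof -
  have "has_bochner_integral lborel (\<lambda>x. dstep x * indicator {0..1} x) (step 1 - step 0)"
    by (rule has_bochner_integral_FTC_Icc_real)
       (use step_deriv dstep_continuous[of UNIV] in \<open>auto simp: continuous_on_eq_continuous_at\<close>)
  moreover have "dstep x * indicator {0..1} x = dstep x" for x
    using dstep_eq_0[of x] by (cases "0 \<le> x \<and> x \<le> 1") auto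
  ultimately show ?thesis by (simp add: step_eq_0 step_eq_1)
qed

section \<open>Smooth functions of two variables\<close>

lemma Ck_fun_continuous: "Ck_fun k f \<Longrightarrow> continuous_on UNIV f"
  by (cases k) auto

text \<open>\<open>Ck_fun\<close> is phrased with \<open>frechet_derivative\<close>, which any
  exhibited derivative determines; the closure rules can therefore work with explicit
  formulas.\<close>

lemma Ck_fun_SucI:
  assumes d: "\<And>x. (f has_derivative f' x) (at x)"
    and "\<And>i. Ck_fun k (\<lambda>x. f' x (axis i 1))"
  shows "Ck_fun (Suc k) f"
proof -
  have "frechet_derivative f (at x) = f' x" for x
    using frechet_derivative_at[OF d[of x]] by simp
  then show ?thesis using assms
    by (auto simp: differentiable_def
        intro!: continuous_at_imp_continuous_on has_derivative_continuous)
qed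

lemma Ck_fun_Suc_has_derivative:
  "Ck_fun (Suc k) f \<Longrightarrow> (f has_derivative frechet_derivative f (at x)) (at x)"
  by (auto simp: frechet_derivative_works)

lemma Ck_fun_SucD: "Ck_fun (Suc k) f \<Longrightarrow> Ck_fun k f"
proof (induction k arbitrary: f)
  case (Suc k)
  then show ?case unfolding Ck_fun.simps by metis
qed auto

lemma Ck_fun_const: "Ck_fun k (\<lambda>x. c)"
proof (induction k arbitrary: c)
  case (Suc k)
  then show ?case by (intro Ck_fun_SucI[of _ "\<lambda>_ _. 0"]) auto
qed auto

lemma Ck_fun_add: "Ck_fun k f \<Longrightarrow> Ck_fun k g \<Longrightarrow> Ck_fun k (\<lambda>x. f x + g x)"
proof (induction k arbitrary: f g)
  case (Suc k)
  show ?case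
    by (rule Ck_fun_SucI, rule has_derivative_add[OF Ck_fun_Suc_has_derivative Ck_fun_Suc_has_derivative])
       (use Suc in auto)
qed (auto intro: continuous_intros)

lemma Ck_fun_mult: "Ck_fun k f \<Longrightarrow> Ck_fun k g \<Longrightarrow> Ck_fun k (\<lambda>x. f x * g x)"
proof (induction k arbitrary: f g)
  case (Suc k)
  have "Ck_fun k f" "Ck_fun k g" using Suc.prems Ck_fun_SucD by blast+
  then show ?case
    by (intro Ck_fun_SucI[OF has_derivative_mult[OF Ck_fun_Suc_has_derivative Ck_fun_Suc_has_derivative]])
       (use Suc in \<open>auto intro!: Ck_fun_add\<close>)
qed (auto intro: continuous_intros)

lemma Ck_fun_coord: "Ck1 k a \<Longrightarrow> Ck_fun k (\<lambda>x. a (x $ i))"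
proof (induction k arbitrary: a)
  case 0
  then show ?case
    by (auto intro!: continuous_intros continuous_on_compose2[of UNIV a])
next
  case (Suc k)
  then obtain a' where a': "\<And>x. (a has_real_derivative a' x) (at x)" "Ck1 k a'" by auto
  show ?case
  proof (rule Ck_fun_SucI)
    fix x :: R2
    have "((\<lambda>x::R2. x $ i) has_derivative (\<lambda>h. h $ i)) (at x)"
      by (rule bounded_linear_imp_has_derivative) (rule bounded_linear_vec_nth)
    from has_derivative_compose[OF this, of a "(*) (a' (x $ i))"] a'(1)[of "x $ i"]
    show "((\<lambda>x. a (x $ i)) has_derivative (\<lambda>h. a' (x $ i) * h $ i)) (at x)"
      by (auto simp: has_field_derivative_def)
  next
    fix j
    show "Ck_fun k (\<lambda>x. a' (x $ i) * axis j 1 $ i)"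
      using Suc.IH[OF a'(2)] by (intro Ck_fun_mult Ck_fun_const)
  qed
qed

lemma smooth_fun_const: "smooth_fun (\<lambda>x. c)"
  and smooth_fun_add: "smooth_fun f \<Longrightarrow> smooth_fun g \<Longrightarrow> smooth_fun (\<lambda>x. f x + g x)"
  and smooth_fun_mult: "smooth_fun f \<Longrightarrow> smooth_fun g \<Longrightarrow> smooth_fun (\<lambda>x. f x * g x)"
  by (auto simp: smooth_fun_def Ck_fun_const Ck_fun_add Ck_fun_mult)

lemma smooth_fun_diff: "smooth_fun f \<Longrightarrow> smooth_fun g \<Longrightarrow> smooth_fun (\<lambda>x. f x - g x)"
  using smooth_fun_add[OF _ smooth_fun_mult[OF smooth_fun_const[of "-1"]], of f g] by simp

lemma smooth_fun_sum:
  "(\<And>i. i \<in> I \<Longrightarrow> smooth_fun (f i)) \<Longrightarrow> smooth_fun (\<lambda>x. \<Sum>i\<in>I. f i x)"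
  by (induction I rule: infinite_finite_induct) (auto intro: smooth_fun_const smooth_fun_add)

lemma smooth_fun_prod:
  "(\<And>i. i \<in> I \<Longrightarrow> smooth_fun (f i)) \<Longrightarrow> smooth_fun (\<lambda>x. \<Prod>i\<in>I. f i x)"
  by (induction I rule: infinite_finite_induct) (auto intro: smooth_fun_const smooth_fun_mult)

lemma smooth_fun_coord: "(\<And>k. Ck1 k a) \<Longrightarrow> smooth_fun (\<lambda>x. a (x $ i))"
  by (auto simp: smooth_fun_def Ck_fun_coord)

definition grad :: "(R2 \<Rightarrow> real) \<Rightarrow> R2 \<Rightarrow> R2" where
  "grad f x = (\<chi> i. frechet_derivative f (at x) (axis i 1))"

lemma grad_nth: "grad f x $ i = frechet_derivative f (at x) (axis i 1)"
  by (simp add: grad_def)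

lemma smooth_fun_has_derivative:
  "smooth_fun f \<Longrightarrow> (f has_derivative frechet_derivative f (at x)) (at x)"
  unfolding smooth_fun_def using Ck_fun_Suc_has_derivative[of 0] by blast

lemma grad_eqI: "(f has_derivative f') (at x) \<Longrightarrow> grad f x = (\<chi> i. f' (axis i 1))"
  using frechet_derivative_at[of f f' x] by (simp add: grad_def)

lemma smooth_fun_continuous: "smooth_fun f \<Longrightarrow> continuous_on A f"
  unfolding smooth_fun_def using Ck_fun_continuous continuous_on_subset by blast

lemma smooth_fun_partial: "smooth_fun f \<Longrightarrow> smooth_fun (\<lambda>x. grad f x $ i)"
  unfolding smooth_fun_def grad_nth by (metis Ck_fun.simps(2))

lemma grad_continuous: "smooth_fun f \<Longrightarrow> continuous_on A (grad f)"
  using smooth_fun_continuous[OF smooth_fun_partial]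
  by (subst continuous_on_componentwise) (auto simp: Basis_vec_def inner_axis)

lemma grad_const: "grad (\<lambda>x. c) x = 0"
  by (subst grad_eqI[of _ "\<lambda>_. 0"]) (auto simp: vec_eq_iff)

lemma grad_add: "smooth_fun f \<Longrightarrow> smooth_fun g \<Longrightarrow> grad (\<lambda>x. f x + g x) x = grad f x + grad g x"
  by (subst grad_eqI[OF has_derivative_add[OF smooth_fun_has_derivative smooth_fun_has_derivative]])
     (auto simp: vec_eq_iff grad_nth)

lemma grad_mult: "smooth_fun f \<Longrightarrow> smooth_fun g \<Longrightarrow>
    grad (\<lambda>x. f x * g x) x = f x *\<^sub>R grad g x + g x *\<^sub>R grad f x"
  by (subst grad_eqI[OF has_derivative_mult[OF smooth_fun_has_derivative smooth_fun_has_derivative]])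
     (auto simp: vec_eq_iff grad_nth)

lemma grad_cmult: "smooth_fun f \<Longrightarrow> grad (\<lambda>x. c * f x) x = c *\<^sub>R grad f x"
  by (subst grad_mult) (auto intro: smooth_fun_const simp: grad_const)

lemma grad_sum:
  "(\<And>i. i \<in> I \<Longrightarrow> smooth_fun (f i)) \<Longrightarrow> grad (\<lambda>x. \<Sum>i\<in>I. f i x) x = (\<Sum>i\<in>I. grad (f i) x)"
  by (induction I rule: infinite_finite_induct) (auto simp: grad_const grad_add smooth_fun_sum)

lemma grad_cong: "eventually (\<lambda>y. f y = g y) (nhds x) \<Longrightarrow> grad f x = grad g x"
proof -
  assume e: "eventually (\<lambda>y. f y = g y) (nhds x)"
  then obtain U where U: "open U" "x \<in> U" "\<And>y. y \<in> U \<Longrightarrow> f y = g y"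
    by (auto simp: eventually_nhds)
  have "(f has_derivative D) (at x) \<longleftrightarrow> (g has_derivative D) (at x)" for D
    using has_derivative_transform_within_open[OF _ U(1,2), of f D UNIV g]
      has_derivative_transform_within_open[OF _ U(1,2), of g D UNIV f] U(3) by metis
  then show ?thesis by (simp add: grad_def frechet_derivative_def)
qed

lemma grad_eq_0: "open U \<Longrightarrow> x \<in> U \<Longrightarrow> (\<And>y. y \<in> U \<Longrightarrow> f y = c) \<Longrightarrow> grad f x = 0"
  by (subst grad_cong[of f "\<lambda>_. c"]) (auto simp: grad_const eventually_nhds)

lemma grad_coord:
  assumes "(a has_real_derivative a') (at (x $ i))"
  shows "grad (\<lambda>x. a (x $ i)) x = a' *\<^sub>R axis i 1"
proof -
  have "((\<lambda>x::R2. x $ i) has_derivative (\<lambda>h. h $ i)) (at x)"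
    by (rule bounded_linear_imp_has_derivative) (rule bounded_linear_vec_nth)
  from has_derivative_compose[OF this, of a "(*) a'"] assms
  have "((\<lambda>x. a (x $ i)) has_derivative (\<lambda>h. a' * h $ i)) (at x)"
    by (auto simp: has_field_derivative_def)
  then show ?thesis by (subst grad_eqI) (auto simp: vec_eq_iff axis_def)
qed

section \<open>Weak gradients\<close>

lemma continuous_compact_support_integrable:
  fixes f :: "R2 \<Rightarrow> real"
  assumes "continuous_on UNIV f" "compact K" "\<And>x. x \<notin> K \<Longrightarrow> f x = 0"
  shows "integrable lborel f"
proof -
  have "integrable lborel (\<lambda>x. indicator K x *\<^sub>R f x)"
    using assms by (intro borel_integrable_compact) (auto intro: continuous_on_subset)
  moreover have "(\<lambda>x. indicator K x *\<^sub>R f x) = f" using assms(3) by (fastforce simp: indicator_def fun_eq_iff)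
  ultimately show ?thesis by simp
qed

lemma grad_eq_0_outside:
  assumes "closed K" "\<And>x. x \<notin> K \<Longrightarrow> f x = 0" "x \<notin> K"
  shows "grad f x = 0"
  using assms by (intro grad_eq_0[of "- K" x f 0]) auto

lemma has_real_derivative_line:
  assumes "smooth_fun f"
  shows "((\<lambda>t. f (x + t *\<^sub>R axis i 1)) has_real_derivative grad f (x + t *\<^sub>R axis i 1) $ i) (at t)"
proof -
  have "((\<lambda>t::real. x + t *\<^sub>R axis i 1) has_derivative (\<lambda>h. h *\<^sub>R axis i 1)) (at t)"
    by (auto intro!: derivative_eq_intros)
  from has_derivative_compose[OF this smooth_fun_has_derivative[OF assms]]
  have d: "((\<lambda>t. f (x + t *\<^sub>R axis i 1)) has_derivative
      (\<lambda>h. frechet_derivative f (at (x + t *\<^sub>R axis i 1)) (h *\<^sub>R axis i 1))) (at t)" .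
  have "linear (frechet_derivative f (at (x + t *\<^sub>R axis i 1)))"
    using smooth_fun_has_derivative[OF assms] has_derivative_linear by blast
  then have "(\<lambda>h. frechet_derivative f (at (x + t *\<^sub>R axis i 1)) (h *\<^sub>R axis i 1)) = 
      (*) (grad f (x + t *\<^sub>R axis i 1) $ i)"
    by (auto simp: linear_cmul grad_nth)
  then show ?thesis using d by (simp add: has_field_derivative_def)
qed

text \<open>Translation invariance of Lebesgue measure makes the integral of every difference
  quotient vanish, and dominated convergence passes to the derivative. Integration by parts for
  smooth functions is this fact for a product.\<close>

lemma integral_partial_eq_0:
  assumes f: "smooth_fun f" and K: "compact K" "\<And>x. x \<notin> K \<Longrightarrow> f x = 0"
  shows "(LINT x|lborel. grad f x $ i) = 0"
proof -
  define e :: R2 where "e = axis i 1"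
  have ne: "norm e = 1" by (simp add: e_def norm_axis_1)
  have gz: "grad f x = 0" if "x \<notin> K" for x
    using grad_eq_0_outside[of K f x] K that compact_imp_closed by blast
  have "compact ((\<lambda>x. grad f x $ i) ` K)"
    using smooth_fun_continuous[OF smooth_fun_partial[OF f]] K by (intro compact_continuous_image)
  then obtain M0 where M0: "\<And>x. x \<in> K \<Longrightarrow> \<bar>grad f x $ i\<bar> \<le> M0"
    by (meson bounded_real compact_imp_bounded imageI)
  define M where "M = max M0 0"
  have M: "\<bar>grad f x $ i\<bar> \<le> M" for x
    using M0[of x] gz[of x] by (cases "x \<in> K") (auto simp: M_def)
  obtain R where R: "\<And>x. x \<in> K \<Longrightarrow> norm x \<le> R" using K(1) compact_imp_bounded bounded_iff by metis
  define q where "q n x = (f (x + (1 / real (Suc n)) *\<^sub>R e) - f x) / (1 / real (Suc n))" for n x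
  have int_f: "integrable lborel f"
    using continuous_compact_support_integrable[OF smooth_fun_continuous[OF f] K] .
  have "(LINT x|lborel. f (c + x)) = (LINT x|lborel. f x) \<and> integrable lborel (\<lambda>x. f (c + x))" for c
  proof -
    have m: "f \<in> borel_measurable borel" using int_f by auto
    have "integrable (distr lborel borel ((+) c)) f" using int_f by (simp add: lborel_distr_plus)
    then have "integrable lborel (\<lambda>x. f (c + x))" using m by (subst (asm) integrable_distr_eq) auto
    moreover have "(LINT x|distr lborel borel ((+) c). f x) = (LINT x|lborel. f (c + x))"
      using m by (subst integral_distr) auto
    ultimately show ?thesis by (simp add: lborel_distr_plus)
  qed
  then have q0: "(LINT x|lborel. q n x) = 0" for n
    unfolding q_def using int_f by (simp add: add.commute[of _ "_ *\<^sub>R e"] del: of_nat_Suc)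
  have lim: "(\<lambda>n. q n x) \<longlonglongrightarrow> grad f x $ i" for x
  proof -
    have "((\<lambda>h. (f (x + (0 + h) *\<^sub>R e) - f (x + 0 *\<^sub>R e)) / h) \<longlongrightarrow> grad f (x + 0 *\<^sub>R e) $ i) (at 0)"
      using has_real_derivative_line[OF f, of x i 0] unfolding DERIV_def e_def .
    then have "((\<lambda>h. (f (x + h *\<^sub>R e) - f x) / h) \<longlongrightarrow> grad f x $ i) (at 0)" by simp
    moreover have "filterlim (\<lambda>n. 1 / real (Suc n)) (at 0) sequentially"
      unfolding filterlim_at using LIMSEQ_inverse_real_of_nat by (auto simp: inverse_eq_divide)
    ultimately show ?thesis unfolding q_def by (rule filterlim_compose)
  qed
  \<comment> \<open>By the mean value theorem \<open>q n x\<close> is the partial derivative at a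
    point within distance 1 of \<open>x\<close>; hence the radius \<open>R + 1\<close> of the common
    support.\<close>
  have bound: "norm (q n x) \<le> M * indicator (cball 0 (R + 1)) x" for n x
  proof -
    have h: "0 < 1 / real (Suc n)" "1 / real (Suc n) \<le> 1" by auto
    from MVT2[OF h(1), of "\<lambda>t. f (x + t *\<^sub>R e)" "\<lambda>t. grad f (x + t *\<^sub>R e) $ i"]
    obtain z where z: "f (x + (1 / real (Suc n)) *\<^sub>R e) - f x = (1 / real (Suc n)) * grad f (x + z *\<^sub>R e) $ i"
      "0 < z" "z < 1 / real (Suc n)"
      using has_real_derivative_line[OF f] unfolding e_def by auto
    then have qz: "q n x = grad f (x + z *\<^sub>R e) $ i" unfolding q_def by (simp del: of_nat_Suc)
    show ?thesis
    proof (cases "x \<in> cball 0 (R + 1)")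
      case True
      then show ?thesis using M qz by simp
    next
      case False
      then have "norm x > R + 1" by simp
      moreover have "norm (z *\<^sub>R e) \<le> 1" using z(2) less_le_trans[OF z(3) h(2)] ne by simp
      ultimately have "norm (x + z *\<^sub>R e) > R"
        using norm_triangle_ineq2[of x "- (z *\<^sub>R e)"] by auto
      then have "x + z *\<^sub>R e \<notin> K" using R[of "x + z *\<^sub>R e"] by auto
      then show ?thesis using gz[of "x + z *\<^sub>R e"] qz False by simp
    qed
  qed
  have "(\<lambda>n. LINT x|lborel. q n x) \<longlonglongrightarrow> (LINT x|lborel. grad f x $ i)"
  proof (rule integral_dominated_convergence[where w = "\<lambda>x. M * indicator (cball 0 (R + 1)) x"])
    show "integrable lborel (\<lambda>x::R2. M * indicator (cball 0 (R + 1)) x)"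
      using borel_integrable_compact[of "cball 0 (R + 1) :: R2 set" "\<lambda>_. M"]
      by (simp add: mult.commute)
    show "(\<lambda>x. grad f x $ i) \<in> borel_measurable lborel"
      using smooth_fun_continuous[OF smooth_fun_partial[OF f]]
      by (simp add: borel_measurable_continuous_onI)
    show "q n \<in> borel_measurable lborel" for n
    proof -
      have "continuous_on UNIV (\<lambda>x. f (x + (1 / real (Suc n)) *\<^sub>R e))"
        by (rule continuous_on_compose2[OF smooth_fun_continuous[OF f, of UNIV]])
           (auto intro: continuous_intros)
      then have "continuous_on UNIV (q n)"
        unfolding q_def using smooth_fun_continuous[OF f, of UNIV]
        by (intro continuous_on_divide continuous_on_diff continuous_on_const) auto
      then show ?thesis by (simp add: borel_measurable_continuous_onI)
    qed
  qed (use lim bound in auto)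
  then show ?thesis by (simp add: q0 LIMSEQ_const_iff)
qed

lemma locally_integrable_continuous:
  "continuous_on \<Omega> f \<Longrightarrow> locally_integrable_on \<Omega> f"
  unfolding locally_integrable_on_def set_integrable_def
  by (blast intro: borel_integrable_compact continuous_on_subset)

lemma continuous_bound_on_compact:
  fixes c :: "R2 \<Rightarrow> real"
  assumes "continuous_on K c" "compact K"
  obtains M where "M \<ge> 0" "\<And>x. x \<in> K \<Longrightarrow> \<bar>c x\<bar> \<le> M"
proof -
  have "bounded (c ` K)" using assms compact_continuous_image compact_imp_bounded by blast
  then show ?thesis using that unfolding bounded_pos bounded_real
    by (metis bounded_pos image_eqI real_norm_def less_imp_le \<open>bounded (c ` K)\<close>)
qed

lemma set_integrable_mult_continuous:
  fixes f c :: "R2 \<Rightarrow> real"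
  assumes f: "set_integrable lborel K f" and c: "continuous_on K c" and K: "compact K"
  shows "set_integrable lborel K (\<lambda>x. f x * c x)"
proof -
  obtain M where M: "M \<ge> 0" "\<And>x. x \<in> K \<Longrightarrow> \<bar>c x\<bar> \<le> M"
    using continuous_bound_on_compact[OF c K] by blast
  have mc: "(\<lambda>x. indicator K x * c x) \<in> borel_measurable lborel"
    using borel_measurable_integrable[OF borel_integrable_compact[OF K c]] by simp
  \<comment> \<open>Neither factor is known to be measurable off \<open>K\<close>, so each one is
    cut off separately.\<close>
  have "(\<lambda>x. (indicator K x * f x) * (indicator K x * c x)) \<in> borel_measurable lborel"
    using borel_measurable_integrable[OF f[unfolded set_integrable_def]] mc
    by (intro borel_measurable_times[where f = "\<lambda>x. indicator K x * f x"]) simp_all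
  moreover have "(\<lambda>x. (indicator K x * f x) * (indicator K x * c x)) = (\<lambda>x. indicator K x *\<^sub>R (f x * c x))"
    by (auto simp: indicator_def)
  ultimately have m: "(\<lambda>x. indicator K x *\<^sub>R (f x * c x)) \<in> borel_measurable lborel" by simp
  have "integrable lborel (\<lambda>x. M * (indicator K x *\<^sub>R f x))"
    using f unfolding set_integrable_def by auto
  then show ?thesis unfolding set_integrable_def
  proof (rule Bochner_Integration.integrable_bound)
    show "AE x in lborel. norm (indicat_real K x *\<^sub>R (f x * c x)) \<le> norm (M * indicat_real K x *\<^sub>R f x)"
      using M by (auto simp: indicator_def abs_mult mult.commute intro!: mult_right_mono)
  qed (rule m)
qed

lemma locally_integrable_mult_continuous:
  "locally_integrable_on \<Omega> f \<Longrightarrow> continuous_on \<Omega> c \<Longrightarrow> locally_integrable_on \<Omega> (\<lambda>x. f x * c x)"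
  unfolding locally_integrable_on_def
  by (auto intro!: set_integrable_mult_continuous intro: continuous_on_subset)

lemma locally_integrable_add:
  "locally_integrable_on \<Omega> f \<Longrightarrow> locally_integrable_on \<Omega> g \<Longrightarrow> locally_integrable_on \<Omega> (\<lambda>x. f x + g x)"
  unfolding locally_integrable_on_def by (auto intro: set_integral_add)

lemma set_integrable_compact_support:
  assumes f: "locally_integrable_on \<Omega> f" and c: "continuous_on UNIV c"
    and K: "compact K" "K \<subseteq> \<Omega>" "\<And>x. x \<notin> K \<Longrightarrow> c x = 0"
  shows "set_integrable lborel \<Omega> (\<lambda>x. f x * c x)"
proof -
  have "set_integrable lborel K (\<lambda>x. f x * c x)"
    using f K continuous_on_subset[OF c subset_UNIV] unfolding locally_integrable_on_def
    by (intro set_integrable_mult_continuous) auto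
  moreover have "(\<lambda>x. indicat_real K x *\<^sub>R (f x * c x)) = (\<lambda>x. indicat_real \<Omega> x *\<^sub>R (f x * c x))"
    using K by (fastforce simp: indicator_def fun_eq_iff)
  ultimately show ?thesis unfolding set_integrable_def by simp
qed

lemma set_lint_compact_support:
  fixes h :: "R2 \<Rightarrow> real"
  assumes "K \<subseteq> \<Omega>" "\<And>x. x \<notin> K \<Longrightarrow> h x = 0"
  shows "(LINT x:\<Omega>|lborel. h x) = (LINT x|lborel. h x)"
  unfolding set_lebesgue_integral_def using assms
  by (intro Bochner_Integration.integral_cong) (auto simp: indicator_def)

lemma test_funD:
  assumes "test_fun \<Omega> \<phi>"
  obtains K where "smooth_fun \<phi>" "compact K" "K \<subseteq> \<Omega>" "\<And>x. x \<notin> K \<Longrightarrow> \<phi> x = 0"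
    "\<And>x. x \<notin> K \<Longrightarrow> grad \<phi> x = 0"
proof (rule that)
  let ?K = "closure {x. \<phi> x \<noteq> 0}"
  show "smooth_fun \<phi>" "compact ?K" "?K \<subseteq> \<Omega>" using assms by (auto simp: test_fun_def)
  show z: "\<phi> x = 0" if "x \<notin> ?K" for x
    using that subsetD[OF closure_subset[of "{x. \<phi> x \<noteq> 0}"], of x] by fast
  show "grad \<phi> x = 0" if "x \<notin> ?K" for x by (rule grad_eq_0_outside[OF closed_closure z that])
qed

lemma test_funI:
  assumes "smooth_fun \<phi>" "compact K" "K \<subseteq> \<Omega>" "\<And>x. x \<notin> K \<Longrightarrow> \<phi> x = 0"
  shows "test_fun \<Omega> \<phi>"
proof -
  have "closure {x. \<phi> x \<noteq> 0} \<subseteq> K"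
    using assms by (intro closure_minimal) (auto simp: compact_imp_closed)
  then have "compact (closure {x. \<phi> x \<noteq> 0})"
    using assms(2) by (metis closed_closure compact_Int_closed inf.absorb_iff2)
  then show ?thesis using assms \<open>_ \<subseteq> K\<close> unfolding test_fun_def by blast
qed

lemma weak_gradientD:
  "weak_gradient \<Omega> v g \<Longrightarrow> test_fun \<Omega> \<phi> \<Longrightarrow>
    (LINT x:\<Omega>|lborel. v x * grad \<phi> x $ i) = - (LINT x:\<Omega>|lborel. g x $ i * \<phi> x)"
  unfolding weak_gradient_def grad_nth by blast

lemma weak_gradientI:
  assumes "locally_integrable_on \<Omega> v" "\<And>i. locally_integrable_on \<Omega> (\<lambda>x. g x $ i)"
    "\<And>\<phi> i. test_fun \<Omega> \<phi> \<Longrightarrow>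
      (LINT x:\<Omega>|lborel. v x * grad \<phi> x $ i) = - (LINT x:\<Omega>|lborel. g x $ i * \<phi> x)"
  shows "weak_gradient \<Omega> v g"
  using assms unfolding weak_gradient_def grad_nth by blast

lemma weak_gradient_locally_integrable:
  "weak_gradient \<Omega> v g \<Longrightarrow> locally_integrable_on \<Omega> v"
  "weak_gradient \<Omega> v g \<Longrightarrow> locally_integrable_on \<Omega> (\<lambda>x. g x $ i)"
  unfolding weak_gradient_def by auto

text \<open>The product rule reduces this to \<open>integral_partial_eq_0\<close> for
  \<open>v * \<phi>\<close>, whose compact support comes from the test function.\<close>

lemma weak_gradient_smooth:
  assumes v: "smooth_fun v"
  shows "weak_gradient \<Omega> v (grad v)"
proof (rule weak_gradientI)
  show "locally_integrable_on \<Omega> v" "locally_integrable_on \<Omega> (\<lambda>x. grad v x $ i)" for i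
    using v by (auto intro!: locally_integrable_continuous smooth_fun_continuous smooth_fun_partial)
next
  fix \<phi> i assume "test_fun \<Omega> \<phi>"
  then obtain K where p: "smooth_fun \<phi>" "compact K" "K \<subseteq> \<Omega>" "\<And>x. x \<notin> K \<Longrightarrow> \<phi> x = 0"
    "\<And>x. x \<notin> K \<Longrightarrow> grad \<phi> x = 0" by (rule test_funD) blast
  note cont = smooth_fun_continuous[OF v] smooth_fun_continuous[OF p(1)]
    smooth_fun_continuous[OF smooth_fun_partial[OF v]] smooth_fun_continuous[OF smooth_fun_partial[OF p(1)]]
  have "integrable lborel (\<lambda>x. v x * grad \<phi> x $ i)" "integrable lborel (\<lambda>x. grad v x $ i * \<phi> x)"
    by (rule continuous_compact_support_integrable[of _ K], intro continuous_on_mult cont,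
        use p in simp_all)+
  moreover have "(LINT x|lborel. grad (\<lambda>x. v x * \<phi> x) x $ i) = 0"
    using v p by (intro integral_partial_eq_0[of _ K] smooth_fun_mult) auto
  ultimately have "(LINT x|lborel. v x * grad \<phi> x $ i) = - (LINT x|lborel. grad v x $ i * \<phi> x)"
    using v p by (simp add: grad_mult mult.commute)
  then show "(LINT x:\<Omega>|lborel. v x * grad \<phi> x $ i) = - (LINT x:\<Omega>|lborel. grad v x $ i * \<phi> x)"
    using set_lint_compact_support[of K \<Omega> "\<lambda>x. v x * grad \<phi> x $ i"]
      set_lint_compact_support[of K \<Omega> "\<lambda>x. grad v x $ i * \<phi> x"] p(3-5) by simp
qed

lemma weak_gradient_add:
  assumes v: "weak_gradient \<Omega> v g" and w: "weak_gradient \<Omega> w h"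
  shows "weak_gradient \<Omega> (\<lambda>x. v x + w x) (\<lambda>x. g x + h x)"
proof (rule weak_gradientI)
  note L = weak_gradient_locally_integrable[OF v] weak_gradient_locally_integrable[OF w]
  show "locally_integrable_on \<Omega> (\<lambda>x. v x + w x)" "locally_integrable_on \<Omega> (\<lambda>x. (g x + h x) $ i)" for i
    using L by (auto intro!: locally_integrable_add)
  fix \<phi> i assume t: "test_fun \<Omega> \<phi>"
  then obtain K where p: "smooth_fun \<phi>" "compact K" "K \<subseteq> \<Omega>" "\<And>x. x \<notin> K \<Longrightarrow> \<phi> x = 0"
    "\<And>x. x \<notin> K \<Longrightarrow> grad \<phi> x = 0" by (rule test_funD) blast
  have "set_integrable lborel \<Omega> (\<lambda>x. v x * grad \<phi> x $ i)" "set_integrable lborel \<Omega> (\<lambda>x. w x * grad \<phi> x $ i)"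
    "set_integrable lborel \<Omega> (\<lambda>x. g x $ i * \<phi> x)" "set_integrable lborel \<Omega> (\<lambda>x. h x $ i * \<phi> x)"
    using L p smooth_fun_continuous[OF p(1)] smooth_fun_continuous[OF smooth_fun_partial[OF p(1)]]
    by (auto intro!: set_integrable_compact_support[of _ _ _ K])
  then show "(LINT x:\<Omega>|lborel. (v x + w x) * grad \<phi> x $ i) = - (LINT x:\<Omega>|lborel. (g x + h x) $ i * \<phi> x)"
    using weak_gradientD[OF v t, of i] weak_gradientD[OF w t, of i]
    by (simp add: ring_distribs set_integral_add)
qed

text \<open>The factor is moved onto the test function: \<open>c * \<phi>\<close> is again a test
  function, and expanding its gradient produces the term with \<open>grad c\<close>.\<close>

lemma weak_gradient_mult_smooth:
  assumes v: "weak_gradient \<Omega> v g" and c: "smooth_fun c"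
  shows "weak_gradient \<Omega> (\<lambda>x. c x * v x) (\<lambda>x. c x *\<^sub>R g x + v x *\<^sub>R grad c x)"
proof (rule weak_gradientI)
  note L = weak_gradient_locally_integrable[OF v]
  note cc = smooth_fun_continuous[OF c] smooth_fun_continuous[OF smooth_fun_partial[OF c]]
  show "locally_integrable_on \<Omega> (\<lambda>x. c x * v x)"
    using locally_integrable_mult_continuous[OF L(1) cc(1)] by (simp add: mult.commute)
  show "locally_integrable_on \<Omega> (\<lambda>x. (c x *\<^sub>R g x + v x *\<^sub>R grad c x) $ i)" for i
    using locally_integrable_add[OF locally_integrable_mult_continuous[OF L(2) cc(1)]
        locally_integrable_mult_continuous[OF L(1) cc(2)], of i i] by (simp add: mult.commute)
  fix \<phi> i assume t: "test_fun \<Omega> \<phi>"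
  then obtain K where p: "smooth_fun \<phi>" "compact K" "K \<subseteq> \<Omega>" "\<And>x. x \<notin> K \<Longrightarrow> \<phi> x = 0"
    "\<And>x. x \<notin> K \<Longrightarrow> grad \<phi> x = 0" by (rule test_funD) blast
  have t': "test_fun \<Omega> (\<lambda>x. c x * \<phi> x)"
    using p c by (intro test_funI[of _ K] smooth_fun_mult) auto
  have int: "set_integrable lborel \<Omega> (\<lambda>x. v x * (c x * grad \<phi> x $ i))"
    "set_integrable lborel \<Omega> (\<lambda>x. v x * (\<phi> x * grad c x $ i))"
    "set_integrable lborel \<Omega> (\<lambda>x. g x $ i * (c x * \<phi> x))"
    using L p cc smooth_fun_continuous[OF p(1)] smooth_fun_continuous[OF smooth_fun_partial[OF p(1)]]
    by (auto intro!: set_integrable_compact_support[of _ _ _ K] continuous_on_mult)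
  have "(LINT x:\<Omega>|lborel. v x * (c x * grad \<phi> x $ i)) + (LINT x:\<Omega>|lborel. v x * (\<phi> x * grad c x $ i))
      = - (LINT x:\<Omega>|lborel. g x $ i * (c x * \<phi> x))"
    using weak_gradientD[OF v t', of i] c p int
    by (simp add: grad_mult ring_distribs set_integral_add)
  moreover have "(LINT x:\<Omega>|lborel. (c x *\<^sub>R g x + v x *\<^sub>R grad c x) $ i * \<phi> x)
    = (LINT x:\<Omega>|lborel. g x $ i * (c x * \<phi> x)) + (LINT x:\<Omega>|lborel. v x * (\<phi> x * grad c x $ i))"
    using int by (subst set_integral_add(2)[symmetric]) (auto simp: algebra_simps)
  ultimately show "(LINT x:\<Omega>|lborel. (c x * v x) * grad \<phi> x $ i)
      = - (LINT x:\<Omega>|lborel. (c x *\<^sub>R g x + v x *\<^sub>R grad c x) $ i * \<phi> x)"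
    by (simp add: mult.assoc mult.left_commute[of "c _"])
qed

text \<open>Local integrability gives measurability of \<open>g\<close> on compact sets only;
  countably many of them exhaust \<Omega>.\<close>

lemma weak_gradient_measurable:
  assumes v: "weak_gradient \<Omega> v g" and "open \<Omega>"
  shows "(\<lambda>x. indicator \<Omega> x *\<^sub>R g x) \<in> borel_measurable borel"
proof -
  obtain C :: "nat \<Rightarrow> R2 set" where C: "\<And>n. compact (C n)" "\<And>n. C n \<subseteq> \<Omega>" "\<And>n. C n \<subseteq> interior (C (Suc n))"
    "\<Union>(range C) = \<Omega>" "\<And>K. \<lbrakk>compact K; K \<subseteq> \<Omega>\<rbrakk> \<Longrightarrow> \<exists>N. \<forall>n\<ge>N. K \<subseteq> C n"
    by (rule open_Union_compact_subsets[OF \<open>open \<Omega>\<close>]) presburger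
  have mono: "C m \<subseteq> C n" if "m \<le> n" for m n
  proof (rule lift_Suc_mono_le[OF _ that])
    show "C n \<subseteq> C (Suc n)" for n using C(3)[of n] interior_subset by (rule subset_trans)
  qed
  have "(\<lambda>x. indicator \<Omega> x * g x $ i) \<in> borel_measurable borel" for i
  proof (rule borel_measurable_LIMSEQ_real)
    show "(\<lambda>x. indicator (C n) x * g x $ i) \<in> borel_measurable borel" for n
    proof -
      have "set_integrable lborel (C n) (\<lambda>x. g x $ i)"
        using weak_gradient_locally_integrable(2)[OF v, of i] C(1,2)
        unfolding locally_integrable_on_def by simp
      from borel_measurable_integrable[OF this[unfolded set_integrable_def]] show ?thesis by simp
    qed
    show "(\<lambda>n. indicator (C n) x * g x $ i) \<longlonglongrightarrow> indicator \<Omega> x * g x $ i" for x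
    proof (cases "x \<in> \<Omega>")
      case True
      then obtain N where "x \<in> C N" using C by blast
      then have "\<forall>n\<ge>N. x \<in> C n" using mono by blast
      then have "eventually (\<lambda>n. indicator (C n) x * g x $ i = indicator \<Omega> x * g x $ i) sequentially"
        unfolding eventually_sequentially using True by (intro exI[of _ N]) simp
      then show ?thesis by (rule tendsto_eventually)
    next
      case False
      then have "x \<notin> C n" for n using C by blast
      then show ?thesis using False by simp
    qed
  qed
  then show ?thesis
    by (subst borel_measurable_euclidean_space) (auto simp: Basis_vec_def inner_axis)
qed

section \<open>Cutoff functions and upper bounds for the capacity\<close>

definition admissible :: "R2 set \<Rightarrow> R2 set \<Rightarrow> R2 set \<Rightarrow> (R2 \<Rightarrow> real) \<Rightarrow> (R2 \<Rightarrow> R2) \<Rightarrow> bool" where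
  "admissible F0 F1 \<Omega> v g \<longleftrightarrow> continuous_on \<Omega> v \<and> (\<forall>x\<in>\<Omega>. 0 \<le> v x) \<and> weak_gradient \<Omega> v g \<and>
      set_integrable lborel \<Omega> (\<lambda>x. (norm (g x))\<^sup>2) \<and>
      (\<exists>U. open U \<and> F0 \<subseteq> U \<and> (\<forall>x\<in>U \<inter> \<Omega>. v x = 0)) \<and>
      (\<exists>U. open U \<and> F1 \<subseteq> U \<and> (\<forall>x\<in>U \<inter> \<Omega>. 1 \<le> v x))"

definition energy :: "R2 set \<Rightarrow> (R2 \<Rightarrow> R2) \<Rightarrow> real" where
  "energy \<Omega> g = (LINT x:\<Omega>|lborel. (norm (g x))\<^sup>2)"

lemma conf_cap_eq: "conf_cap F0 F1 \<Omega> = Inf {energy \<Omega> g | v g. admissible F0 F1 \<Omega> v g}"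
  by (simp add: conf_cap_def admissible_def energy_def)

lemma energy_nonneg: "0 \<le> energy \<Omega> g"
  unfolding energy_def set_lebesgue_integral_def by (intro Bochner_Integration.integral_nonneg) auto

lemma conf_cap_le: "admissible F0 F1 \<Omega> v g \<Longrightarrow> conf_cap F0 F1 \<Omega> \<le> energy \<Omega> g"
  unfolding conf_cap_eq by (rule cInf_lower) (auto intro!: bdd_belowI[of _ 0] energy_nonneg)

lemma conf_cap_nonneg: "admissible F0 F1 \<Omega> v g \<Longrightarrow> 0 \<le> conf_cap F0 F1 \<Omega>"
  unfolding conf_cap_eq by (rule cInf_greatest) (auto intro: energy_nonneg)

text \<open>The given admissible pair makes the set of energies nonempty; otherwise a small value of
  \<open>Inf\<close> would not yield a competitor.\<close>

lemma conf_cap_lessD: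
  assumes "conf_cap F0 F1 \<Omega> < c" "admissible F0 F1 \<Omega> v0 g0"
  obtains v g where "admissible F0 F1 \<Omega> v g" "energy \<Omega> g < c"
  using cInf_lessD[of "{energy \<Omega> g | v g. admissible F0 F1 \<Omega> v g}" c] assms
  unfolding conf_cap_eq by blast

section \<open>Cutoffs in one variable\<close>

definition cut :: "real \<Rightarrow> real" where "cut y = step (y + 2) - step (y - 1)"
definition dcut :: "real \<Rightarrow> real" where "dcut y = dstep (y + 2) - dstep (y - 1)"

lemma Ck1_cut: "Ck1 k cut"
  using Ck1_add[OF Ck1_affine[OF Ck1_step, of k 1 2] Ck1_mult[OF Ck1_const[of k "-1"] Ck1_affine[OF Ck1_step, of k 1 "-1"]]]
  by (simp add: cut_def[abs_def])

lemma cut_deriv: "(cut has_real_derivative dcut y) (at y)"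
proof -
  have "((\<lambda>y. step (y + 2)) has_real_derivative dstep (y + 2)) (at y)"
    using step_deriv[of "y + 2"] by (simp add: DERIV_shift)
  moreover have "((\<lambda>y. step (y + (-1))) has_real_derivative dstep (y + (-1))) (at y)"
    using step_deriv[of "y + (-1)"] DERIV_shift by blast
  ultimately show ?thesis
    unfolding cut_def[abs_def] dcut_def by (auto intro: DERIV_diff)
qed

lemma cut_eq_1: "\<bar>y\<bar> \<le> 1 \<Longrightarrow> cut y = 1"
  by (simp add: cut_def step_eq_0 step_eq_1)

lemma cut_eq_0: "\<bar>y\<bar> \<ge> 2 \<Longrightarrow> cut y = 0"
  by (cases "y \<ge> 0") (auto simp: cut_def step_eq_0 step_eq_1)

lemma cut_range: "0 \<le> cut y \<and> cut y \<le> 1"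
proof (cases "y \<ge> 0")
  case True
  then show ?thesis using step_nonneg[of "y - 1"] step_le_1[of "y - 1"] by (simp add: cut_def step_eq_1)
next
  case False
  then show ?thesis using step_nonneg[of "y + 2"] step_le_1[of "y + 2"] by (simp add: cut_def step_eq_0)
qed

lemma dcut_eq_0: "\<bar>y\<bar> \<le> 1 \<or> \<bar>y\<bar> \<ge> 2 \<Longrightarrow> dcut y = 0"
  by (cases "y \<ge> 0") (auto simp: dcut_def dstep_eq_0)

lemma dcut_bounded: "\<exists>M>0. \<forall>y. \<bar>dcut y\<bar> \<le> M"
proof -
  have "bounded (dstep ` {0..1})"
    using compact_continuous_image[OF dstep_continuous, of "{0..1}"] compact_imp_bounded by auto
  then obtain M where M: "M > 0" "\<And>y. y \<in> {0..1} \<Longrightarrow> \<bar>dstep y\<bar> \<le> M"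
    unfolding bounded_pos by auto
  have "\<bar>dstep y\<bar> \<le> M" for y
    using M(2)[of y] M(1) dstep_eq_0[of y] by (cases "0 \<le> y \<and> y \<le> 1") auto
  from this[of "_ + 2"] this[of "_ - 1"] have "\<bar>dcut y\<bar> \<le> 2 * M" for y
    unfolding dcut_def by (rule order_trans[OF abs_triangle_ineq4, OF order_trans[OF add_mono]]) simp
  then show ?thesis using M(1) by (intro exI[of _ "2 * M"]) auto
qed

section \<open>Axis-parallel squares\<close>

definition sq :: "R2 \<Rightarrow> real \<Rightarrow> R2 set" where
  "sq p r = {x. \<forall>i. \<bar>x $ i - p $ i\<bar> \<le> r}"

lemma sq_cbox: "sq p r = cbox (\<chi> i. p $ i - r) (\<chi> i. p $ i + r)"
  unfolding sq_def by (auto simp: mem_box_cart abs_le_iff) (smt (verit))+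

lemma compact_sq: "compact (sq p r)"
  by (simp add: sq_cbox)

lemma sq_mono: "r \<le> s \<Longrightarrow> sq p r \<subseteq> sq p s"
  unfolding sq_def using order_trans by blast

lemma cball_subset_sq: "cball p r \<subseteq> sq p r"
proof
  fix x assume "x \<in> cball p r"
  then have "norm (x - p) \<le> r" by (simp add: dist_norm norm_minus_commute)
  then show "x \<in> sq p r" unfolding sq_def
    using component_le_norm_cart[of "x - p"] by (auto intro: order_trans)
qed

lemma sq_subset_cball: "sq p r \<subseteq> cball p (2 * r)"
proof
  fix x assume x: "x \<in> sq p r"
  have "norm (x - p) \<le> (\<Sum>i\<in>UNIV. \<bar>(x - p) $ i\<bar>)" by (rule norm_le_l1_cart)
  also have "\<dots> \<le> 2 * r" using x by (simp add: sq_def UNIV_2 forall_2)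
  finally show "x \<in> cball p (2 * r)" by (simp add: dist_norm norm_minus_commute)
qed

lemma ball_subset_sq: "ball p r \<subseteq> sq p r"
  using cball_subset_sq ball_subset_cball by blast

lemma open_contains_sq:
  assumes "open W" "p \<in> W"
  obtains r where "r > 0" "sq p r \<subseteq> W"
proof -
  obtain e where "e > 0" "cball p e \<subseteq> W" using assms open_contains_cball by blast
  then show ?thesis using that[of "e / 2"] sq_subset_cball[of p "e / 2"] by auto
qed

lemma emeasure_sq: "r \<ge> 0 \<Longrightarrow> emeasure lborel (sq p r) = ennreal ((2 * r)\<^sup>2)"
proof -
  assume r: "r \<ge> 0"
  have "measure lborel (sq p r) = (2 * r)\<^sup>2"
    using r content_cbox_cart[of "\<chi> i. p $ i - r" "\<chi> i. p $ i + r"]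
    by (auto simp: sq_cbox UNIV_2 power2_eq_square interval_ne_empty_cart)
  then show ?thesis
    using emeasure_eq_ennreal_measure[of lborel "sq p r"] by (simp add: sq_cbox emeasure_lborel_cbox_eq)
qed

lemma measure_sq: "r \<ge> 0 \<Longrightarrow> measure lborel (sq p r) = (2 * r)\<^sup>2"
  by (simp add: measure_def emeasure_sq)

section \<open>Product cutoffs on squares\<close>

definition bump :: "R2 \<Rightarrow> real \<Rightarrow> R2 \<Rightarrow> real" where
  "bump p r x = cut ((x $ 1 - p $ 1) / r) * cut ((x $ 2 - p $ 2) / r)"

lemma smooth_cut_coord: "smooth_fun (\<lambda>x. cut ((x $ i - c) / r))"
proof -
  have "smooth_fun (\<lambda>x. cut ((1 / r) * x $ i + (- c / r)))"
    using Ck1_affine[OF Ck1_cut, of _ "1 / r" "- c / r"] by (intro smooth_fun_coord[of "\<lambda>t. cut ((1 / r) * t + (- c / r))"])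
  then show ?thesis by (simp add: diff_divide_distrib)
qed

lemma grad_cut_coord: "grad (\<lambda>x. cut ((x $ i - c) / r)) x = (dcut ((x $ i - c) / r) / r) *\<^sub>R axis i 1"
proof (rule grad_coord)
  have "((\<lambda>t. (t - c) / r) has_real_derivative 1 / r) (at (x $ i))"
    by (auto intro!: derivative_eq_intros simp: divide_inverse)
  from DERIV_chain2[OF cut_deriv this]
  show "((\<lambda>t. cut ((t - c) / r)) has_real_derivative dcut ((x $ i - c) / r) / r) (at (x $ i))"
    by simp
qed

lemma smooth_bump: "smooth_fun (bump p r)"
  unfolding bump_def[abs_def] by (intro smooth_fun_mult smooth_cut_coord)

lemma grad_bump: "grad (bump p r) x =
   (cut ((x $ 1 - p $ 1) / r) * dcut ((x $ 2 - p $ 2) / r) / r) *\<^sub>R axis 2 1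
   + (cut ((x $ 2 - p $ 2) / r) * dcut ((x $ 1 - p $ 1) / r) / r) *\<^sub>R axis 1 1"
  unfolding bump_def[abs_def] by (simp add: grad_mult smooth_cut_coord grad_cut_coord)

lemma bump_range: "0 \<le> bump p r x" "bump p r x \<le> 1"
  using cut_range unfolding bump_def by (auto intro: mult_le_one)

lemma bump_eq_1: "r > 0 \<Longrightarrow> x \<in> sq p r \<Longrightarrow> bump p r x = 1"
  by (simp add: bump_def sq_def cut_eq_1)

lemma notin_sqD: "r > 0 \<Longrightarrow> x \<notin> sq p (c * r) \<Longrightarrow> \<exists>i. \<bar>(x $ i - p $ i) / r\<bar> > c"
proof -
  assume r: "r > 0" and "x \<notin> sq p (c * r)"
  then obtain i where i: "c * r < \<bar>x $ i - p $ i\<bar>" unfolding sq_def by (auto simp: not_le)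
  have "c < \<bar>x $ i - p $ i\<bar> / r" by (rule pos_less_divide_eq[OF r, THEN iffD2, OF i])
  also have "\<dots> = \<bar>(x $ i - p $ i) / r\<bar>" using r by (simp only: abs_divide abs_of_pos)
  finally show ?thesis by (rule exI)
qed

lemma bump_eq_0:
  assumes "r > 0" "x \<notin> sq p (2 * r)"
  shows "bump p r x = 0"
proof -
  have "\<bar>(x $ 1 - p $ 1) / r\<bar> > 2 \<or> \<bar>(x $ 2 - p $ 2) / r\<bar> > 2"
    using notin_sqD[OF assms] by (simp only: not_all[symmetric] not_le[symmetric] forall_2 de_Morgan_conj)
  then show ?thesis using cut_eq_0 unfolding bump_def by (metis less_imp_le mult_eq_0_iff)
qed

text \<open>The frontier of the inner square is included in the first alternative. Hence of two
  bumps at different dyadic scales at least one has gradient 0 at every point, not just almost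
  everywhere.\<close>

lemma grad_bump_eq_0:
  assumes "r > 0" "x \<in> sq p r \<or> x \<notin> sq p (2 * r)"
  shows "grad (bump p r) x = 0"
proof (cases "x \<in> sq p r")
  case True
  then show ?thesis using assms(1) by (simp add: grad_bump sq_def dcut_eq_0)
next
  case False
  then have "\<bar>(x $ 1 - p $ 1) / r\<bar> > 2 \<or> \<bar>(x $ 2 - p $ 2) / r\<bar> > 2"
    using notin_sqD[of r x p 2] False assms by (simp only: not_all[symmetric] not_le[symmetric] forall_2 de_Morgan_conj simp_thms)
  then show ?thesis
  proof
    assume "\<bar>(x $ 1 - p $ 1) / r\<bar> > 2"
    then have "cut ((x $ 1 - p $ 1) / r) = 0" "dcut ((x $ 1 - p $ 1) / r) = 0"
      using cut_eq_0 dcut_eq_0 less_imp_le by blast+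
    then show ?thesis unfolding grad_bump by simp
  next
    assume "\<bar>(x $ 2 - p $ 2) / r\<bar> > 2"
    then have "cut ((x $ 2 - p $ 2) / r) = 0" "dcut ((x $ 2 - p $ 2) / r) = 0"
      using cut_eq_0 dcut_eq_0 less_imp_le by blast+
    then show ?thesis unfolding grad_bump by simp
  qed
qed

lemma norm_grad_bump_le:
  assumes r: "r > 0" and M: "\<And>y. \<bar>dcut y\<bar> \<le> M"
  shows "norm (grad (bump p r) x) \<le> 2 * M / r"
proof -
  have b: "\<bar>cut a * dcut b / r\<bar> \<le> M / r" for a b
  proof -
    have "\<bar>cut a\<bar> * \<bar>dcut b\<bar> \<le> 1 * M" using cut_range[of a] M[of b] by (intro mult_mono) auto
    then show ?thesis using r by (simp add: abs_mult divide_right_mono)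
  qed
  show ?thesis unfolding grad_bump
    by (rule order_trans[OF norm_triangle_ineq])
       (use b[of "(x $ 1 - p $ 1) / r" "(x $ 2 - p $ 2) / r"] b[of "(x $ 2 - p $ 2) / r" "(x $ 1 - p $ 1) / r"]
         in \<open>simp add: norm_axis_1\<close>)
qed

text \<open>\<open>K\<close> is covered by finitely many balls whose doubled squares stay in
  \<open>W\<close>. Combining the bumps as 1 minus the product of \<open>1 - bump p (r p) x\<close>
  keeps the result smooth and between 0 and 1; it is 1 as soon as one bump is 1 and 0 where all of
  them are 0.\<close>

lemma smooth_cutoff_exists:
  assumes K: "compact K" and W: "open W" "K \<subseteq> W"
  obtains \<eta> U K' where "smooth_fun \<eta>" "\<And>x. 0 \<le> \<eta> x" "\<And>x. \<eta> x \<le> 1" "open U" "K \<subseteq> U"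
    "\<And>x. x \<in> U \<Longrightarrow> \<eta> x = 1" "compact K'" "K' \<subseteq> W" "\<And>x. x \<notin> K' \<Longrightarrow> \<eta> x = 0"
proof -
  have "\<exists>r>0. sq p (2 * r) \<subseteq> W" if pK: "p \<in> K" for p
  proof -
    obtain s where "s > 0" "sq p s \<subseteq> W" using open_contains_sq[OF W(1) subsetD[OF W(2) pK]] by blast
    then show ?thesis by (intro exI[of _ "s / 2"]) auto
  qed
  then obtain r where r: "\<And>p. p \<in> K \<Longrightarrow> r p > 0 \<and> sq p (2 * r p) \<subseteq> W" by metis
  obtain D where D: "D \<subseteq> K" "finite D" "K \<subseteq> (\<Union>p\<in>D. ball p (r p))"
  proof (rule compactE_image[OF K, of K "\<lambda>p. ball p (r p)"])
    show "K \<subseteq> (\<Union>p\<in>K. ball p (r p))"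
    proof
      fix p assume "p \<in> K"
      then show "p \<in> (\<Union>p\<in>K. ball p (r p))" using r[of p] by (intro UN_I[of p]) auto
    qed
  qed (use that in auto)
  define \<eta> where "\<eta> x = 1 - (\<Prod>p\<in>D. 1 - bump p (r p) x)" for x
  show ?thesis
  proof (rule that[of \<eta> "\<Union>p\<in>D. ball p (r p)" "\<Union>p\<in>D. sq p (2 * r p)"])
    show "smooth_fun \<eta>"
      unfolding \<eta>_def[abs_def] by (intro smooth_fun_diff smooth_fun_const smooth_fun_prod smooth_bump)
    have "0 \<le> (\<Prod>p\<in>D. 1 - bump p (r p) x)" "(\<Prod>p\<in>D. 1 - bump p (r p) x) \<le> 1" for x
      using bump_range by (auto intro!: prod_nonneg prod_le_1)
    then show "0 \<le> \<eta> x" "\<eta> x \<le> 1" for x by (simp_all add: \<eta>_def)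
    show "\<eta> x = 1" if "x \<in> (\<Union>p\<in>D. ball p (r p))" for x
    proof -
      obtain p where p: "p \<in> D" "x \<in> ball p (r p)" using \<open>x \<in> _\<close> by blast
      then have "1 - bump p (r p) x = 0"
        using r[of p] D(1) ball_subset_sq[of p "r p"] by (simp add: bump_eq_1 subset_iff)
      then have "(\<Prod>p\<in>D. 1 - bump p (r p) x) = 0" using p(1) D(2) by (intro prod_zero) auto
      then show ?thesis by (simp add: \<eta>_def)
    qed
    show "compact (\<Union>p\<in>D. sq p (2 * r p))" using D(2) compact_sq by (intro compact_UN) auto
    show "(\<Union>p\<in>D. sq p (2 * r p)) \<subseteq> W" using r D(1) by blast
    show "\<eta> x = 0" if "x \<notin> (\<Union>p\<in>D. sq p (2 * r p))" for x
    proof -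
      have "bump p (r p) x = 0" if "p \<in> D" for p
        using that \<open>x \<notin> (\<Union>p\<in>D. sq p (2 * r p))\<close> r[of p] D(1) by (intro bump_eq_0) blast+
      then show ?thesis by (simp add: \<eta>_def)
    qed
  qed (use D(3) in auto)
qed

section \<open>Upper bounds for the capacity from smooth functions\<close>

lemma smooth_energy_integrable:
  assumes f: "smooth_fun f" and K: "compact K" "\<And>x. x \<notin> K \<Longrightarrow> f x = 0"
  shows "integrable lborel (\<lambda>x. (norm (grad f x))\<^sup>2)"
proof (rule continuous_compact_support_integrable[OF _ K(1)])
  show "continuous_on UNIV (\<lambda>x. (norm (grad f x))\<^sup>2)"
    using grad_continuous[OF f] by (intro continuous_on_power continuous_on_norm)
  show "(norm (grad f x))\<^sup>2 = 0" if "x \<notin> K" for x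
    using grad_eq_0_outside[OF compact_imp_closed[OF K(1)] K(2) that] by simp
qed

text \<open>Since \<open>K\<close> is compact, its complement is open and serves as the
  neighbourhood of \<open>F0\<close> on which \<open>f\<close> vanishes.\<close>

lemma admissible_smooth:
  assumes "open \<Omega>" and f: "smooth_fun f" "\<And>x. 0 \<le> f x" and K: "compact K" "\<And>x. x \<notin> K \<Longrightarrow> f x = 0"
    and "F0 \<inter> K = {}" "open U" "F1 \<subseteq> U" "\<And>x. x \<in> U \<Longrightarrow> f x = 1"
  shows "admissible F0 F1 \<Omega> f (grad f)"
  unfolding admissible_def
proof (intro conjI)
  show "continuous_on \<Omega> f" by (rule smooth_fun_continuous[OF f(1)])
  show "\<forall>x\<in>\<Omega>. 0 \<le> f x" using f(2) by blast
  show "weak_gradient \<Omega> f (grad f)" by (rule weak_gradient_smooth[OF f(1)])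
  show "set_integrable lborel \<Omega> (\<lambda>x. (norm (grad f x))\<^sup>2)"
    unfolding set_integrable_def using assms(1) smooth_energy_integrable[OF f(1) K]
    by (intro integrable_mult_indicator) auto
  show "\<exists>U. open U \<and> F0 \<subseteq> U \<and> (\<forall>x\<in>U \<inter> \<Omega>. f x = 0)"
    using K assms(6) compact_imp_closed[OF K(1)] by (intro exI[of _ "- K"]) auto
  show "\<exists>U. open U \<and> F1 \<subseteq> U \<and> (\<forall>x\<in>U \<inter> \<Omega>. 1 \<le> f x)"
    using assms(7-9) by (intro exI[of _ U]) auto
qed

text \<open>Secures competitors, so that the capacities entering the metric are infima over nonempty
  sets.\<close>

lemma admissible_exists:
  assumes "open \<Omega>" "closed F0" "compact K" "F1 \<subseteq> K" "F0 \<inter> K = {}"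
  obtains v g where "admissible F0 F1 \<Omega> v g"
proof -
  have "open (- F0)" "K \<subseteq> - F0" using assms by auto
  then obtain f U K' where f: "smooth_fun f" "\<And>x. 0 \<le> f x" "\<And>x. f x \<le> 1" "open U" "K \<subseteq> U"
    "\<And>x. x \<in> U \<Longrightarrow> f x = 1" "compact K'" "K' \<subseteq> - F0" "\<And>x. x \<notin> K' \<Longrightarrow> f x = 0"
    by (rule smooth_cutoff_exists[OF assms(3)]) presburger
  have "admissible F0 F1 \<Omega> f (grad f)"
    by (rule admissible_smooth[OF assms(1) f(1,2,7,9), where U = U]) (use f assms in auto)
  then show ?thesis by (rule that)
qed

text \<open>The gradients of dyadic bumps have disjoint supports and equal energies, so the average of
  \<open>N\<close> of them has energy of order \<open>1 / N\<close>.\<close>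

lemma conf_cap_small:
  assumes \<Omega>: "open \<Omega>" and F0: "closed F0" "p \<notin> F0" and e: "e > 0"
  obtains d where "d > 0" "\<And>F1. F1 \<subseteq> ball p d \<Longrightarrow> conf_cap F0 F1 \<Omega> < e"
proof -
  obtain M where M: "M > 0" "\<And>y. \<bar>dcut y\<bar> \<le> M" using dcut_bounded by blast
  obtain R0 where R0: "R0 > 0" "sq p R0 \<subseteq> - F0" using open_contains_sq[of "- F0" p] F0 by auto
  \<comment> \<open>\<open>64 * M\<^sup>2\<close> bounds the energy of one bump at every scale: the
    gradient is at most \<open>2 * M / r\<close> and lives on a square of side \<open>4 * r\<close>.
    In the plane the powers of \<open>r\<close> cancel.\<close>
  obtain N where N: "N > 0" "64 * M\<^sup>2 / e < real N"
  proof -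
    obtain n where "max 1 (64 * M\<^sup>2 / e) < real n" using reals_Archimedean2 by blast
    then show ?thesis by (intro that[of n]) auto
  qed
  \<comment> \<open>The factor 1/2 keeps the largest support \<open>sq p (2 * r 0)\<close> inside
    \<open>sq p R0\<close>; the halving gives \<open>2 * r k \<le> r j\<close> for
    \<open>j < k\<close>, so each support fits into the region where the earlier bumps are
    constant.\<close>
  define r where "r k = R0 / 2 / 2 ^ k" for k :: nat
  have rpos: "r k > 0" for k using R0 by (simp add: r_def)
  have rle: "2 * r k \<le> r j" if "j < k" for j k
  proof -
    have "(2::real) ^ Suc j \<le> 2 ^ k" using that by (intro power_increasing) auto
    then show ?thesis using R0 by (simp add: r_def field_simps)
  qed
  have rmono: "r k \<le> r j" if "j \<le> k" for j k
    using that rle[of j k] rpos[of k] by (cases "j = k") auto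
  define f where "f x = (1 / N) * (\<Sum>k<N. bump p (r k) x)" for x
  have sf: "smooth_fun f"
    unfolding f_def[abs_def] by (intro smooth_fun_mult smooth_fun_const smooth_fun_sum smooth_bump)
  have f0: "f x = 0" if "x \<notin> sq p R0" for x
  proof -
    have "bump p (r k) x = 0" for k
    proof (rule bump_eq_0[OF rpos])
      have "2 * r k \<le> R0" using rmono[of 0 k] by (simp add: r_def)
      then show "x \<notin> sq p (2 * r k)" using that sq_mono by blast
    qed
    then show ?thesis by (simp add: f_def)
  qed
  have fge: "0 \<le> f x" for x
    unfolding f_def using bump_range(1) by (intro mult_nonneg_nonneg sum_nonneg) auto
  have f1: "f x = 1" if "x \<in> ball p (r N)" for x
  proof -
    have "bump p (r k) x = 1" if "k < N" for k
    proof (rule bump_eq_1[OF rpos])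
      have "r N \<le> r k" using rmono[of k N] that by simp
      then show "x \<in> sq p (r k)" using \<open>x \<in> ball p (r N)\<close> ball_subset_sq sq_mono by blast
    qed
    then show ?thesis using N by (simp add: f_def)
  qed
  have orth: "(norm (grad f x))\<^sup>2 = (1 / N)\<^sup>2 * (\<Sum>k<N. (norm (grad (bump p (r k)) x))\<^sup>2)" for x
  proof -
    have "grad f x = (1 / N) *\<^sub>R (\<Sum>k<N. grad (bump p (r k)) x)"
      unfolding f_def[abs_def] by (simp only: grad_cmult grad_sum smooth_fun_sum smooth_bump)
    moreover have "(norm (\<Sum>k<N. grad (bump p (r k)) x))\<^sup>2 = (\<Sum>k<N. (norm (grad (bump p (r k)) x))\<^sup>2)"
    proof (rule norm_sum_Pythagorean)
      have "grad (bump p (r j)) x = 0 \<or> grad (bump p (r k)) x = 0" if "j < k" for j k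
      proof (cases "x \<in> sq p (2 * r k)")
        case True
        then have "x \<in> sq p (r j)" using rle[OF that] sq_mono by blast
        then show ?thesis using grad_bump_eq_0[OF rpos] by blast
      next
        case False
        then show ?thesis using grad_bump_eq_0[OF rpos] by blast
      qed
      then show "pairwise (\<lambda>i j. orthogonal (grad (bump p (r i)) x) (grad (bump p (r j)) x)) {..<N}"
        unfolding pairwise_def orthogonal_def by (metis inner_zero_left inner_zero_right nat_neq_iff)
    qed auto
    ultimately show ?thesis by (simp add: power_mult_distrib power_divide)
  qed
  have each: "integrable lborel (\<lambda>x. (norm (grad (bump p (r k)) x))\<^sup>2)
      \<and> (LINT x|lborel. (norm (grad (bump p (r k)) x))\<^sup>2) \<le> 64 * M\<^sup>2" for k
  proof
    show i: "integrable lborel (\<lambda>x. (norm (grad (bump p (r k)) x))\<^sup>2)"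
      using bump_eq_0[OF rpos] by (intro smooth_energy_integrable[OF smooth_bump compact_sq]) auto
    have "(LINT x|lborel. (norm (grad (bump p (r k)) x))\<^sup>2)
        \<le> (LINT x|lborel. (2 * M / r k)\<^sup>2 * indicator (sq p (2 * r k)) x)"
    proof (rule integral_mono[OF i])
      show "integrable lborel (\<lambda>x. (2 * M / r k)\<^sup>2 * indicat_real (sq p (2 * r k)) x)"
        using borel_integrable_compact[OF compact_sq, of p "2 * r k" "\<lambda>_. (2 * M / r k)\<^sup>2"]
        by (simp add: mult.commute)
      show "(norm (grad (bump p (r k)) x))\<^sup>2 \<le> (2 * M / r k)\<^sup>2 * indicat_real (sq p (2 * r k)) x" for x
        using norm_grad_bump_le[OF rpos M(2), of p k x] grad_bump_eq_0[OF rpos, of x p k]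
        by (cases "x \<in> sq p (2 * r k)") (auto intro: power_mono)
    qed
    also have "\<dots> = (2 * M / r k)\<^sup>2 * (2 * (2 * r k))\<^sup>2"
      using rpos[of k] measure_sq[of "2 * r k" p] by (simp add: sq_cbox)
    also have "\<dots> = 64 * M\<^sup>2" using rpos[of k] by (simp add: power2_eq_square)
    finally show "(LINT x|lborel. (norm (grad (bump p (r k)) x))\<^sup>2) \<le> 64 * M\<^sup>2" .
  qed
  have "energy \<Omega> (grad f) \<le> (LINT x|lborel. (norm (grad f x))\<^sup>2)"
    unfolding energy_def set_lebesgue_integral_def
    using smooth_energy_integrable[OF sf compact_sq f0] \<Omega>
    by (intro integral_mono integrable_mult_indicator) (auto simp: indicator_def)
  also have "\<dots> = (1 / N)\<^sup>2 * (\<Sum>k<N. LINT x|lborel. (norm (grad (bump p (r k)) x))\<^sup>2)"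
    unfolding orth using each by simp
  also have "\<dots> \<le> (1 / N)\<^sup>2 * (\<Sum>k<N. 64 * M\<^sup>2)"
    using each by (intro mult_left_mono sum_mono) auto
  also have "\<dots> = 64 * M\<^sup>2 / N" using N by (simp add: power2_eq_square)
  also have "\<dots> < e" using N e by (simp add: field_simps)
  finally have E: "energy \<Omega> (grad f) < e" .
  show ?thesis
  proof (rule that[OF rpos[of N]])
    fix F1 assume "F1 \<subseteq> ball p (r N)"
    then have "admissible F0 F1 \<Omega> f (grad f)"
      using R0(2) f0 f1 fge
      by (intro admissible_smooth[OF \<Omega> sf _ compact_sq[of p R0], of F0 "ball p (r N)"]) auto
    then show "conf_cap F0 F1 \<Omega> < e" using conf_cap_le E le_less_trans by blast
  qed
qed

lemma conf_cap_empty: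
  assumes "open \<Omega>" shows "conf_cap F0 {} \<Omega> = 0"
proof -
  have "admissible F0 {} \<Omega> (\<lambda>x. 0) (grad (\<lambda>x. 0))"
    using assms by (intro admissible_smooth[of _ _ "{}" _ "{}"] smooth_fun_const) auto
  from conf_cap_le[OF this] conf_cap_nonneg[OF this] show ?thesis
    by (simp add: energy_def grad_const)
qed

section \<open>Restriction of functions with weak gradient to lines\<close>

text \<open>Distinguishing an arbitrary coordinate \<open>i\<close> from the other one lets the same
  proofs serve horizontal and vertical lines.\<close>

definition mk :: "2 \<Rightarrow> real \<Rightarrow> real \<Rightarrow> R2" where
  "mk i s t = (\<chi> k. if k = i then s else t)"

lemma index_2_cases: "i \<noteq> j \<Longrightarrow> k = i \<or> k = (j::2)"
  by (metis exhaust_2)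

lemma mk_nth: "mk i s t $ i = s" "i \<noteq> j \<Longrightarrow> mk i s t $ j = t"
  by (auto simp: mk_def)

lemma mk_eq: "i \<noteq> j \<Longrightarrow> mk i (x $ i) (x $ j) = x"
  using index_2_cases[of i j] by (auto simp: mk_def vec_eq_iff)

lemma mk_swap: "i \<noteq> j \<Longrightarrow> mk j t s = mk i s t"
  using index_2_cases[of i j] by (auto simp: mk_def vec_eq_iff)

lemma UNIV_2_index: "i \<noteq> j \<Longrightarrow> UNIV = {i, j::2}"
  using index_2_cases[of i j] by auto

lemma continuous_mk:
  assumes "continuous_on A f" "continuous_on A g"
  shows "continuous_on A (\<lambda>x. mk i (f x) (g x))"
  unfolding mk_def
proof (rule continuous_on_vec_lambda)
  show "continuous_on A (\<lambda>x. if k = i then f x else g x)" for k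
    using assms by (cases "k = i") auto
qed

lemma measurable_mk: "(\<lambda>(s, t). mk i s t) \<in> (lborel \<Otimes>\<^sub>M lborel) \<rightarrow>\<^sub>M borel"
proof -
  have "continuous_on UNIV (\<lambda>x::real \<times> real. mk i (fst x) (snd x))"
    by (intro continuous_mk continuous_on_fst continuous_on_snd continuous_on_id)
  then have "(\<lambda>x::real \<times> real. mk i (fst x) (snd x)) \<in> borel_measurable borel"
    by (rule borel_measurable_continuous_onI)
  then show ?thesis by (simp add: lborel_prod case_prod_beta')
qed

text \<open>Lebesgue measure is determined by its values on boxes, and the preimage of a box is a
  product of two intervals. Fubini in coordinates rests on this identity.\<close>

lemma lborel_mk: "(lborel :: R2 measure) = distr (lborel \<Otimes>\<^sub>M lborel) borel (\<lambda>(s, t). mk i s t)"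
proof (rule lborel_eqI)
  fix l u :: R2 assume lu: "\<And>b. b \<in> Basis \<Longrightarrow> l \<bullet> b \<le> u \<bullet> b"
  obtain j where j: "i \<noteq> j"
  proof (cases "i = 1")
    case True
    then show ?thesis using that[of 2] by simp
  qed (use that in blast)
  have le: "l $ k \<le> u $ k" for k
    using lu[of "axis k 1"] by (simp add: inner_axis axis_in_Basis_iff)
  have pre: "(\<lambda>(s, t). mk i s t) -` box l u \<inter> space (lborel \<Otimes>\<^sub>M lborel) = {l $ i<..<u $ i} \<times> {l $ j<..<u $ j}"
    using j index_2_cases[OF j] mk_nth(1)[of i] mk_nth(2)[OF j]
    by (auto simp: space_pair_measure mem_box_cart) (metis mk_nth)+
  have "emeasure (distr (lborel \<Otimes>\<^sub>M lborel) borel (\<lambda>(s, t). mk i s t)) (box l u)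
     = emeasure (lborel \<Otimes>\<^sub>M lborel) ({l $ i<..<u $ i} \<times> {l $ j<..<u $ j})"
    by (subst emeasure_distr[OF measurable_mk]) (auto simp only: pre sets_borel borel_open open_box)
  also have "\<dots> = ennreal (u $ i - l $ i) * ennreal (u $ j - l $ j)"
    using le by (subst lborel.emeasure_pair_measure_Times) auto
  also have "\<dots> = ennreal (\<Prod>k\<in>UNIV. (u - l) $ k)"
    using le j by (simp add: UNIV_2_index[OF j] ennreal_mult)
  also have "(\<Prod>k\<in>UNIV. (u - l) $ k) = (\<Prod>b\<in>Basis. (u - l) \<bullet> b)"
    by (simp add: Basis_vec_def cart_eq_inner_axis axis_eq_axis prod.UNION_disjoint)
  finally show "emeasure (distr (lborel \<Otimes>\<^sub>M lborel) borel (\<lambda>(s, t). mk i s t)) (box l u)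
     = ennreal (\<Prod>b\<in>Basis. (u - l) \<bullet> b)" .
qed auto

lemma nn_integral_mk:
  fixes f :: "R2 \<Rightarrow> ennreal"
  assumes f: "f \<in> borel_measurable borel"
  shows "(\<integral>\<^sup>+x. f x \<partial>lborel) = (\<integral>\<^sup>+t. (\<integral>\<^sup>+s. f (mk i s t) \<partial>lborel) \<partial>lborel)"
proof -
  have m: "(\<lambda>x. f (case_prod (mk i) x)) \<in> borel_measurable (lborel \<Otimes>\<^sub>M lborel)"
    using measurable_compose[OF measurable_mk f] by simp
  have "(\<integral>\<^sup>+x. f x \<partial>lborel) = (\<integral>\<^sup>+x. f (case_prod (mk i) x) \<partial>(lborel \<Otimes>\<^sub>M lborel))"
    by (subst lborel_mk[of i], subst nn_integral_distr[OF measurable_mk]) (use f in auto)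
  also have "\<dots> = (\<integral>\<^sup>+t. (\<integral>\<^sup>+s. f (mk i s t) \<partial>lborel) \<partial>lborel)"
    using lborel_pair.nn_integral_snd[OF m] by simp
  finally show ?thesis .
qed

lemma integral_mk:
  fixes f :: "R2 \<Rightarrow> real"
  assumes f: "integrable lborel f"
  shows "(LINT x|lborel. f x) = (LINT t|lborel. (LINT s|lborel. f (mk i s t)))"
    and "integrable lborel (\<lambda>t. LINT s|lborel. f (mk i s t))"
proof -
  have fm: "f \<in> borel_measurable borel" using f by auto
  have "integrable (distr (lborel \<Otimes>\<^sub>M lborel) borel (\<lambda>(s, t). mk i s t)) f"
    using f lborel_mk[of i] by simp
  then have p: "integrable (lborel \<Otimes>\<^sub>M lborel) (\<lambda>(s, t). f (mk i s t))"
    by (subst (asm) integrable_distr_eq[OF measurable_mk fm]) (simp add: case_prod_beta')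
  show "integrable lborel (\<lambda>t. LINT s|lborel. f (mk i s t))"
    using lborel_pair.integrable_snd[OF p] .
  have "(LINT x|lborel. f x) = (LINT x|distr (lborel \<Otimes>\<^sub>M lborel) borel (\<lambda>(s, t). mk i s t). f x)"
    using lborel_mk[of i] by simp
  also have "\<dots> = (LINT x|(lborel \<Otimes>\<^sub>M lborel). f (case_prod (mk i) x))"
    by (rule integral_distr[OF measurable_mk fm])
  also have "\<dots> = (LINT t|lborel. (LINT s|lborel. f (mk i s t)))"
    using lborel_pair.integral_snd[OF p] by (simp add: case_prod_beta')
  finally show "(LINT x|lborel. f x) = (LINT t|lborel. (LINT s|lborel. f (mk i s t)))" .
qed

section \<open>Mollified indicators and point values\<close>

text \<open>Smooth substitute for the indicator of \<open>{a<..b}\<close>, with ramps of width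
  \<open>1 / k\<close> to the right of \<open>a\<close> and of \<open>b\<close>. As
  \<open>step 0 = 0\<close>, the limit for large \<open>k\<close> omits \<open>a\<close> and
  includes \<open>b\<close>, and the support overhangs \<open>b\<close> by
  \<open>1 / k\<close>.\<close>

definition plateau :: "real \<Rightarrow> real \<Rightarrow> real \<Rightarrow> real \<Rightarrow> real" where
  "plateau k a b t = step (k * (t - a)) - step (k * (t - b))"

definition dplateau :: "real \<Rightarrow> real \<Rightarrow> real \<Rightarrow> real \<Rightarrow> real" where
  "dplateau k a b t = k * dstep (k * (t - a)) - k * dstep (k * (t - b))"

lemma Ck1_plateau: "Ck1 n (plateau k a b)"
proof -
  have "Ck1 n (\<lambda>t. step (k * t + (- k * a)) + (-1) * step (k * t + (- k * b)))"
    by (intro Ck1_add Ck1_mult Ck1_const Ck1_affine Ck1_step)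
  then show ?thesis by (simp add: plateau_def[abs_def] algebra_simps)
qed

lemma plateau_deriv: "(plateau k a b has_real_derivative dplateau k a b t) (at t)"
proof -
  have "((\<lambda>t. step (k * (t - c))) has_real_derivative dstep (k * (t - c)) * k) (at t)" for c
    by (rule DERIV_chain2[OF step_deriv]) (auto intro!: derivative_eq_intros)
  from DERIV_diff[OF this[of a] this[of b]] show ?thesis
    unfolding plateau_def[abs_def] dplateau_def by (simp add: mult.commute)
qed

lemma plateau_abs_le_1: "\<bar>plateau k a b t\<bar> \<le> 1"
  using step_nonneg[of "k * (t - a)"] step_le_1[of "k * (t - a)"]
    step_nonneg[of "k * (t - b)"] step_le_1[of "k * (t - b)"] unfolding plateau_def by linarith

lemma plateau_eq_0:
  assumes "k > 0" "a \<le> b" "t \<le> a \<or> b + 1 / k \<le> t"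
  shows "plateau k a b t = 0"
  using assms(3)
proof
  assume "t \<le> a"
  then have "k * (t - a) \<le> 0" "k * (t - b) \<le> 0" using assms by (auto simp: mult_le_0_iff)
  then show ?thesis by (simp add: plateau_def step_eq_0)
next
  assume t: "b + 1 / k \<le> t"
  have "k * (1 / k) \<le> k * (t - b)" "k * (1 / k) \<le> k * (t - a)"
    using assms t by (intro mult_left_mono; linarith)+
  then show ?thesis using assms(1) by (simp add: plateau_def step_eq_1)
qed

lemma step_tendsto:
  assumes k: "filterlim k at_top sequentially"
  shows "(\<lambda>n. step (k n * (t - a))) \<longlonglongrightarrow> (if t > a then 1 else 0)"
proof (cases "t > a")
  case True
  have "eventually (\<lambda>n. k n \<ge> 1 / (t - a)) sequentially"
    using k by (auto simp: filterlim_at_top)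
  then have "eventually (\<lambda>n. step (k n * (t - a)) = 1) sequentially"
    by eventually_elim (use True in \<open>auto intro!: step_eq_1 simp: field_simps\<close>)
  then show ?thesis using True by (simp add: tendsto_eventually)
next
  case False
  have "eventually (\<lambda>n. k n \<ge> 0) sequentially"
    using k by (auto simp: filterlim_at_top)
  then have "eventually (\<lambda>n. step (k n * (t - a)) = 0) sequentially"
    by eventually_elim (use False in \<open>auto intro!: step_eq_0 simp: mult_le_0_iff\<close>)
  then show ?thesis using False by (simp add: tendsto_eventually)
qed

lemma plateau_tendsto:
  assumes k: "filterlim k at_top sequentially" and "a \<le> b"
  shows "(\<lambda>n. plateau (k n) a b t) \<longlonglongrightarrow> indicator {a<..b} t"
proof -
  have "(\<lambda>n. plateau (k n) a b t) \<longlonglongrightarrow> (if t > a then 1 else 0) - (if t > b then 1 else 0)"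
    unfolding plateau_def by (intro tendsto_diff step_tendsto k)
  then show ?thesis using assms(2) by (auto simp: indicator_def split: if_splits)
qed

lemma dstep_integrable: "integrable lborel dstep" "(LINT y|lborel. dstep y) = 1"
  using dstep_has_integral by (auto simp: has_bochner_integral_iff)

text \<open>The substitution \<open>s = a + y / k\<close> turns the integral into an average of
  \<open>w (a + y / k)\<close> with the nonnegative weight \<open>dstep\<close> of mass 1. Hence the
  bound by \<open>M\<close>, and convergence to \<open>w a\<close> by continuity.\<close>

lemma mollified_point_value:
  fixes w :: "real \<Rightarrow> real"
  assumes w: "continuous_on UNIV w" "\<And>s. \<bar>w s\<bar> \<le> M"
  shows "k > 0 \<Longrightarrow> integrable lborel (\<lambda>s. w s * (k * dstep (k * (s - a))))"
    and "k > 0 \<Longrightarrow> \<bar>LINT s|lborel. w s * (k * dstep (k * (s - a)))\<bar> \<le> M"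
    and "filterlim \<kappa> at_top sequentially \<Longrightarrow> (\<And>n. \<kappa> n > 0) \<Longrightarrow>
      (\<lambda>n. LINT s|lborel. w s * (\<kappa> n * dstep (\<kappa> n * (s - a)))) \<longlonglongrightarrow> w a"
proof -
  have wm: "(\<lambda>y. w (f y)) \<in> borel_measurable lborel" if "continuous_on UNIV f" for f :: "real \<Rightarrow> real"
  proof -
    have "continuous_on UNIV (\<lambda>y. w (f y))" by (rule continuous_on_compose2[OF w(1) that]) auto
    then show ?thesis by (simp add: borel_measurable_continuous_onI)
  qed
  have cf: "continuous_on UNIV (\<lambda>y. a + c * y)" for c :: real by (intro continuous_intros)
  have dm: "dstep \<in> borel_measurable lborel" using dstep_integrable by auto
  have M0: "M \<ge> 0" using w(2)[of 0] by linarith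
  have int: "integrable lborel (\<lambda>y. w (a + c * y) * dstep y)" for c
  proof (rule Bochner_Integration.integrable_bound[where f = "\<lambda>y. M * dstep y"])
    show "integrable lborel (\<lambda>y. M * dstep y)" using dstep_integrable by simp
    show "(\<lambda>y. w (a + c * y) * dstep y) \<in> borel_measurable lborel"
      by (intro borel_measurable_times wm[OF cf] dm)
    show "AE y in lborel. norm (w (a + c * y) * dstep y) \<le> norm (M * dstep y)"
      using w(2) M0 dstep_nonneg by (auto simp: abs_mult intro!: mult_right_mono)
  qed
  have subst: "integrable lborel (\<lambda>s. w s * (k * dstep (k * (s - a))))
     \<and> (LINT s|lborel. w s * (k * dstep (k * (s - a)))) = (LINT y|lborel. w (a + (1 / k) * y) * dstep y)"
    if k: "k > 0" for k
  proof -
    let ?f = "\<lambda>s. w s * (k * dstep (k * (s - a)))"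
    have e: "?f (a + (1 / k) * y) = k * (w (a + (1 / k) * y) * dstep y)" for y using k by simp
    have "integrable lborel (\<lambda>y. ?f (a + (1 / k) * y))"
      unfolding e using int[of "1 / k"] by (intro integrable_mult_right)
    then have "integrable lborel ?f"
      using lborel_integrable_real_affine_iff[of "1 / k" ?f a] k by simp
    moreover have "(LINT s|lborel. ?f s) = \<bar>1 / k\<bar> *\<^sub>R (LINT y|lborel. ?f (a + (1 / k) * y))"
      using k by (intro lborel_integral_real_affine) auto
    ultimately show ?thesis unfolding e using k by simp
  qed
  show "k > 0 \<Longrightarrow> integrable lborel (\<lambda>s. w s * (k * dstep (k * (s - a))))" using subst by blast
  show "\<bar>LINT s|lborel. w s * (k * dstep (k * (s - a)))\<bar> \<le> M" if "k > 0"
  proof -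
    have "\<bar>LINT y|lborel. w (a + (1 / k) * y) * dstep y\<bar> \<le> (LINT y|lborel. \<bar>w (a + (1 / k) * y) * dstep y\<bar>)"
      by (rule integral_abs_bound)
    also have "\<dots> \<le> (LINT y|lborel. M * dstep y)"
    proof (rule integral_mono)
      show "integrable lborel (\<lambda>y. \<bar>w (a + (1 / k) * y) * dstep y\<bar>)"
        by (rule integrable_abs[OF int])
      show "\<bar>w (a + (1 / k) * y) * dstep y\<bar> \<le> M * dstep y" for y
        using w(2) dstep_nonneg by (auto simp: abs_mult intro!: mult_right_mono)
    qed (use dstep_integrable in simp)
    also have "\<dots> = M" using dstep_integrable by simp
    finally show ?thesis using subst[OF that] by simp
  qed
  show "(\<lambda>n. LINT s|lborel. w s * (\<kappa> n * dstep (\<kappa> n * (s - a)))) \<longlonglongrightarrow> w a"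
    if k: "filterlim \<kappa> at_top sequentially" "\<And>n. \<kappa> n > 0"
  proof -
    have "(\<lambda>n. LINT y|lborel. w (a + (1 / \<kappa> n) * y) * dstep y) \<longlonglongrightarrow> (LINT y|lborel. w a * dstep y)"
    proof (rule integral_dominated_convergence[where w = "\<lambda>y. M * dstep y"])
      show "(\<lambda>y. w a * dstep y) \<in> borel_measurable lborel" using dm by simp
      show "(\<lambda>y. w (a + (1 / \<kappa> n) * y) * dstep y) \<in> borel_measurable lborel" for n
        by (intro borel_measurable_times wm[OF cf] dm)
      show "integrable lborel (\<lambda>y. M * dstep y)" using dstep_integrable by simp
      have "(\<lambda>n. 1 / \<kappa> n) \<longlonglongrightarrow> 0"
        using tendsto_inverse_0_at_top[OF k(1)] by (simp add: inverse_eq_divide)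
      then have "(\<lambda>n. a + (1 / \<kappa> n) * y) \<longlonglongrightarrow> a + 0 * y" for y by (intro tendsto_intros)
      then have "(\<lambda>n. w (a + (1 / \<kappa> n) * y)) \<longlonglongrightarrow> w a" for y
        using w(1) by (intro continuous_on_tendsto_compose[OF w(1)]) auto
      then show "AE y in lborel. (\<lambda>n. w (a + (1 / \<kappa> n) * y) * dstep y) \<longlonglongrightarrow> w a * dstep y"
        by (intro AE_I2 tendsto_mult tendsto_const)
      show "AE y in lborel. norm (w (a + (1 / \<kappa> n) * y) * dstep y) \<le> M * dstep y" for n
        using w(2) M0 dstep_nonneg by (auto simp: abs_mult intro!: mult_right_mono)
    qed
    then show ?thesis using subst[OF k(2)] dstep_integrable by simp
  qed
qed

text \<open>The fundamental theorem of calculus, averaged over the lines with other coordinate in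
  \<open>{\<alpha><..\<beta>}\<close>. The test function is a product of plateaus: its derivative in
  direction \<open>i\<close> is a mollifier at \<open>s0\<close> minus one at \<open>s1\<close>,
  which recovers point values of \<open>u\<close>, while the other factor tends to an indicator. The
  margin \<open>d\<close> makes room for the overhang of the plateaus.\<close>

lemma rectangle_identity:
  fixes u h :: "R2 \<Rightarrow> real"
  assumes ij: "i \<noteq> j" and u: "continuous_on UNIV u" "\<And>x. \<bar>u x\<bar> \<le> M" and h: "integrable lborel h"
    and weak: "\<And>\<phi>. test_fun W \<phi> \<Longrightarrow> (LINT x|lborel. u x * grad \<phi> x $ i) = - (LINT x|lborel. h x * \<phi> x)"
    and ab: "s0 \<le> s1" "\<alpha> \<le> \<beta>" "d > 0" "{x. x $ i \<in> {s0..s1 + d} \<and> x $ j \<in> {\<alpha>..\<beta> + d}} \<subseteq> W"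
  shows "(LINT t|lborel. indicator {\<alpha><..\<beta>} t * (u (mk i s1 t) - u (mk i s0 t)))
    = (LINT x|lborel. h x * (indicator {s0<..s1} (x $ i) * indicator {\<alpha><..\<beta>} (x $ j)))"
proof -
  \<comment> \<open>Starting the steepness at \<open>N\<close> keeps the overhang
    \<open>1 / k n\<close> below \<open>d\<close> for every \<open>n\<close>, so all test functions
    are supported in \<open>W\<close>.\<close>
  obtain N where N: "1 / d < real N" using reals_Archimedean2 by blast
  define k where "k n = real (n + N)" for n
  have N0: "real N > 0" using N ab(3) by (smt (verit) divide_pos_pos)
  have kpos: "k n > 0" for n using N0 by (simp add: k_def)
  have kd: "1 / k n \<le> d" for n
  proof -
    have "1 / d < k n" using N by (simp add: k_def)
    then show ?thesis using ab(3) kpos[of n] by (simp add: field_simps)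
  qed
  have klim: "filterlim k at_top sequentially"
    unfolding k_def[abs_def] by (rule filterlim_compose[OF filterlim_real_sequentially]) (rule filterlim_add_const_nat_at_top)
  define \<phi> where "\<phi> n x = plateau (k n) s0 s1 (x $ i) * plateau (k n) \<alpha> \<beta> (x $ j)" for n and x :: R2
  have sc: "smooth_fun (\<lambda>x. plateau c a b (x $ l))" for c a b l
    by (intro smooth_fun_coord Ck1_plateau)
  have s\<phi>: "smooth_fun (\<phi> n)" for n unfolding \<phi>_def[abs_def] by (intro smooth_fun_mult sc)
  define R where "R = {x. x $ i \<in> {s0..s1 + d} \<and> x $ j \<in> {\<alpha>..\<beta> + d}}"
  have Rbox: "R = cbox (mk i s0 \<alpha>) (mk i (s1 + d) (\<beta> + d))"
    unfolding R_def using mk_nth(1)[of i] mk_nth(2)[OF ij] index_2_cases[OF ij]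
    by (auto simp: mem_box_cart) (metis mk_nth)+
  have \<phi>0: "\<phi> n x = 0" if "x \<notin> R" for n x
  proof -
    have "plateau (k n) s0 s1 (x $ i) = 0 \<or> plateau (k n) \<alpha> \<beta> (x $ j) = 0"
    proof (rule ccontr)
      assume c: "\<not> ?thesis"
      have "s0 < x $ i" "x $ i < s1 + 1 / k n" "\<alpha> < x $ j" "x $ j < \<beta> + 1 / k n"
        using plateau_eq_0[OF kpos ab(1), of "x $ i" n] plateau_eq_0[OF kpos ab(2), of "x $ j" n] c
        by (meson not_le)+
      then have "x \<in> R" using kd[of n] by (auto simp: R_def)
      then show False using that by blast
    qed
    then show ?thesis by (auto simp: \<phi>_def)
  qed
  have test: "test_fun W (\<phi> n)" for n
  proof (rule test_funI[OF s\<phi>])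
    show "compact R" by (simp add: Rbox)
    show "R \<subseteq> W" using ab(4) by (simp add: R_def)
  qed (rule \<phi>0)
  have g\<phi>: "grad (\<phi> n) x $ i = dplateau (k n) s0 s1 (x $ i) * plateau (k n) \<alpha> \<beta> (x $ j)" for n x
    unfolding \<phi>_def[abs_def]
    by (subst grad_mult[OF sc sc]) (use ij in \<open>simp add: grad_coord[OF plateau_deriv] axis_def\<close>)
  have rhs: "(\<lambda>n. LINT x|lborel. h x * \<phi> n x) \<longlonglongrightarrow>
     (LINT x|lborel. h x * (indicator {s0<..s1} (x $ i) * indicator {\<alpha><..\<beta>} (x $ j)))"
  proof (rule integral_dominated_convergence[where w = "\<lambda>x. \<bar>h x\<bar>"])
    have coordm: "(\<lambda>x::R2. x $ l) \<in> borel_measurable borel" for l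
      by (intro borel_measurable_continuous_onI continuous_intros)
    have indm: "(\<lambda>x::R2. indicator {a<..b} (x $ l) :: real) \<in> borel_measurable borel" for a b l
      by (rule measurable_compose[OF coordm]) auto
    have hm: "h \<in> borel_measurable borel" using h by auto
    show "(\<lambda>x. h x * (indicator {s0<..s1} (x $ i) * indicator {\<alpha><..\<beta>} (x $ j))) \<in> borel_measurable lborel"
      using borel_measurable_times[OF hm borel_measurable_times[OF indm indm]] by simp
    have "\<phi> n \<in> borel_measurable borel" for n
      using smooth_fun_continuous[OF s\<phi>] by (rule borel_measurable_continuous_onI)
    from borel_measurable_times[OF hm this]
    show "(\<lambda>x. h x * \<phi> n x) \<in> borel_measurable lborel" for n by simp
    show "integrable lborel (\<lambda>x. \<bar>h x\<bar>)" using h by simp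
    show "AE x in lborel. (\<lambda>n. h x * \<phi> n x) \<longlonglongrightarrow> h x * (indicator {s0<..s1} (x $ i) * indicator {\<alpha><..\<beta>} (x $ j))"
      unfolding \<phi>_def using klim ab by (intro AE_I2 tendsto_mult tendsto_const plateau_tendsto)
    show "AE x in lborel. norm (h x * \<phi> n x) \<le> \<bar>h x\<bar>" for n
    proof (rule AE_I2)
      fix x
      have "\<bar>\<phi> n x\<bar> \<le> 1" unfolding \<phi>_def abs_mult
        using plateau_abs_le_1 by (intro mult_le_one) auto
      then show "norm (h x * \<phi> n x) \<le> \<bar>h x\<bar>" by (simp add: abs_mult mult_left_le)
    qed
  qed
  \<comment> \<open>Mollified value of \<open>u\<close> at position \<open>s\<close> on the line
    with other coordinate \<open>t\<close>; it tends to \<open>u (mk i s t)\<close> and stays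
    bounded by \<open>M\<close>.\<close>
  define J where "J n s t = (LINT \<sigma>|lborel. u (mk i \<sigma> t) * (k n * dstep (k n * (\<sigma> - s))))" for n s t
  have uc: "continuous_on UNIV (\<lambda>\<sigma>. u (mk i \<sigma> t))" for t
    by (rule continuous_on_compose2[OF u(1)]) (auto intro!: continuous_mk continuous_intros)
  have uc': "continuous_on UNIV (\<lambda>t. u (mk i s t))" for s
    by (rule continuous_on_compose2[OF u(1)]) (auto intro!: continuous_mk continuous_intros)
  note mol = mollified_point_value[OF uc u(2)]
  have int\<phi>: "integrable lborel (\<lambda>x. u x * grad (\<phi> n) x $ i)" for n
  proof (rule continuous_compact_support_integrable[of _ R])
    show "continuous_on UNIV (\<lambda>x. u x * grad (\<phi> n) x $ i)"
      by (intro continuous_on_mult u(1) smooth_fun_continuous smooth_fun_partial s\<phi>)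
    show "compact R" by (simp add: Rbox)
    show "u x * grad (\<phi> n) x $ i = 0" if "x \<notin> R" for x
    proof -
      have "closed R" by (simp add: Rbox closed_cbox)
      from grad_eq_0_outside[OF this \<phi>0 that] show ?thesis by simp
    qed
  qed
  have lhs_eq: "(LINT x|lborel. u x * grad (\<phi> n) x $ i)
      = (LINT t|lborel. plateau (k n) \<alpha> \<beta> t * (J n s0 t - J n s1 t))"
    and lhs_int: "integrable lborel (\<lambda>t. plateau (k n) \<alpha> \<beta> t * (J n s0 t - J n s1 t))" for n
  proof -
    have inner: "(LINT s|lborel. u (mk i s t) * grad (\<phi> n) (mk i s t) $ i)
       = plateau (k n) \<alpha> \<beta> t * (J n s0 t - J n s1 t)" for t
    proof -
      have "(LINT s|lborel. u (mk i s t) * grad (\<phi> n) (mk i s t) $ i)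
        = (LINT s|lborel. plateau (k n) \<alpha> \<beta> t * (u (mk i s t) * (k n * dstep (k n * (s - s0)))
             - u (mk i s t) * (k n * dstep (k n * (s - s1)))))"
        unfolding g\<phi> mk_nth(1) mk_nth(2)[OF ij] dplateau_def by (simp add: algebra_simps)
      also have "\<dots> = plateau (k n) \<alpha> \<beta> t * (J n s0 t - J n s1 t)"
        unfolding J_def using mol(1)[OF kpos] by simp
      finally show ?thesis .
    qed
    show "(LINT x|lborel. u x * grad (\<phi> n) x $ i) = (LINT t|lborel. plateau (k n) \<alpha> \<beta> t * (J n s0 t - J n s1 t))"
      using integral_mk(1)[OF int\<phi>, of n i] unfolding inner .
    show "integrable lborel (\<lambda>t. plateau (k n) \<alpha> \<beta> t * (J n s0 t - J n s1 t))"
      using integral_mk(2)[OF int\<phi>, of i n] unfolding inner .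
  qed
  have lhs: "(\<lambda>n. LINT t|lborel. plateau (k n) \<alpha> \<beta> t * (J n s0 t - J n s1 t)) \<longlonglongrightarrow>
     (LINT t|lborel. indicator {\<alpha><..\<beta>} t * (u (mk i s0 t) - u (mk i s1 t)))"
  proof (rule integral_dominated_convergence[where w = "\<lambda>t. 2 * M * indicator {\<alpha>..\<beta> + d} t"])
    have "(\<lambda>t. u (mk i s t)) \<in> borel_measurable borel" for s
      using uc' by (rule borel_measurable_continuous_onI)
    then show "(\<lambda>t. indicator {\<alpha><..\<beta>} t * (u (mk i s0 t) - u (mk i s1 t))) \<in> borel_measurable lborel"
      by (auto intro!: borel_measurable_times borel_measurable_diff)
    show "(\<lambda>t. plateau (k n) \<alpha> \<beta> t * (J n s0 t - J n s1 t)) \<in> borel_measurable lborel" for n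
      using lhs_int by auto
    show "integrable lborel (\<lambda>t. 2 * M * indicator {\<alpha>..\<beta> + d} t)"
      using borel_integrable_compact[of "{\<alpha>..\<beta> + d}" "\<lambda>_. 2 * M"] by (simp add: mult.commute)
    show "AE t in lborel. (\<lambda>n. plateau (k n) \<alpha> \<beta> t * (J n s0 t - J n s1 t)) \<longlonglongrightarrow>
        indicator {\<alpha><..\<beta>} t * (u (mk i s0 t) - u (mk i s1 t))"
      unfolding J_def using mol(3)[OF klim kpos] ab(2) klim
      by (intro AE_I2 tendsto_mult tendsto_diff plateau_tendsto) auto
    show "AE t in lborel. norm (plateau (k n) \<alpha> \<beta> t * (J n s0 t - J n s1 t)) \<le> 2 * M * indicator {\<alpha>..\<beta> + d} t" for n
    proof (rule AE_I2)
      fix t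
      show "norm (plateau (k n) \<alpha> \<beta> t * (J n s0 t - J n s1 t)) \<le> 2 * M * indicator {\<alpha>..\<beta> + d} t"
      proof (cases "t \<in> {\<alpha>..\<beta> + d}")
        case True
        have "\<bar>J n s0 t - J n s1 t\<bar> \<le> 2 * M"
          unfolding J_def using mol(2)[OF kpos, of t n s0] mol(2)[OF kpos, of t n s1] by linarith
        then have "\<bar>plateau (k n) \<alpha> \<beta> t\<bar> * \<bar>J n s0 t - J n s1 t\<bar> \<le> 1 * (2 * M)"
          using plateau_abs_le_1 by (intro mult_mono) auto
        then show ?thesis using True by (simp add: abs_mult)
      next
        case False
        then have "t \<le> \<alpha> \<or> \<beta> + 1 / k n \<le> t" using kd[of n] by auto
        then show ?thesis using plateau_eq_0[OF kpos ab(2)] False by simp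
      qed
    qed
  qed
  have "(LINT t|lborel. indicator {\<alpha><..\<beta>} t * (u (mk i s0 t) - u (mk i s1 t)))
     = - (LINT x|lborel. h x * (indicator {s0<..s1} (x $ i) * indicator {\<alpha><..\<beta>} (x $ j)))"
    using LIMSEQ_unique[OF lhs] tendsto_minus[OF rhs] weak[OF test] lhs_eq by auto
  moreover have "(LINT t|lborel. indicator {\<alpha><..\<beta>} t * (u (mk i s1 t) - u (mk i s0 t)))
     = - (LINT t|lborel. indicator {\<alpha><..\<beta>} t * (u (mk i s0 t) - u (mk i s1 t)))"
    by (simp add: algebra_simps flip: integral_minus)
  ultimately show ?thesis by simp
qed

text \<open>At a Lebesgue point of the fibre integral of \<open>G\<close> the estimate follows by averaging the rectangle
  identity; hence one null set serves all \<open>s0\<close> and \<open>s1\<close>.\<close>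

lemma line_oscillation:
  fixes u h G :: "R2 \<Rightarrow> real"
  assumes ij: "i \<noteq> j" and u: "continuous_on UNIV u" "\<And>x. \<bar>u x\<bar> \<le> M"
    and h: "integrable lborel h" and G: "integrable lborel G" "\<And>x. \<bar>h x\<bar> \<le> G x"
    and weak: "\<And>\<phi>. test_fun W \<phi> \<Longrightarrow> (LINT x|lborel. u x * grad \<phi> x $ i) = - (LINT x|lborel. h x * \<phi> x)"
  obtains N where "N \<in> null_sets lborel"
    "\<And>t s0 s1 d. t \<notin> N \<Longrightarrow> s0 \<le> s1 \<Longrightarrow> d > 0 \<Longrightarrow>
      {x. x $ i \<in> {s0..s1 + d} \<and> x $ j \<in> {t..t + d}} \<subseteq> W \<Longrightarrow>
      \<bar>u (mk i s1 t) - u (mk i s0 t)\<bar> \<le> (LINT s|lborel. G (mk i s t))"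
proof -
  define K where "K t = (LINT s|lborel. G (mk i s t))" for t
  have Kint: "integrable lborel K" unfolding K_def[abs_def] by (rule integral_mk(2)[OF G(1)])
  have Gnn: "0 \<le> G x" for x using G(2)[of x] by linarith
  have Knn: "0 \<le> K t" for t unfolding K_def by (intro Bochner_Integration.integral_nonneg Gnn)
  have "K integrable_on cbox a b" for a b
    using integrable_on_lborel[OF Kint] integrable_on_subcbox[of K UNIV a b] by simp
  then obtain N0 where N0: "negligible N0"
    "\<And>x e. \<lbrakk>x \<notin> N0; 0 < e\<rbrakk> \<Longrightarrow>
        \<exists>d>0. \<forall>h. 0 < h \<and> h < d \<longrightarrow> norm (integral (cbox x (x + h *\<^sub>R One)) K /\<^sub>R h ^ DIM(real) - K x) < e"
    using integrable_ccontinuous_explicit[of K] by blast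
  \<comment> \<open>Negligible sets are null for the completed measure; \<open>N0\<close> is
    enlarged to a Borel null set.\<close>
  obtain N where N: "N \<in> null_sets lborel" "N0 \<subseteq> N"
    using N0(1) unfolding negligible_iff_null_sets null_sets_completion_iff2 by blast
  show ?thesis
  proof (rule that[OF N(1)])
    fix t s0 s1 d assume t: "t \<notin> N" and s: "s0 \<le> s1" and d: "d > 0"
      and R: "{x. x $ i \<in> {s0..s1 + d} \<and> x $ j \<in> {t..t + d}} \<subseteq> W"
    define D where "D \<tau> = u (mk i s1 \<tau>) - u (mk i s0 \<tau>)" for \<tau>
    have contD: "continuous_on UNIV D"
      unfolding D_def by (intro continuous_on_diff continuous_on_compose2[OF u(1)]) (auto intro!: continuous_mk continuous_intros)
    \<comment> \<open>Replacing \<open>h\<close> between \<open>s0\<close> and \<open>s1\<close> by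
      \<open>G\<close> on the entire line removes \<open>s0\<close> and \<open>s1\<close> from the
      right-hand side, so only the single function \<open>K\<close> has to be
      differentiated.\<close>
    have key: "\<bar>LINT \<tau>|lborel. indicator {t<..t + hh} \<tau> * D \<tau>\<bar> \<le> (LINT \<tau>|lborel. indicator {t<..t + hh} \<tau> * K \<tau>)"
      if hh: "0 < hh" "hh \<le> d / 2" for hh
    proof -
      have sub: "{x. x $ i \<in> {s0..s1 + d / 2} \<and> x $ j \<in> {t..t + hh + d / 2}} \<subseteq> W"
        using hh d by (intro subset_trans[OF _ R]) auto
      have coordm: "(\<lambda>x::R2. x $ l) \<in> borel_measurable borel" for l
        by (intro borel_measurable_continuous_onI continuous_intros)
      have indm: "(\<lambda>x::R2. indicator {a<..b} (x $ l) :: real) \<in> borel_measurable borel" for a b l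
        by (rule measurable_compose[OF coordm]) auto
      have gm: "G \<in> borel_measurable lborel" "h \<in> borel_measurable lborel" using G h by auto
      have iG: "integrable lborel (\<lambda>x. G x * indicator {t<..t + hh} (x $ j))"
        by (rule Bochner_Integration.integrable_bound[OF G(1)])
           (use borel_measurable_times[OF gm(1)] indm Gnn in \<open>auto simp: indicator_def\<close>)
      have ih: "integrable lborel (\<lambda>x. h x * (indicator {s0<..s1} (x $ i) * indicator {t<..t + hh} (x $ j)))"
        by (rule Bochner_Integration.integrable_bound[OF h])
           (use borel_measurable_times[OF gm(2)] borel_measurable_times[OF indm indm] in \<open>auto simp: indicator_def\<close>)
      have "\<bar>LINT \<tau>|lborel. indicator {t<..t + hh} \<tau> * D \<tau>\<bar>
          = \<bar>LINT x|lborel. h x * (indicator {s0<..s1} (x $ i) * indicator {t<..t + hh} (x $ j))\<bar>"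
        unfolding D_def using rectangle_identity[OF ij u h weak s _ _ sub] hh d by simp
      also have "\<dots> \<le> (LINT x|lborel. \<bar>h x * (indicator {s0<..s1} (x $ i) * indicator {t<..t + hh} (x $ j))\<bar>)"
        by (rule integral_abs_bound)
      also have "\<dots> \<le> (LINT x|lborel. G x * indicator {t<..t + hh} (x $ j))"
        using ih iG G(2) Gnn by (intro integral_mono integrable_abs) (auto simp: indicator_def)
      also have "\<dots> = (LINT \<tau>|lborel. LINT s|lborel. G (mk i s \<tau>) * indicator {t<..t + hh} \<tau>)"
        using integral_mk(1)[OF iG, of i] by (simp add: mk_nth(2)[OF ij])
      also have "\<dots> = (LINT \<tau>|lborel. indicator {t<..t + hh} \<tau> * K \<tau>)"
        by (simp add: K_def mult.commute)
      finally show ?thesis .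
    qed
    have indI: "integrable lborel (\<lambda>\<tau>. indicator {t<..t + hh} \<tau> * c \<tau>)" if "continuous_on UNIV c" for hh and c :: "real \<Rightarrow> real"
    proof -
      have "set_integrable lborel {t..t + hh} c"
        unfolding set_integrable_def using that continuous_on_subset by (intro borel_integrable_compact) blast+
      then have "set_integrable lborel {t<..t + hh} c" by (rule set_integrable_subset) auto
      then show ?thesis by (simp add: set_integrable_def)
    qed
    \<comment> \<open>Here \<sigma> is 1 or -1, which covers both signs of \<open>D t\<close>. Over
      \<open>{t<..t + hh}\<close> the mean of \<open>D\<close> is close to \<open>D t\<close> by
      continuity and the mean of \<open>K\<close> is close to \<open>K t\<close> because
      \<open>t\<close> lies off \<open>N0\<close>.\<close>
    have main: "\<sigma> * D t \<le> K t" if \<sigma>: "\<bar>\<sigma>\<bar> = 1" for \<sigma>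
    proof (rule field_le_epsilon)
      fix e0 :: real assume "e0 > 0"
      define e where "e = e0 / 2"
      have e: "e > 0" using \<open>e0 > 0\<close> by (simp add: e_def)
      obtain d1 where d1: "d1 > 0" "\<And>h. 0 < h \<Longrightarrow> h < d1 \<Longrightarrow> \<bar>integral {t..t + h} K / h - K t\<bar> < e"
      proof -
        have "t \<notin> N0" using t N(2) by blast
        from N0(2)[OF this e] show ?thesis using that by (auto simp: divide_inverse mult.commute)
      qed
      have "isCont D t" using contD by (simp add: continuous_on_eq_continuous_at)
      then obtain d2 where d2: "d2 > 0" "\<And>\<tau>. \<bar>\<tau> - t\<bar> < d2 \<Longrightarrow> \<bar>D \<tau> - D t\<bar> < e"
        unfolding continuous_at_eps_delta using e by (metis dist_real_def)
      define hh where "hh = min (d / 2) (min (d1 / 2) (d2 / 2))"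
      have hh: "0 < hh" "hh \<le> d / 2" "hh < d1" "hh < d2"
        using d d1(1) d2(1) by (auto simp: hh_def)
      have setK: "set_integrable lborel A K" if "A \<in> sets lborel" for A
        unfolding set_integrable_def by (rule integrable_mult_indicator[OF that Kint])
      have "hh * (\<sigma> * D t - e) = (LINT \<tau>|lborel. indicator {t<..t + hh} \<tau> * (\<sigma> * D t - e))"
        using hh by simp
      also have "\<dots> \<le> (LINT \<tau>|lborel. indicator {t<..t + hh} \<tau> * (\<sigma> * D \<tau>))"
      proof (rule integral_mono[OF indI indI])
        show "continuous_on UNIV (\<lambda>\<tau>. \<sigma> * D \<tau>)" using contD by (intro continuous_intros)
        fix \<tau>
        show "indicator {t<..t + hh} \<tau> * (\<sigma> * D t - e) \<le> indicator {t<..t + hh} \<tau> * (\<sigma> * D \<tau>)"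
        proof (cases "\<tau> \<in> {t<..t + hh}")
          case True
          then have "\<bar>D \<tau> - D t\<bar> < e" using hh by (intro d2(2)) auto
          moreover have "\<sigma> = 1 \<or> \<sigma> = -1" using \<sigma> by linarith
          ultimately show ?thesis using True by auto
        qed simp
      qed (intro continuous_intros)
      also have "\<dots> = \<sigma> * (LINT \<tau>|lborel. indicator {t<..t + hh} \<tau> * D \<tau>)"
        by (simp add: mult.left_commute)
      also have "\<dots> \<le> \<bar>LINT \<tau>|lborel. indicator {t<..t + hh} \<tau> * D \<tau>\<bar>"
        using \<sigma> by (metis abs_ge_self abs_mult mult_1)
      also have "\<dots> \<le> (LINT \<tau>|lborel. indicator {t<..t + hh} \<tau> * K \<tau>)"
        by (rule key[OF hh(1,2)])
      also have "\<dots> \<le> (LINT \<tau>|lborel. indicator {t..t + hh} \<tau> * K \<tau>)"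
        using setK[of "{t<..t + hh}"] setK[of "{t..t + hh}"] Knn unfolding set_integrable_def
        by (intro integral_mono) (auto simp: indicator_def)
      also have "\<dots> = integral {t..t + hh} K"
        using set_borel_integral_eq_integral(2)[OF setK[of "{t..t + hh}"]] by (simp add: set_lebesgue_integral_def)
      also have "\<dots> \<le> hh * (K t + e)"
        using d1(2)[OF hh(1,3)] hh(1) by (simp add: abs_less_iff field_simps)
      finally have "\<sigma> * D t - e \<le> K t + e" using hh(1) by simp
      then show "\<sigma> * D t \<le> K t + e0" by (simp add: e_def)
    qed
    show "\<bar>u (mk i s1 t) - u (mk i s0 t)\<bar> \<le> (LINT s|lborel. G (mk i s t))"
      using main[of 1] main[of "-1"] by (simp add: D_def K_def abs_le_iff)
  qed
qed

section \<open>Oscillation on a good concentric square\<close>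

text \<open>Cauchy-Schwarz on each line, where \<open>G\<close> lives on an interval of length
  \<open>4 * r\<close>, followed by Fubini.\<close>

lemma fiber_integral_L2:
  fixes G :: "R2 \<Rightarrow> real"
  assumes G: "integrable lborel G" "\<And>x. 0 \<le> G x" and r: "r \<ge> 0"
    and supp: "\<And>x. \<bar>x $ i - c\<bar> > 2 * r \<Longrightarrow> G x = 0"
  shows "(\<integral>\<^sup>+t. (ennreal (LINT s|lborel. G (mk i s t)))\<^sup>2 \<partial>lborel) \<le> ennreal (4 * r) * (\<integral>\<^sup>+x. (ennreal (G x))\<^sup>2 \<partial>lborel)"
proof -
  have Gm: "G \<in> borel_measurable borel" using G by auto
  have contm: "continuous_on UNIV (\<lambda>s. mk i s t)" for t by (intro continuous_mk continuous_intros)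
  have Gsm: "(\<lambda>s. G (mk i s t)) \<in> borel_measurable borel" for t
    by (rule measurable_compose[OF borel_measurable_continuous_onI[OF contm] Gm])
  have fib: "(ennreal (LINT s|lborel. G (mk i s t)))\<^sup>2 \<le> ennreal (4 * r) * (\<integral>\<^sup>+s. (ennreal (G (mk i s t)))\<^sup>2 \<partial>lborel)" for t
  proof -
    let ?I = "{c - 2 * r..c + 2 * r}"
    \<comment> \<open>On a fibre that is not integrable the Bochner integral is 0 by convention, and
      the bound is trivial.\<close>
    have "ennreal (LINT s|lborel. G (mk i s t)) \<le> (\<integral>\<^sup>+s. ennreal (G (mk i s t)) \<partial>lborel)"
    proof (cases "integrable lborel (\<lambda>s. G (mk i s t))")
      case True
      then show ?thesis using nn_integral_eq_integral[OF True] G(2) by simp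
    qed (simp add: not_integrable_integral_eq)
    also have "\<dots> = (\<integral>\<^sup>+s. indicator ?I s * ennreal (G (mk i s t)) \<partial>lborel)"
    proof (rule nn_integral_cong)
      fix s
      show "ennreal (G (mk i s t)) = indicator ?I s * ennreal (G (mk i s t))"
        using supp[of "mk i s t"] by (cases "s \<in> ?I") (auto simp: mk_nth(1))
    qed
    finally have "(ennreal (LINT s|lborel. G (mk i s t)))\<^sup>2 \<le> (\<integral>\<^sup>+s. indicator ?I s * ennreal (G (mk i s t)) \<partial>lborel)\<^sup>2"
      by (intro power_mono) auto
    also have "\<dots> \<le> (\<integral>\<^sup>+s. (indicator ?I s)\<^sup>2 \<partial>lborel) * (\<integral>\<^sup>+s. (ennreal (G (mk i s t)))\<^sup>2 \<partial>lborel)"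
      using Gsm by (intro Cauchy_Schwarz_nn_integral) auto
    also have "(\<integral>\<^sup>+s. (indicator ?I s)\<^sup>2 \<partial>lborel) = (\<integral>\<^sup>+s. indicator ?I s \<partial>lborel)"
      by (intro nn_integral_cong) (simp add: indicator_def)
    also have "\<dots> = ennreal (4 * r)" using r by simp
    finally show ?thesis .
  qed
  have m2: "(\<lambda>x. (ennreal (G x))\<^sup>2) \<in> borel_measurable borel" using Gm by simp
  have m3: "(\<lambda>(t, s). (ennreal (G (mk i s t)))\<^sup>2) \<in> borel_measurable (lborel \<Otimes>\<^sub>M lborel)"
  proof -
    have "continuous_on UNIV (\<lambda>x::real \<times> real. mk i (snd x) (fst x))"
      by (intro continuous_mk continuous_on_fst continuous_on_snd continuous_on_id)
    from measurable_compose[OF borel_measurable_continuous_onI[OF this] m2]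
    show ?thesis by (simp add: lborel_prod case_prod_beta')
  qed
  have "(\<integral>\<^sup>+t. (ennreal (LINT s|lborel. G (mk i s t)))\<^sup>2 \<partial>lborel)
     \<le> (\<integral>\<^sup>+t. ennreal (4 * r) * (\<integral>\<^sup>+s. (ennreal (G (mk i s t)))\<^sup>2 \<partial>lborel) \<partial>lborel)"
    by (intro nn_integral_mono fib)
  also have "\<dots> = ennreal (4 * r) * (\<integral>\<^sup>+t. (\<integral>\<^sup>+s. (ennreal (G (mk i s t)))\<^sup>2 \<partial>lborel) \<partial>lborel)"
    using lborel.borel_measurable_nn_integral[OF m3] by (intro nn_integral_cmult) simp
  also have "\<dots> = ennreal (4 * r) * (\<integral>\<^sup>+x. (ennreal (G x))\<^sup>2 \<partial>lborel)"
    using nn_integral_mk[OF m2, of i] by simp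
  finally show ?thesis .
qed

text \<open>The intermediate value theorem for the distance to \<open>p\<close> in the maximum norm,
  whose level sets are the frontiers of the squares.\<close>

lemma connected_meets_square_frontier:
  assumes S: "connected S" "p \<in> S" "\<not> S \<subseteq> sq p r" and \<rho>: "0 \<le> \<rho>" "\<rho> \<le> r"
  obtains z k where "z \<in> S" "z \<in> sq p \<rho>" "\<bar>z $ k - p $ k\<bar> = \<rho>"
proof -
  define f where "f x = max \<bar>x $ 1 - p $ 1\<bar> \<bar>x $ 2 - p $ 2\<bar>" for x :: R2
  have "continuous_on S f" unfolding f_def by (intro continuous_intros)
  then have conn: "connected (f ` S)" using S(1) by (rule connected_continuous_image)
  obtain y where y: "y \<in> S" "y \<notin> sq p r" using S(3) by blast
  have "f y > r" using y(2) by (auto simp: sq_def f_def forall_2 not_le less_max_iff_disj)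
  moreover have "f p = 0" by (simp add: f_def)
  ultimately have "\<rho> \<in> f ` S"
    using connectedD_interval[OF conn, of "f p" "f y" \<rho>] S(2) y(1) \<rho> by auto
  then obtain z where z: "z \<in> S" "f z = \<rho>" by blast
  then have "z \<in> sq p \<rho>" by (auto simp: sq_def f_def forall_2)
  moreover have "\<bar>z $ 1 - p $ 1\<bar> = \<rho> \<or> \<bar>z $ 2 - p $ 2\<bar> = \<rho>" using z(2) by (auto simp: f_def max_def split: if_splits)
  ultimately show ?thesis using that z(1) by blast
qed

text \<open>An averaging argument. \<open>T \<rho>\<close> adds the squares of the integrals along
  the four lines that carry the sides of the square of half-side \<rho>. Its total integral is at
  most \<open>16 * r * E0\<close>, so it cannot be at least \<open>16 * E\<close> almost everywhere
  on \<open>{0<..<r}\<close>; the strict inequality \<open>E0 < E\<close> thus provides a radius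
  that also avoids the null sets. Each line then contributes at most
  \<open>sqrt (16 * E)\<close>.\<close>

lemma good_radius_exists:
  fixes K1 K2 :: "real \<Rightarrow> real"
  assumes r: "r > 0" and E: "0 \<le> E0" "E0 < E"
    and N: "N1 \<in> null_sets lborel" "N2 \<in> null_sets lborel"
    and Km: "K1 \<in> borel_measurable borel" "K2 \<in> borel_measurable borel"
    and Knn: "\<And>t. 0 \<le> K1 t" "\<And>t. 0 \<le> K2 t"
    and K: "(\<integral>\<^sup>+t. (ennreal (K1 t))\<^sup>2 \<partial>lborel) \<le> ennreal (4 * r * E0)"
       "(\<integral>\<^sup>+t. (ennreal (K2 t))\<^sup>2 \<partial>lborel) \<le> ennreal (4 * r * E0)"
  obtains \<rho> where "0 < \<rho>" "\<rho> < r"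
    "\<And>\<sigma>. \<sigma> \<in> {1, -1} \<Longrightarrow> a + \<sigma> * \<rho> \<notin> N1 \<and> K1 (a + \<sigma> * \<rho>) \<le> 4 * sqrt E"
    "\<And>\<sigma>. \<sigma> \<in> {1, -1} \<Longrightarrow> b + \<sigma> * \<rho> \<notin> N2 \<and> K2 (b + \<sigma> * \<rho>) \<le> 4 * sqrt E"
proof -
  define T where "T \<rho> = (ennreal (K1 (a + 1 * \<rho>)))\<^sup>2 + (ennreal (K1 (a + (-1) * \<rho>)))\<^sup>2
     + (ennreal (K2 (b + 1 * \<rho>)))\<^sup>2 + (ennreal (K2 (b + (-1) * \<rho>)))\<^sup>2" for \<rho>
  have aff: "(\<integral>\<^sup>+\<rho>. (ennreal (k (c + \<sigma> * \<rho>)))\<^sup>2 \<partial>lborel) = (\<integral>\<^sup>+t. (ennreal (k t))\<^sup>2 \<partial>lborel)"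
    if "k \<in> borel_measurable borel" "\<bar>\<sigma>\<bar> = 1" for k :: "real \<Rightarrow> real" and c \<sigma>
  proof -
    have "\<sigma> \<noteq> 0" using that(2) by auto
    moreover have "(\<lambda>t. (ennreal (k t))\<^sup>2) \<in> borel_measurable borel" using that(1) by simp
    ultimately show ?thesis using nn_integral_real_affine[of "\<lambda>t. (ennreal (k t))\<^sup>2" \<sigma> c] that(2) by simp
  qed
  have Km': "(\<lambda>\<rho>. (ennreal (k (c + \<sigma> * \<rho>)))\<^sup>2) \<in> borel_measurable lborel"
    if "k \<in> borel_measurable borel" for k :: "real \<Rightarrow> real" and c \<sigma>
  proof -
    have "(\<lambda>\<rho>. k (c + \<sigma> * \<rho>)) \<in> borel_measurable borel" by (rule measurable_compose[OF _ that]) simp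
    then show ?thesis by simp
  qed
  have "(\<integral>\<^sup>+\<rho>. T \<rho> \<partial>lborel) = (\<integral>\<^sup>+t. (ennreal (K1 t))\<^sup>2 \<partial>lborel) + (\<integral>\<^sup>+t. (ennreal (K1 t))\<^sup>2 \<partial>lborel)
     + (\<integral>\<^sup>+t. (ennreal (K2 t))\<^sup>2 \<partial>lborel) + (\<integral>\<^sup>+t. (ennreal (K2 t))\<^sup>2 \<partial>lborel)"
    unfolding T_def using aff[OF Km(1)] aff[OF Km(2)] Km'[OF Km(1)] Km'[OF Km(2)]
    by (subst nn_integral_add | simp only: borel_measurable_add)+
  also have "\<dots> \<le> ennreal (4 * r * E0) + ennreal (4 * r * E0) + ennreal (4 * r * E0) + ennreal (4 * r * E0)"
    by (intro add_mono K)
  also have "\<dots> = ennreal (16 * r * E0)" using r E(1) by (simp flip: ennreal_plus)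
  finally have Tint: "(\<integral>\<^sup>+\<rho>. T \<rho> \<partial>lborel) \<le> ennreal (16 * r * E0)" .
  have AEN: "AE \<rho> in lborel. c + \<sigma> * \<rho> \<notin> N" if "N \<in> null_sets lborel" "\<bar>\<sigma>\<bar> = 1" for N :: "real set" and c \<sigma>
  proof (rule AE_borel_affine[where P = "\<lambda>x. x \<notin> N"])
    show "AE x in lborel. x \<notin> N" using that(1) by (rule AE_not_in)
    have "N \<in> sets borel" using that(1) by auto
    then show "Measurable.pred borel (\<lambda>x. x \<notin> N)" by simp
  qed (use that(2) in auto)
  have AEall: "AE \<rho> in lborel. a + 1 * \<rho> \<notin> N1 \<and> a + (-1) * \<rho> \<notin> N1 \<and> b + 1 * \<rho> \<notin> N2 \<and> b + (-1) * \<rho> \<notin> N2"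
    by (intro AE_conjI AEN N) auto
  have "\<exists>\<rho>. 0 < \<rho> \<and> \<rho> < r \<and> (a + 1 * \<rho> \<notin> N1 \<and> a + (-1) * \<rho> \<notin> N1 \<and> b + 1 * \<rho> \<notin> N2 \<and> b + (-1) * \<rho> \<notin> N2)
     \<and> T \<rho> \<le> ennreal (16 * E)"
  proof (rule ccontr)
    assume no: "\<not> ?thesis"
    have "AE \<rho> in lborel. indicator {0<..<r} \<rho> * ennreal (16 * E) \<le> T \<rho>"
      using AEall
    proof eventually_elim
      case (elim \<rho>)
      then show ?case using no by (cases "0 < \<rho> \<and> \<rho> < r") (auto simp: indicator_def not_le less_imp_le)
    qed
    then have "(\<integral>\<^sup>+\<rho>. indicator {0<..<r} \<rho> * ennreal (16 * E) \<partial>lborel) \<le> (\<integral>\<^sup>+\<rho>. T \<rho> \<partial>lborel)"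
      by (rule nn_integral_mono_AE)
    also have "(\<integral>\<^sup>+\<rho>. indicator {0<..<r} \<rho> * ennreal (16 * E) \<partial>lborel) = ennreal r * ennreal (16 * E)"
      using r by (subst nn_integral_multc) auto
    finally have "ennreal (r * (16 * E)) \<le> ennreal (16 * r * E0)"
      using Tint r E by (simp add: ennreal_mult' order_trans)
    then have "r * (16 * E) \<le> 16 * r * E0" using r E by (subst (asm) ennreal_le_iff) auto
    then show False using r E by simp
  qed
  then obtain \<rho> where \<rho>: "0 < \<rho>" "\<rho> < r" "a + 1 * \<rho> \<notin> N1" "a + (-1) * \<rho> \<notin> N1" "b + 1 * \<rho> \<notin> N2" "b + (-1) * \<rho> \<notin> N2"
    "T \<rho> \<le> ennreal (16 * E)" by blast
  have bnd: "x \<le> 4 * sqrt E" if "0 \<le> x" "(ennreal x)\<^sup>2 \<le> T \<rho>" for x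
  proof -
    have "ennreal (x\<^sup>2) \<le> ennreal (16 * E)" using order_trans[OF that(2) \<rho>(7)] that(1) by (simp add: ennreal_power)
    then have "x\<^sup>2 \<le> 16 * E" using E by (subst (asm) ennreal_le_iff) auto
    then have "x \<le> sqrt (16 * E)" by (rule real_le_rsqrt)
    also have "\<dots> = 4 * sqrt E" by (simp add: real_sqrt_mult)
    finally show ?thesis .
  qed
  have T1: "(ennreal (K1 (a + 1 * \<rho>)))\<^sup>2 \<le> T \<rho>" "(ennreal (K1 (a + (-1) * \<rho>)))\<^sup>2 \<le> T \<rho>"
    "(ennreal (K2 (b + 1 * \<rho>)))\<^sup>2 \<le> T \<rho>" "(ennreal (K2 (b + (-1) * \<rho>)))\<^sup>2 \<le> T \<rho>"
    unfolding T_def by (auto simp: add.assoc intro: add_increasing add_increasing2)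
  show ?thesis
  proof (rule that[OF \<rho>(1,2)])
    fix \<sigma> :: real assume "\<sigma> \<in> {1, -1}"
    then consider "\<sigma> = 1" | "\<sigma> = -1" by auto
    note c = this
    show "a + \<sigma> * \<rho> \<notin> N1 \<and> K1 (a + \<sigma> * \<rho>) \<le> 4 * sqrt E"
      by (rule c) (use \<rho> bnd[OF Knn(1) T1(1)] bnd[OF Knn(1) T1(2)] in simp_all)
    show "b + \<sigma> * \<rho> \<notin> N2 \<and> K2 (b + \<sigma> * \<rho>) \<le> 4 * sqrt E"
      by (rule c) (use \<rho> bnd[OF Knn(2) T1(3)] bnd[OF Knn(2) T1(4)] in simp_all)
  qed
qed

text \<open>The constant is the value of \<open>v\<close> at a corner of a good square. From any
  point of the frontier of that square at most two sides lead to the corner, each at a cost of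
  \<open>4 * sqrt E\<close>. For the mean square bound, every horizontal line through
  \<open>sq p r\<close> meets the vertical line through the corner, on which \<open>v\<close> stays
  within \<open>4 * sqrt E\<close> of the constant.\<close>

lemma local_estimate:
  assumes \<Omega>: "open \<Omega>" and v: "continuous_on \<Omega> v" "weak_gradient \<Omega> v g"
    and g2: "set_integrable lborel \<Omega> (\<lambda>x. (norm (g x))\<^sup>2)"
    and r: "r > 0" "sq p (2 * r) \<subseteq> \<Omega>" and E: "energy \<Omega> g < E"
  obtains m where "m \<in> v ` sq p r" "(LINT x:sq p r|lborel. (v x - m)\<^sup>2) \<le> 144 * r\<^sup>2 * E"
    "\<And>S. connected S \<Longrightarrow> p \<in> S \<Longrightarrow> \<not> S \<subseteq> sq p r \<Longrightarrow> \<exists>z\<in>S \<inter> sq p r. \<bar>v z - m\<bar> \<le> 8 * sqrt E"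
proof -
  define Q where "Q = sq p (2 * r)"
  \<comment> \<open>Test functions supported in \<open>W\<close> are supported in \<Omega>, and on
    their support the extension \<open>u\<close> below agrees with \<open>v\<close>.\<close>
  define W where "W = {x. \<forall>k. \<bar>x $ k - p $ k\<bar> < 2 * r}"
  define G where "G x = indicator Q x * norm (g x)" for x
  define h where "h k x = indicator Q x * g x $ k" for k x
  define l w where "l = (\<chi> k. p $ k - 2 * r)" and "w = (\<chi> k. p $ k + 2 * r)"
  have Qbox: "Q = cbox l w" by (simp add: Q_def l_def w_def sq_cbox)
  have Qc: "compact Q" and QO: "Q \<subseteq> \<Omega>" using r compact_sq by (auto simp: Q_def)
  have Qs: "Q \<in> sets borel" by (simp add: Qbox)
  have WQ: "W \<subseteq> Q" unfolding W_def Q_def sq_def using less_imp_le by blast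
  \<comment> \<open>The results on lines ask for a function that is continuous and bounded on the
    whole plane; \<open>ext_cont\<close> extends \<open>v\<close> from the square by clamping the
    argument.\<close>
  define u where "u = ext_cont v l w"
  have uv: "u x = v x" if "x \<in> Q" for x using that by (simp add: u_def Qbox)
  have vQ: "continuous_on (cbox l w) v" using v(1) QO continuous_on_subset Qbox by blast
  have uc: "continuous_on UNIV u" unfolding u_def by (rule continuous_on_ext_cont[OF vQ])
  obtain M where M: "\<And>x. \<bar>u x\<bar> \<le> M"
  proof -
    have "bounded (v ` cbox l w)" using vQ compact_continuous_image compact_imp_bounded compact_cbox by blast
    then have "bounded (range u)" unfolding u_def ext_cont_def
      by (rule clamp_bounded)
    then show ?thesis using that by (auto simp: bounded_iff)
  qed
  have hint: "integrable lborel (h k)" for k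
    using weak_gradient_locally_integrable(2)[OF v(2), of k] Qc QO
    unfolding locally_integrable_on_def set_integrable_def h_def[abs_def] by simp
  have gm: "(\<lambda>x. indicator Q x *\<^sub>R g x) \<in> borel_measurable borel"
  proof -
    have "(\<lambda>x. indicator Q x *\<^sub>R (indicator \<Omega> x *\<^sub>R g x)) \<in> borel_measurable borel"
      by (intro borel_measurable_scaleR weak_gradient_measurable[OF v(2) \<Omega>] borel_measurable_indicator Qs)
    moreover have "(\<lambda>x. indicator Q x *\<^sub>R (indicator \<Omega> x *\<^sub>R g x)) = (\<lambda>x. indicator Q x *\<^sub>R g x)"
      using QO by (auto simp: indicator_def fun_eq_iff)
    ultimately show ?thesis by simp
  qed
  have Gm: "G \<in> borel_measurable borel"
    using measurable_compose[OF gm borel_measurable_norm] by (simp add: G_def[abs_def])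
  have Gint: "integrable lborel G"
  proof (rule Bochner_Integration.integrable_bound[where f = "\<lambda>x. \<bar>h 1 x\<bar> + \<bar>h 2 x\<bar>"])
    show "integrable lborel (\<lambda>x. \<bar>h 1 x\<bar> + \<bar>h 2 x\<bar>)" using hint by simp
    show "AE x in lborel. norm (G x) \<le> norm (\<bar>h 1 x\<bar> + \<bar>h 2 x\<bar>)"
    proof (rule AE_I2)
      fix x
      show "norm (G x) \<le> norm (\<bar>h 1 x\<bar> + \<bar>h 2 x\<bar>)"
        using norm_le_l1_cart[of "g x"] by (simp add: G_def h_def UNIV_2 indicator_def)
    qed
  qed (use Gm in simp)
  have hG: "\<bar>h k x\<bar> \<le> G x" for k x
    using component_le_norm_cart[of "g x" k] by (simp add: h_def G_def indicator_def)
  have Gnn: "0 \<le> G x" for x by (simp add: G_def)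
  have weak: "(LINT x|lborel. u x * grad \<phi> x $ k) = - (LINT x|lborel. h k x * \<phi> x)" if t: "test_fun W \<phi>" for \<phi> k
  proof -
    obtain K where K: "smooth_fun \<phi>" "compact K" "K \<subseteq> W" "\<And>x. x \<notin> K \<Longrightarrow> \<phi> x = 0"
      "\<And>x. x \<notin> K \<Longrightarrow> grad \<phi> x = 0" using t by (rule test_funD) blast
    have KQ: "K \<subseteq> Q" using K(3) WQ by blast
    have KO: "K \<subseteq> \<Omega>" using KQ QO by blast
    have "test_fun \<Omega> \<phi>" by (rule test_funI[OF K(1,2) KO K(4)])
    from weak_gradientD[OF v(2) this, of k]
    have "(LINT x|lborel. v x * grad \<phi> x $ k) = - (LINT x|lborel. g x $ k * \<phi> x)"
      using set_lint_compact_support[OF KO, of "\<lambda>x. v x * grad \<phi> x $ k"]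
        set_lint_compact_support[OF KO, of "\<lambda>x. g x $ k * \<phi> x"] K(4,5) by simp
    moreover have "v x * grad \<phi> x $ k = u x * grad \<phi> x $ k" for x
      using uv[of x] K(5)[of x] KQ by (cases "x \<in> K") auto
    moreover have "g x $ k * \<phi> x = h k x * \<phi> x" for x
      using K(4)[of x] KQ by (cases "x \<in> K") (auto simp: h_def)
    ultimately show ?thesis by simp
  qed
  define K where "K k t = (LINT s|lborel. G (mk k s t))" for k t
  define E0 where "E0 = (LINT x|lborel. (G x)\<^sup>2)"
  have G2: "(G x)\<^sup>2 = indicator Q x * (norm (g x))\<^sup>2" for x by (simp add: G_def indicator_def)
  have "set_integrable lborel Q (\<lambda>x. (norm (g x))\<^sup>2)"
    by (rule set_integrable_subset[OF g2 _ QO]) (use Qs in simp)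
  then have G2int: "integrable lborel (\<lambda>x. (G x)\<^sup>2)" unfolding G2 set_integrable_def by simp
  have E0: "0 \<le> E0" "E0 < E"
  proof -
    show "0 \<le> E0" unfolding E0_def by (intro Bochner_Integration.integral_nonneg) simp
    have "E0 \<le> energy \<Omega> g" unfolding E0_def energy_def set_lebesgue_integral_def
      using G2int g2 QO unfolding set_integrable_def G2
      by (intro integral_mono) (auto simp: indicator_def)
    then show "E0 < E" using E by simp
  qed
  have Kint: "integrable lborel (K k)" for k unfolding K_def[abs_def] by (rule integral_mk(2)[OF Gint])
  have Km: "K k \<in> borel_measurable borel" for k using Kint by auto
  have Knn: "0 \<le> K k t" for k t unfolding K_def by (intro Bochner_Integration.integral_nonneg Gnn)
  have K2: "(\<integral>\<^sup>+t. (ennreal (K k t))\<^sup>2 \<partial>lborel) \<le> ennreal (4 * r * E0)" for k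
  proof -
    have "(\<integral>\<^sup>+t. (ennreal (K k t))\<^sup>2 \<partial>lborel) \<le> ennreal (4 * r) * (\<integral>\<^sup>+x. (ennreal (G x))\<^sup>2 \<partial>lborel)"
      unfolding K_def
    proof (rule fiber_integral_L2[OF Gint Gnn])
      show "G x = 0" if "\<bar>x $ k - p $ k\<bar> > 2 * r" for x
        using that by (auto simp: G_def Q_def sq_def indicator_def not_le)
    qed (use r in simp)
    also have "(\<integral>\<^sup>+x. (ennreal (G x))\<^sup>2 \<partial>lborel) = ennreal E0"
      using nn_integral_eq_integral[OF G2int] Gnn by (simp add: E0_def ennreal_power)
    finally show ?thesis using r E0 by (simp add: ennreal_mult')
  qed
  have osc: "\<exists>N. N \<in> null_sets lborel \<and> (\<forall>t s s'. t \<notin> N \<longrightarrow> \<bar>t - p $ j\<bar> \<le> r \<longrightarrow> \<bar>s - p $ i\<bar> \<le> r \<longrightarrow> \<bar>s' - p $ i\<bar> \<le> r \<longrightarrow>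
      \<bar>v (mk i s t) - v (mk i s' t)\<bar> \<le> K i t)" if ij: "i \<noteq> j" for i j :: 2
  proof -
    obtain N where N: "N \<in> null_sets lborel"
      "\<And>t s0 s1 d. t \<notin> N \<Longrightarrow> s0 \<le> s1 \<Longrightarrow> d > 0 \<Longrightarrow>
        {x. x $ i \<in> {s0..s1 + d} \<and> x $ j \<in> {t..t + d}} \<subseteq> W \<Longrightarrow> \<bar>u (mk i s1 t) - u (mk i s0 t)\<bar> \<le> K i t"
    proof (rule line_oscillation[OF ij uc M hint Gint hG, where W = W])
      show "(LINT x|lborel. u x * grad \<phi> x $ i) = - (LINT x|lborel. h i x * \<phi> x)" if "test_fun W \<phi>" for \<phi>
        by (rule weak[OF that])
    qed (rule that; simp add: K_def)
    have one: "\<bar>v (mk i s1 t) - v (mk i s0 t)\<bar> \<le> K i t"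
      if "t \<notin> N" "\<bar>t - p $ j\<bar> \<le> r" "\<bar>s0 - p $ i\<bar> \<le> r" "\<bar>s1 - p $ i\<bar> \<le> r" "s0 \<le> s1" for t s0 s1
    proof -
      \<comment> \<open>This is the purpose of the doubled square: after adding the margin
        \<open>r / 2\<close>, coordinates stay within \<open>3 * r / 2\<close> of the
        centre.\<close>
      have "{x. x $ i \<in> {s0..s1 + r / 2} \<and> x $ j \<in> {t..t + r / 2}} \<subseteq> W"
      proof
        fix x assume x: "x \<in> {x. x $ i \<in> {s0..s1 + r / 2} \<and> x $ j \<in> {t..t + r / 2}}"
        have "\<bar>x $ k - p $ k\<bar> < 2 * r" for k
          using index_2_cases[OF ij, of k] x that r(1) by auto
        then show "x \<in> W" by (simp add: W_def)
      qed
      from N(2)[OF that(1,5) _ this] have "\<bar>u (mk i s1 t) - u (mk i s0 t)\<bar> \<le> K i t" using r by simp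
      moreover have "mk i s t \<in> Q" if "\<bar>s - p $ i\<bar> \<le> r" for s
      proof -
        have "\<bar>mk i s t $ k - p $ k\<bar> \<le> 2 * r" for k
          using index_2_cases[OF ij, of k] that \<open>\<bar>t - p $ j\<bar> \<le> r\<close> r(1) mk_nth(1)[of i s t] mk_nth(2)[OF ij, of s t] by auto
        then show ?thesis by (simp add: Q_def sq_def)
      qed
      ultimately show ?thesis using uv that(3,4) by simp
    qed
    have "\<bar>v (mk i s t) - v (mk i s' t)\<bar> \<le> K i t"
      if "t \<notin> N" "\<bar>t - p $ j\<bar> \<le> r" "\<bar>s - p $ i\<bar> \<le> r" "\<bar>s' - p $ i\<bar> \<le> r" for t s s'
      using one[OF that(1,2,3,4)] one[OF that(1,2,4,3)] by (cases "s \<le> s'") (auto simp: abs_minus_commute)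
    then show ?thesis using N(1) by blast
  qed
  have n12: "(1::2) \<noteq> 2" "(2::2) \<noteq> 1" by simp_all
  obtain N1 where N1: "N1 \<in> null_sets lborel" "\<And>t s s'. t \<notin> N1 \<Longrightarrow> \<bar>t - p $ 2\<bar> \<le> r \<Longrightarrow> \<bar>s - p $ 1\<bar> \<le> r \<Longrightarrow> \<bar>s' - p $ 1\<bar> \<le> r \<Longrightarrow>
      \<bar>v (mk 1 s t) - v (mk 1 s' t)\<bar> \<le> K 1 t" using osc[OF n12(1)] by blast
  \<comment> \<open>For vertical lines \<open>osc\<close> speaks of \<open>mk 2\<close>; swapping
    the arguments expresses both families of lines by \<open>mk 1\<close>.\<close>
  obtain N2 where N2: "N2 \<in> null_sets lborel" "\<And>t s s'. t \<notin> N2 \<Longrightarrow> \<bar>t - p $ 1\<bar> \<le> r \<Longrightarrow> \<bar>s - p $ 2\<bar> \<le> r \<Longrightarrow> \<bar>s' - p $ 2\<bar> \<le> r \<Longrightarrow>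
      \<bar>v (mk 1 t s) - v (mk 1 t s')\<bar> \<le> K 2 t" using osc[OF n12(2)] unfolding mk_swap[OF n12(1)] by blast
  obtain \<rho> where \<rho>: "0 < \<rho>" "\<rho> < r"
    "\<And>\<sigma>. \<sigma> \<in> {1, -1} \<Longrightarrow> p $ 2 + \<sigma> * \<rho> \<notin> N1 \<and> K 1 (p $ 2 + \<sigma> * \<rho>) \<le> 4 * sqrt E"
    "\<And>\<sigma>. \<sigma> \<in> {1, -1} \<Longrightarrow> p $ 1 + \<sigma> * \<rho> \<notin> N2 \<and> K 2 (p $ 1 + \<sigma> * \<rho>) \<le> 4 * sqrt E"
    by (rule good_radius_exists[OF r(1) E0 N1(1) N2(1) Km Km Knn Knn K2 K2]) blast
  define m where "m = v (mk 1 (p $ 1 + \<rho>) (p $ 2 + \<rho>))"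
  have hor: "\<bar>v (mk 1 s t) - v (mk 1 s' t)\<bar> \<le> 4 * sqrt E"
    if "\<bar>t - p $ 2\<bar> = \<rho>" "\<bar>s - p $ 1\<bar> \<le> \<rho>" "\<bar>s' - p $ 1\<bar> \<le> \<rho>" for t s s'
  proof -
    define \<sigma> :: real where "\<sigma> = (if t \<ge> p $ 2 then 1 else -1)"
    have \<sigma>: "\<sigma> \<in> {1, -1}" "t = p $ 2 + \<sigma> * \<rho>" using that(1) by (auto simp: \<sigma>_def)
    have "\<bar>v (mk 1 s t) - v (mk 1 s' t)\<bar> \<le> K 1 t" using \<rho>(3)[OF \<sigma>(1)] \<sigma>(2) that \<rho>(2) by (intro N1(2)) auto
    also have "\<dots> \<le> 4 * sqrt E" using \<rho>(3)[OF \<sigma>(1)] \<sigma>(2) by simp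
    finally show ?thesis .
  qed
  \<comment> \<open>Unlike \<open>hor\<close>, this allows heights up to \<open>r\<close> and not
    just \<rho>: the mean square estimate moves along the whole part of the vertical line within
    \<open>sq p r\<close>.\<close>
  have ver: "\<bar>v (mk 1 t s) - v (mk 1 t s')\<bar> \<le> 4 * sqrt E"
    if "\<bar>t - p $ 1\<bar> = \<rho>" "\<bar>s - p $ 2\<bar> \<le> r" "\<bar>s' - p $ 2\<bar> \<le> r" for t s s'
  proof -
    define \<sigma> :: real where "\<sigma> = (if t \<ge> p $ 1 then 1 else -1)"
    have \<sigma>: "\<sigma> \<in> {1, -1}" "t = p $ 1 + \<sigma> * \<rho>" using that(1) by (auto simp: \<sigma>_def)
    have "\<bar>v (mk 1 t s) - v (mk 1 t s')\<bar> \<le> K 2 t" using \<rho>(4)[OF \<sigma>(1)] \<sigma>(2) that \<rho>(2) by (intro N2(2)) auto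
    also have "\<dots> \<le> 4 * sqrt E" using \<rho>(4)[OF \<sigma>(1)] \<sigma>(2) by simp
    finally show ?thesis .
  qed
  show ?thesis
  proof (rule that[of m])
    have "mk 1 (p $ 1 + \<rho>) (p $ 2 + \<rho>) \<in> sq p r"
      using \<rho>(1,2) by (simp add: sq_def forall_2 mk_nth(1) mk_nth(2)[OF n12(1)])
    then show "m \<in> v ` sq p r" unfolding m_def by (rule imageI)
  next
    fix S assume S: "connected S" "p \<in> S" "\<not> S \<subseteq> sq p r"
    obtain z k where z: "z \<in> S" "z \<in> sq p \<rho>" "\<bar>z $ k - p $ k\<bar> = \<rho>"
      using connected_meets_square_frontier[OF S, of \<rho>] \<rho>(1,2) by auto
    have zz: "z = mk 1 (z $ 1) (z $ 2)" using mk_eq[OF n12(1), of z] by simp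
    have zb: "\<bar>z $ 1 - p $ 1\<bar> \<le> \<rho>" "\<bar>z $ 2 - p $ 2\<bar> \<le> \<rho>" using z(2) by (auto simp: sq_def)
    have "\<bar>v z - m\<bar> \<le> 8 * sqrt E"
    proof (cases "k = 2")
      case True
      have "\<bar>v (mk 1 (z $ 1) (z $ 2)) - v (mk 1 (p $ 1 + \<rho>) (z $ 2))\<bar> \<le> 4 * sqrt E"
        using z(3) True zb \<rho> by (intro hor) auto
      moreover have "\<bar>v (mk 1 (p $ 1 + \<rho>) (z $ 2)) - m\<bar> \<le> 4 * sqrt E"
        unfolding m_def using zb \<rho> by (intro ver) auto
      ultimately show ?thesis unfolding zz[symmetric] by linarith
    next
      case False
      then have "k = 1" using exhaust_2[of k] by blast
      then have "\<bar>v (mk 1 (z $ 1) (z $ 2)) - v (mk 1 (z $ 1) (p $ 2 + \<rho>))\<bar> \<le> 4 * sqrt E"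
        using z(3) zb \<rho> by (intro ver) auto
      moreover have "\<bar>v (mk 1 (z $ 1) (p $ 2 + \<rho>)) - m\<bar> \<le> 4 * sqrt E"
        unfolding m_def using zb \<rho> by (intro hor) auto
      ultimately show ?thesis unfolding zz[symmetric] by linarith
    qed
    moreover have "z \<in> sq p r" using z(2) sq_mono[of \<rho> r p] \<rho>(2) by auto
    ultimately show "\<exists>z\<in>S \<inter> sq p r. \<bar>v z - m\<bar> \<le> 8 * sqrt E" using z(1) by blast
  next
    let ?I = "{p $ 1 - r..p $ 1 + r}" and ?J = "{p $ 2 - r..p $ 2 + r}"
    define f where "f x = indicator (sq p r) x * (v x - m)\<^sup>2" for x
    have sqQ: "sq p r \<subseteq> Q" using r sq_mono[of r "2 * r" p] by (simp add: Q_def)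
    have fu: "f x = indicator (sq p r) x * (u x - m)\<^sup>2" for x
      using uv[of x] sqQ by (auto simp: f_def indicator_def)
    have fm: "f \<in> borel_measurable borel"
    proof -
      have "u \<in> borel_measurable borel" by (rule borel_measurable_continuous_onI[OF uc])
      moreover have "sq p r \<in> sets borel" by (simp add: sq_cbox)
      ultimately show ?thesis unfolding fu[abs_def] by simp
    qed
    have sqmk: "mk 1 s t \<in> sq p r \<longleftrightarrow> s \<in> ?I \<and> t \<in> ?J" for s t
      by (auto simp: sq_def forall_2 mk_nth(1) mk_nth(2)[OF n12(1)] abs_le_iff)
    \<comment> \<open>First along the horizontal line to the good vertical line, then along that
      line to the corner; the square of the sum of the two costs is at most
      \<open>2 * (K 1 t)\<^sup>2 + 2 * (4 * sqrt E)\<^sup>2\<close>.\<close>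
    have pt: "ennreal (f (mk 1 s t)) \<le> indicator ?I s * (indicator ?J t * ennreal (2 * (K 1 t)\<^sup>2 + 32 * E))"
      if "t \<notin> N1" for s t
    proof (cases "s \<in> ?I \<and> t \<in> ?J")
      case True
      then have "\<bar>v (mk 1 s t) - v (mk 1 (p $ 1 + \<rho>) t)\<bar> \<le> K 1 t"
        using that \<rho> by (intro N1(2)) auto
      moreover have "\<bar>v (mk 1 (p $ 1 + \<rho>) t) - m\<bar> \<le> 4 * sqrt E"
        unfolding m_def using True \<rho> by (intro ver) auto
      ultimately have "\<bar>v (mk 1 s t) - m\<bar> \<le> K 1 t + 4 * sqrt E" by linarith
      then have "(v (mk 1 s t) - m)\<^sup>2 \<le> (K 1 t + 4 * sqrt E)\<^sup>2" by (metis abs_ge_zero power2_abs power_mono)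
      also have "\<dots> \<le> 2 * (K 1 t)\<^sup>2 + 2 * (4 * sqrt E)\<^sup>2"
        using sum_squares_bound[of "K 1 t" "4 * sqrt E"] by (simp add: power2_sum)
      also have "\<dots> = 2 * (K 1 t)\<^sup>2 + 32 * E" using E0 by (simp add: power_mult_distrib)
      finally show ?thesis using True sqmk by (simp add: f_def ennreal_leI)
    next
      case False
      then have "f (mk 1 s t) = 0" using sqmk by (simp add: f_def)
      then show ?thesis by simp
    qed
    have "(\<integral>\<^sup>+x. ennreal (f x) \<partial>lborel) = (\<integral>\<^sup>+t. (\<integral>\<^sup>+s. ennreal (f (mk 1 s t)) \<partial>lborel) \<partial>lborel)"
      using fm by (intro nn_integral_mk) simp
    also have "\<dots> \<le> (\<integral>\<^sup>+t. ennreal (4 * r) * (ennreal (K 1 t))\<^sup>2 + ennreal (64 * r * E) * indicator ?J t \<partial>lborel)"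
    proof (rule nn_integral_mono_AE)
      have "AE t in lborel. t \<notin> N1" using N1(1) by (rule AE_not_in)
      then show "AE t in lborel. (\<integral>\<^sup>+s. ennreal (f (mk 1 s t)) \<partial>lborel)
          \<le> ennreal (4 * r) * (ennreal (K 1 t))\<^sup>2 + ennreal (64 * r * E) * indicator ?J t"
      proof eventually_elim
        case (elim t)
        have "(\<integral>\<^sup>+s. ennreal (f (mk 1 s t)) \<partial>lborel)
            \<le> (\<integral>\<^sup>+s. indicator ?I s * (indicator ?J t * ennreal (2 * (K 1 t)\<^sup>2 + 32 * E)) \<partial>lborel)"
          by (intro nn_integral_mono pt elim)
        also have "\<dots> = ennreal (2 * r) * (indicator ?J t * ennreal (2 * (K 1 t)\<^sup>2 + 32 * E))"
          using r by (subst nn_integral_multc) auto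
        also have "\<dots> \<le> ennreal (4 * r) * (ennreal (K 1 t))\<^sup>2 + ennreal (64 * r * E) * indicator ?J t"
        proof (cases "t \<in> ?J")
          case True
          have "ennreal (2 * r) * ennreal (2 * (K 1 t)\<^sup>2 + 32 * E) = ennreal (2 * r * (2 * (K 1 t)\<^sup>2 + 32 * E))"
            using r by (simp add: ennreal_mult')
          also have "\<dots> = ennreal (4 * r * (K 1 t)\<^sup>2 + 64 * r * E)" by (simp add: algebra_simps)
          also have "\<dots> = ennreal (4 * r * (K 1 t)\<^sup>2) + ennreal (64 * r * E)"
            using r E0 by (intro ennreal_plus) auto
          also have "\<dots> = ennreal (4 * r) * (ennreal (K 1 t))\<^sup>2 + ennreal (64 * r * E)"
            using r Knn[of 1 t] by (simp add: ennreal_mult' ennreal_power)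
          finally show ?thesis using True by simp
        qed simp
        finally show ?case .
      qed
    qed
    also have "\<dots> = ennreal (4 * r) * (\<integral>\<^sup>+t. (ennreal (K 1 t))\<^sup>2 \<partial>lborel) + ennreal (64 * r * E) * ennreal (2 * r)"
      using Km[of 1] r by (subst nn_integral_add) (auto simp: nn_integral_cmult)
    also have "\<dots> \<le> ennreal (4 * r) * ennreal (4 * r * E0) + ennreal (64 * r * E) * ennreal (2 * r)"
      by (intro add_mono mult_left_mono K2) auto
    \<comment> \<open>The first summand stems from the integral of \<open>(K 1 t)\<^sup>2\<close>,
      the second from the constant \<open>32 * E\<close> on a square of area
      \<open>(2 * r)\<^sup>2\<close>. With \<open>E0 < E\<close> the factors 16 and 128 add up to
      144.\<close>
    also have "\<dots> = ennreal (16 * r\<^sup>2 * E0 + 128 * r\<^sup>2 * E)"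
      using r E0 by (simp add: power2_eq_square flip: ennreal_mult' ennreal_plus)
    also have "\<dots> \<le> ennreal (144 * r\<^sup>2 * E)"
    proof (rule ennreal_leI)
      have "16 * r\<^sup>2 * E0 \<le> 16 * r\<^sup>2 * E" using E0 by (intro mult_left_mono) auto
      then show "16 * r\<^sup>2 * E0 + 128 * r\<^sup>2 * E \<le> 144 * r\<^sup>2 * E" by linarith
    qed
    finally have "(LINT x|lborel. f x) \<le> 144 * r\<^sup>2 * E"
      using E0 by (intro integral_real_bounded) auto
    then show "(LINT x:sq p r|lborel. (v x - m)\<^sup>2) \<le> 144 * r\<^sup>2 * E"
      by (simp add: set_lebesgue_integral_def f_def)
  qed
qed

section \<open>Sequences of functions with vanishing energy\<close>

text \<open>Only limits are passed from square to square, so neither the number of squares nor the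
  constants of the local estimate have to be tracked.\<close>

definition vanishing :: "R2 set \<Rightarrow> (nat \<Rightarrow> R2 \<Rightarrow> real) \<Rightarrow> (nat \<Rightarrow> R2 \<Rightarrow> R2) \<Rightarrow> bool" where
  "vanishing \<Omega> v g \<longleftrightarrow> (\<forall>n. continuous_on \<Omega> (v n)) \<and> (\<forall>n. weak_gradient \<Omega> (v n) (g n)) \<and>
     (\<forall>n. set_integrable lborel \<Omega> (\<lambda>x. (norm (g n x))\<^sup>2)) \<and> (\<lambda>n. energy \<Omega> (g n)) \<longlonglongrightarrow> 0"

text \<open>The constants may depend on \<open>n\<close> and are not assumed to converge or to be
  bounded; that they tend to 0 is shown afterwards by other means.\<close>

definition L2null :: "R2 set \<Rightarrow> (nat \<Rightarrow> R2 \<Rightarrow> real) \<Rightarrow> (nat \<Rightarrow> real) \<Rightarrow> bool" where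
  "L2null A v m \<longleftrightarrow> (\<lambda>n. LINT x:A|lborel. (v n x - m n)\<^sup>2) \<longlonglongrightarrow> 0"

section \<open>Closeness to constants in mean square\<close>

lemma set_integrable_continuous:
  fixes f :: "R2 \<Rightarrow> real"
  shows "compact K \<Longrightarrow> continuous_on K f \<Longrightarrow> set_integrable lborel K f"
  unfolding set_integrable_def by (rule borel_integrable_compact)

lemma set_lint_nonneg:
  fixes f :: "R2 \<Rightarrow> real"
  shows "(\<And>x. 0 \<le> f x) \<Longrightarrow> 0 \<le> (LINT x:A|lborel. f x)"
  unfolding set_lebesgue_integral_def by (intro Bochner_Integration.integral_nonneg) auto

lemma null_dominated:
  fixes a b :: "nat \<Rightarrow> real"
  assumes "\<And>n. 0 \<le> a n" "\<And>n. a n \<le> b n" "b \<longlonglongrightarrow> 0"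
  shows "a \<longlonglongrightarrow> 0"
  by (rule Lim_null_comparison[OF _ assms(3)]) (use assms(1,2) in \<open>auto intro!: always_eventually\<close>)

lemma L2null_dominated:
  assumes "\<And>n. (LINT x:A|lborel. (v n x - m n)\<^sup>2) \<le> b n" "b \<longlonglongrightarrow> 0"
  shows "L2null A v m"
  unfolding L2null_def by (rule null_dominated[OF _ assms]) (rule set_lint_nonneg, simp)

lemma L2null_subset:
  assumes A: "L2null A v m" "compact A" "compact B" "B \<subseteq> A" "\<And>n. continuous_on A (v n)"
  shows "L2null B v m"
proof (rule L2null_dominated)
  show "(\<lambda>n. LINT x:A|lborel. (v n x - m n)\<^sup>2) \<longlonglongrightarrow> 0" using A(1) by (simp add: L2null_def)
  fix n
  have "set_integrable lborel A (\<lambda>x. (v n x - m n)\<^sup>2)"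
    by (intro set_integrable_continuous A continuous_intros)
  moreover have "set_integrable lborel B (\<lambda>x. (v n x - m n)\<^sup>2)"
    by (intro set_integrable_continuous A continuous_intros) (rule continuous_on_subset[OF A(5,4)])
  ultimately show "(LINT x:B|lborel. (v n x - m n)\<^sup>2) \<le> (LINT x:A|lborel. (v n x - m n)\<^sup>2)"
    unfolding set_lebesgue_integral_def set_integrable_def
    using A(4) by (intro integral_mono) (auto simp: indicator_def)
qed

text \<open>The sum has a name of its own so that a cancelling sum such as
  \<open>(v n x - m' n) + (m n - v n x)\<close> can be given in simplified form.\<close>

lemma set_lint_square_add_le:
  fixes f h k :: "R2 \<Rightarrow> real"
  assumes A: "compact A" and c: "continuous_on A f" "continuous_on A h"
    and k: "\<And>x. k x = f x + h x"
  shows "(LINT x:A|lborel. (k x)\<^sup>2) \<le> 2 * (LINT x:A|lborel. (f x)\<^sup>2) + 2 * (LINT x:A|lborel. (h x)\<^sup>2)"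
proof -
  have i: "set_integrable lborel A (\<lambda>x. (f x)\<^sup>2)" "set_integrable lborel A (\<lambda>x. (h x)\<^sup>2)"
    "set_integrable lborel A (\<lambda>x. (k x)\<^sup>2)"
    unfolding k by (intro set_integrable_continuous A continuous_intros c)+
  have "(LINT x:A|lborel. (k x)\<^sup>2) \<le> (LINT x:A|lborel. 2 * (f x)\<^sup>2 + 2 * (h x)\<^sup>2)"
  proof (rule set_integral_mono)
    show "set_integrable lborel A (\<lambda>x. 2 * (f x)\<^sup>2 + 2 * (h x)\<^sup>2)"
      by (intro set_integral_add set_integrable_mult_right i)
    show "(k x)\<^sup>2 \<le> 2 * (f x)\<^sup>2 + 2 * (h x)\<^sup>2" for x
      using sum_squares_bound[of "f x" "h x"] unfolding k by (simp add: power2_sum)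
  qed (rule i)
  also have "\<dots> = 2 * (LINT x:A|lborel. (f x)\<^sup>2) + 2 * (LINT x:A|lborel. (h x)\<^sup>2)"
    using i by (subst set_integral_add) auto
  finally show ?thesis .
qed

lemma set_lint_const_sq: "s \<ge> 0 \<Longrightarrow> (LINT x:sq q s|lborel. c) = (2 * s)\<^sup>2 * (c::real)"
  using measure_sq[of s q] by (simp add: set_lebesgue_integral_def sq_cbox)

text \<open>On a square, however small, the difference of the constants has mean square equal to the
  area times its square, so the triangle inequality controls it. This is the uniqueness that glues
  local constants together.\<close>

lemma L2null_means_close:
  assumes m: "L2null (sq q s) v m" "L2null (sq q s) v m'" and s: "s > 0"
    and c: "\<And>n. continuous_on (sq q s) (v n)"
  shows "(\<lambda>n. m n - m' n) \<longlonglongrightarrow> 0"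
proof -
  have le: "(2 * s)\<^sup>2 * (m n - m' n)\<^sup>2 \<le> 2 * (LINT x:sq q s|lborel. (v n x - m' n)\<^sup>2) + 2 * (LINT x:sq q s|lborel. (m n - v n x)\<^sup>2)" for n
    using set_lint_square_add_le[OF compact_sq, of q s "\<lambda>x. v n x - m' n" "\<lambda>x. m n - v n x" "\<lambda>x. m n - m' n",
        OF continuous_on_diff[OF c continuous_on_const] continuous_on_diff[OF continuous_on_const c]]
      set_lint_const_sq[of s q "(m n - m' n)\<^sup>2"] s by simp
  have le': "(m n - m' n)\<^sup>2 \<le> (2 * (LINT x:sq q s|lborel. (v n x - m' n)\<^sup>2) + 2 * (LINT x:sq q s|lborel. (v n x - m n)\<^sup>2)) / (2 * s)\<^sup>2" for n
    using le[of n] s by (simp add: power2_commute[of "m n"] field_simps)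
  have "(\<lambda>n. (2 * (LINT x:sq q s|lborel. (v n x - m' n)\<^sup>2) + 2 * (LINT x:sq q s|lborel. (v n x - m n)\<^sup>2)) / (2 * s)\<^sup>2)
      \<longlonglongrightarrow> (2 * 0 + 2 * 0) / (2 * s)\<^sup>2"
    using m s unfolding L2null_def by (intro tendsto_intros) auto
  then have "(\<lambda>n. (m n - m' n)\<^sup>2) \<longlonglongrightarrow> 0"
    by (intro null_dominated[OF _ le']) simp_all
  then have "(\<lambda>n. sqrt ((m n - m' n)\<^sup>2)) \<longlonglongrightarrow> sqrt 0" by (rule tendsto_real_sqrt)
  then show ?thesis by (simp add: tendsto_rabs_zero_iff)
qed

lemma L2null_change_mean:
  assumes m: "L2null (sq q s) v m'" "(\<lambda>n. m n - m' n) \<longlonglongrightarrow> 0" and s: "s \<ge> 0"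
    and c: "\<And>n. continuous_on (sq q s) (v n)"
  shows "L2null (sq q s) v m"
proof (rule L2null_dominated)
  fix n
  show "(LINT x:sq q s|lborel. (v n x - m n)\<^sup>2) \<le>
     2 * (LINT x:sq q s|lborel. (v n x - m' n)\<^sup>2) + 2 * ((2 * s)\<^sup>2 * (m' n - m n)\<^sup>2)"
    using set_lint_square_add_le[OF compact_sq, of q s "\<lambda>x. v n x - m' n" "\<lambda>x. m' n - m n" "\<lambda>x. v n x - m n",
        OF continuous_on_diff[OF c continuous_on_const] continuous_on_const]
      set_lint_const_sq[OF s, of q "(m' n - m n)\<^sup>2"] by simp
next
  have "(\<lambda>n. 2 * (LINT x:sq q s|lborel. (v n x - m' n)\<^sup>2) + 2 * ((2 * s)\<^sup>2 * (m n - m' n)\<^sup>2)) \<longlonglongrightarrow> 2 * 0 + 2 * ((2 * s)\<^sup>2 * 0\<^sup>2)"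
    using m unfolding L2null_def by (intro tendsto_intros) auto
  then show "(\<lambda>n. 2 * (LINT x:sq q s|lborel. (v n x - m' n)\<^sup>2) + 2 * ((2 * s)\<^sup>2 * (m' n - m n)\<^sup>2)) \<longlonglongrightarrow> 0"
    by (simp add: power2_commute[of "m' _"])
qed

text \<open>The sets \<open>S n\<close> may vary with \<open>n\<close>, as the curves will. That
  \<open>m n\<close> is a value of \<open>v n\<close> matters for signs: nonnegative functions
  receive nonnegative constants.\<close>

lemma vanishing_local:
  assumes \<Omega>: "open \<Omega>" and v: "vanishing \<Omega> v g" and r: "r > 0" "sq p (2 * r) \<subseteq> \<Omega>"
  obtains m where "\<And>n. m n \<in> v n ` \<Omega>" "L2null (sq p r) v m"
    "\<And>S. (\<And>n. connected (S n)) \<Longrightarrow> (\<And>n. p \<in> S n) \<Longrightarrow> (\<And>n. \<not> S n \<subseteq> sq p r) \<Longrightarrow>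
      \<exists>z. (\<forall>n. z n \<in> S n \<inter> sq p r) \<and> (\<lambda>n. v n (z n) - m n) \<longlonglongrightarrow> 0"
proof -
  \<comment> \<open>\<open>local_estimate\<close> wants a bound strictly above the energy; the added
    null sequence supplies it, also when the energy is 0.\<close>
  define E where "E n = energy \<Omega> (g n) + 1 / real (Suc n)" for n
  have Elim: "E \<longlonglongrightarrow> 0"
    unfolding E_def using tendsto_add[of "\<lambda>n. energy \<Omega> (g n)" 0 sequentially "\<lambda>n. 1 / real (Suc n)" 0] v LIMSEQ_inverse_real_of_nat
    by (simp add: vanishing_def inverse_eq_divide)
  have "\<exists>m. m \<in> v n ` sq p r \<and> (LINT x:sq p r|lborel. (v n x - m)\<^sup>2) \<le> 144 * r\<^sup>2 * E n \<and>
    (\<forall>S. connected S \<longrightarrow> p \<in> S \<longrightarrow> \<not> S \<subseteq> sq p r \<longrightarrow> (\<exists>z\<in>S \<inter> sq p r. \<bar>v n z - m\<bar> \<le> 8 * sqrt (E n)))" for n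
    by (rule local_estimate[OF \<Omega>, of "v n" "g n" r p "E n"])
       (use v r in \<open>auto simp: vanishing_def E_def\<close>)
  then obtain m where m: "\<And>n. m n \<in> v n ` sq p r"
    "\<And>n. (LINT x:sq p r|lborel. (v n x - m n)\<^sup>2) \<le> 144 * r\<^sup>2 * E n"
    "\<And>n S. connected S \<Longrightarrow> p \<in> S \<Longrightarrow> \<not> S \<subseteq> sq p r \<Longrightarrow> (\<exists>z\<in>S \<inter> sq p r. \<bar>v n z - m n\<bar> \<le> 8 * sqrt (E n))"
    by metis
  show ?thesis
  proof (rule that[of m])
    have "sq p r \<subseteq> \<Omega>" using r sq_mono[of r "2 * r" p] by auto
    then show "m n \<in> v n ` \<Omega>" for n using m(1)[of n] by blast
    show "L2null (sq p r) v m"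
    proof (rule L2null_dominated[OF m(2)])
      show "(\<lambda>n. 144 * r\<^sup>2 * E n) \<longlonglongrightarrow> 0" using tendsto_mult_right_zero[OF Elim] .
    qed
    fix S :: "nat \<Rightarrow> R2 set" assume S: "\<And>n. connected (S n)" "\<And>n. p \<in> S n" "\<And>n. \<not> S n \<subseteq> sq p r"
    have "\<exists>z. z \<in> S n \<inter> sq p r \<and> \<bar>v n z - m n\<bar> \<le> 8 * sqrt (E n)" for n
      using m(3)[OF S, of n] by blast
    then obtain z where z: "\<And>n. z n \<in> S n \<inter> sq p r" "\<And>n. \<bar>v n (z n) - m n\<bar> \<le> 8 * sqrt (E n)" by metis
    have "(\<lambda>n. 8 * sqrt (E n)) \<longlonglongrightarrow> 8 * sqrt 0" by (intro tendsto_intros Elim)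
    then have "(\<lambda>n. 8 * sqrt (E n)) \<longlonglongrightarrow> 0" by simp
    then have "(\<lambda>n. v n (z n) - m n) \<longlonglongrightarrow> 0"
      by (rule Lim_null_comparison[rotated]) (use z(2) in auto)
    then show "\<exists>z. (\<forall>n. z n \<in> S n \<inter> sq p r) \<and> (\<lambda>n. v n (z n) - m n) \<longlonglongrightarrow> 0" using z(1) by blast
  qed
qed

lemma sq_subset_sq:
  assumes "dist q' q \<le> a" "s + a \<le> r"
  shows "sq q' s \<subseteq> sq q r"
proof
  fix x assume x: "x \<in> sq q' s"
  have "\<bar>x $ k - q $ k\<bar> \<le> r" for k
  proof -
    have "\<bar>q' $ k - q $ k\<bar> \<le> a" using component_le_norm_cart[of "q' - q" k] assms(1) by (simp add: dist_norm)
    moreover have "\<bar>x $ k - q' $ k\<bar> \<le> s" using x by (simp add: sq_def)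
    ultimately show ?thesis using assms(2) by linarith
  qed
  then show "x \<in> sq q r" by (simp add: sq_def)
qed

text \<open>The set of centres around which \<open>m\<close> works is open. So is its complement in
  \<Omega>: near any point some local constant works, and if it shares a small square with
  \<open>m\<close>, the two differ by a null sequence, so \<open>m\<close> works there too.
  Connectedness gives all of \<Omega>, and finitely many squares cover \<open>K\<close>.\<close>

lemma vanishing_global:
  assumes \<Omega>: "open \<Omega>" "connected \<Omega>" and v: "vanishing \<Omega> v g"
    and p: "p \<in> \<Omega>" "r > 0" "sq p r \<subseteq> \<Omega>" "L2null (sq p r) v m"
    and K: "compact K" "K \<subseteq> \<Omega>"
  shows "L2null K v m"
proof -
  have c: "continuous_on A (v n)" if "A \<subseteq> \<Omega>" for A n
    using v that continuous_on_subset unfolding vanishing_def by blast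
  define A where "A = {q \<in> \<Omega>. \<exists>r>0. sq q r \<subseteq> \<Omega> \<and> L2null (sq q r) v m}"
  have "open A"
  proof (rule openI)
    fix q assume "q \<in> A"
    then obtain r where r: "r > 0" "sq q r \<subseteq> \<Omega>" "L2null (sq q r) v m" by (auto simp: A_def)
    have "q' \<in> A" if "q' \<in> ball q (r / 2)" for q'
    proof -
      have sub: "sq q' (r / 2) \<subseteq> sq q r"
        using that by (intro sq_subset_sq[of q' q "r / 2"]) (auto simp: dist_commute)
      have "L2null (sq q' (r / 2)) v m"
        by (rule L2null_subset[OF r(3) compact_sq compact_sq sub c[OF r(2)]])
      moreover have "q' \<in> sq q' (r / 2)" using r by (simp add: sq_def)
      ultimately show ?thesis unfolding A_def using sub r by (intro CollectI conjI exI[of _ "r / 2"]) auto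
    qed
    then show "\<exists>e>0. ball q e \<subseteq> A" using r(1) by (intro exI[of _ "r / 2"]) auto
  qed
  moreover have "open (\<Omega> - A)"
  proof (rule openI)
    fix q assume q: "q \<in> \<Omega> - A"
    obtain r0 where r0: "r0 > 0" "sq q r0 \<subseteq> \<Omega>" using open_contains_sq[OF \<Omega>(1), of q] q by blast
    define r where "r = r0 / 2"
    have r: "r > 0" "sq q (2 * r) \<subseteq> \<Omega>" using r0 by (auto simp: r_def)
    have rO: "sq q r \<subseteq> \<Omega>" using r sq_mono[of r "2 * r" q] by auto
    obtain m' where m': "L2null (sq q r) v m'" by (rule vanishing_local[OF \<Omega>(1) v r])
    have "q' \<in> \<Omega> - A" if q': "q' \<in> ball q (r / 2)" for q'
    proof (rule ccontr)
      assume no: "q' \<notin> \<Omega> - A"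
      have "q' \<in> sq q r" using q' ball_subset_sq[of q "r / 2"] sq_mono[of "r / 2" r q] r(1) by auto
      then have "q' \<in> A" using no rO by blast
      then obtain r' where r': "r' > 0" "sq q' r' \<subseteq> \<Omega>" "L2null (sq q' r') v m" by (auto simp: A_def)
      \<comment> \<open>Small enough for \<open>sq q' s\<close> to lie in both squares, where the
        two constants are compared.\<close>
      define s where "s = min r' (r / 2)"
      have s: "s > 0" using r r' by (simp add: s_def)
      have s1: "sq q' s \<subseteq> sq q r" using q' by (intro sq_subset_sq[of q' q "r / 2"]) (auto simp: dist_commute s_def)
      have s2: "sq q' s \<subseteq> sq q' r'" by (rule sq_mono) (simp add: s_def)
      have "(\<lambda>n. m n - m' n) \<longlonglongrightarrow> 0"
      proof (rule L2null_means_close[OF _ _ s])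
        show "L2null (sq q' s) v m" by (rule L2null_subset[OF r'(3) compact_sq compact_sq s2 c[OF r'(2)]])
        show "L2null (sq q' s) v m'" by (rule L2null_subset[OF m' compact_sq compact_sq s1 c[OF rO]])
        show "continuous_on (sq q' s) (v n)" for n using s1 rO by (intro c) auto
      qed
      then have "L2null (sq q r) v m" using r by (intro L2null_change_mean[OF m'] c[OF rO]) auto
      then have "q \<in> A" unfolding A_def using q r rO by blast
      then show False using q by blast
    qed
    then show "\<exists>e>0. ball q e \<subseteq> \<Omega> - A" using r(1) by (intro exI[of _ "r / 2"]) auto
  qed
  moreover have "p \<in> A" using p by (auto simp: A_def)
  ultimately have "\<Omega> \<subseteq> A"
    using connectedD[OF \<Omega>(2), of A "\<Omega> - A"] p(1) by blast
  then have "\<exists>r>0. sq q r \<subseteq> \<Omega> \<and> L2null (sq q r) v m" if "q \<in> K" for q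
    using that K(2) by (auto simp: A_def)
  then obtain R where R: "\<And>q. q \<in> K \<Longrightarrow> R q > 0 \<and> sq q (R q) \<subseteq> \<Omega> \<and> L2null (sq q (R q)) v m" by metis
  obtain D where D: "D \<subseteq> K" "finite D" "K \<subseteq> (\<Union>q\<in>D. ball q (R q))"
  proof (rule compactE_image[OF K(1), of K "\<lambda>q. ball q (R q)"])
    show "K \<subseteq> (\<Union>q\<in>K. ball q (R q))"
    proof
      fix q assume "q \<in> K"
      then show "q \<in> (\<Union>q\<in>K. ball q (R q))" using R[of q] by (intro UN_I[of q]) auto
    qed
  qed (use that in auto)
  have "(\<lambda>n. \<Sum>q\<in>D. (LINT x:sq q (R q)|lborel. (v n x - m n)\<^sup>2)) \<longlonglongrightarrow> (\<Sum>q\<in>D. 0)"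
    using R D(1) unfolding L2null_def by (intro tendsto_sum) blast
  then have lim: "(\<lambda>n. \<Sum>q\<in>D. (LINT x:sq q (R q)|lborel. (v n x - m n)\<^sup>2)) \<longlonglongrightarrow> 0" by simp
  show ?thesis
  proof (rule L2null_dominated[OF _ lim])
    fix n
    let ?f = "\<lambda>x. (v n x - m n)\<^sup>2"
    have int: "integrable lborel (\<lambda>x. indicator B x *\<^sub>R ?f x)" if "compact B" "B \<subseteq> \<Omega>" for B
      using set_integrable_continuous[OF that(1) continuous_on_power[OF continuous_on_diff[OF c[OF that(2)] continuous_on_const]]]
      unfolding set_integrable_def .
    note iK = int[OF K]
    have iq: "integrable lborel (\<lambda>x. indicator (sq q (R q)) x *\<^sub>R ?f x)" if "q \<in> D" for q
      using R D(1) that by (intro int compact_sq) blast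
    have "(LINT x|lborel. indicator K x *\<^sub>R ?f x) \<le> (LINT x|lborel. (\<Sum>q\<in>D. indicator (sq q (R q)) x *\<^sub>R ?f x))"
    proof (rule integral_mono[OF iK])
      show "integrable lborel (\<lambda>x. \<Sum>q\<in>D. indicator (sq q (R q)) x *\<^sub>R ?f x)" using iq by (intro Bochner_Integration.integrable_sum)
      fix x
      show "indicator K x *\<^sub>R ?f x \<le> (\<Sum>q\<in>D. indicator (sq q (R q)) x *\<^sub>R ?f x)"
      proof (cases "x \<in> K")
        case True
        then obtain q where q: "q \<in> D" "x \<in> sq q (R q)" using D(3) ball_subset_sq by blast
        have "indicator (sq q (R q)) x *\<^sub>R ?f x \<le> (\<Sum>q\<in>D. indicator (sq q (R q)) x *\<^sub>R ?f x)"
          using q(1) D(2) by (intro member_le_sum) auto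
        then show ?thesis using q True by simp
      qed (auto intro!: sum_nonneg)
    qed
    also have "\<dots> = (\<Sum>q\<in>D. (LINT x|lborel. indicator (sq q (R q)) x *\<^sub>R ?f x))"
      using iq by (intro Bochner_Integration.integral_sum)
    finally show "(LINT x:K|lborel. ?f x) \<le> (\<Sum>q\<in>D. (LINT x:sq q (R q)|lborel. ?f x))"
      by (simp add: set_lebesgue_integral_def)
  qed
qed

text \<open>The measurability needed to deduce integrability from the pointwise bound comes from the
  weak gradient.\<close>

lemma energy_dominated:
  assumes \<Omega>: "open \<Omega>" and w: "weak_gradient \<Omega> w g" and f: "set_integrable lborel \<Omega> f"
    and le: "\<And>x. x \<in> \<Omega> \<Longrightarrow> (norm (g x))\<^sup>2 \<le> f x"
  shows "set_integrable lborel \<Omega> (\<lambda>x. (norm (g x))\<^sup>2)" "energy \<Omega> g \<le> (LINT x:\<Omega>|lborel. f x)"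
proof -
  have "(\<lambda>x. (norm (indicator \<Omega> x *\<^sub>R g x))\<^sup>2) \<in> borel_measurable lborel"
    using measurable_compose[OF weak_gradient_measurable[OF w \<Omega>] borel_measurable_norm] by simp
  moreover have "(\<lambda>x. (norm (indicator \<Omega> x *\<^sub>R g x))\<^sup>2) = (\<lambda>x. indicator \<Omega> x *\<^sub>R (norm (g x))\<^sup>2)"
    by (auto simp: indicator_def fun_eq_iff)
  ultimately have m: "(\<lambda>x. indicator \<Omega> x *\<^sub>R (norm (g x))\<^sup>2) \<in> borel_measurable lborel" by simp
  show i: "set_integrable lborel \<Omega> (\<lambda>x. (norm (g x))\<^sup>2)"
    unfolding set_integrable_def
  proof (rule Bochner_Integration.integrable_bound[OF f[unfolded set_integrable_def] m])
    show "AE x in lborel. norm (indicator \<Omega> x *\<^sub>R (norm (g x))\<^sup>2) \<le> norm (indicator \<Omega> x *\<^sub>R f x)"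
    proof (rule AE_I2)
      fix x show "norm (indicator \<Omega> x *\<^sub>R (norm (g x))\<^sup>2) \<le> norm (indicator \<Omega> x *\<^sub>R f x)"
        using le[of x] by (cases "x \<in> \<Omega>") auto
    qed
  qed
  show "energy \<Omega> g \<le> (LINT x:\<Omega>|lborel. f x)"
    unfolding energy_def by (rule set_integral_mono[OF i f le])
qed

lemma norm_add_square_le: "(norm (a + b))\<^sup>2 \<le> 2 * (norm a)\<^sup>2 + 2 * (norm b)\<^sup>2" for a b :: "'a::real_normed_vector"
proof -
  have "(norm (a + b))\<^sup>2 \<le> (norm a + norm b)\<^sup>2" by (intro power_mono norm_triangle_ineq) auto
  then show ?thesis using sum_squares_bound[of "norm a" "norm b"] by (simp add: power2_sum)
qed

lemma vanishing_add:
  assumes \<Omega>: "open \<Omega>" and v: "vanishing \<Omega> v g" and w: "vanishing \<Omega> w h"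
  shows "vanishing \<Omega> (\<lambda>n x. v n x + w n x) (\<lambda>n x. g n x + h n x)"
proof -
  have wg: "weak_gradient \<Omega> (\<lambda>x. v n x + w n x) (\<lambda>x. g n x + h n x)" for n
    using v w by (intro weak_gradient_add) (auto simp: vanishing_def)
  have gi: "set_integrable lborel \<Omega> (\<lambda>x. (norm (g n x))\<^sup>2)" "set_integrable lborel \<Omega> (\<lambda>x. (norm (h n x))\<^sup>2)" for n
    using v w by (auto simp: vanishing_def)
  have fi: "set_integrable lborel \<Omega> (\<lambda>x. 2 * (norm (g n x))\<^sup>2 + 2 * (norm (h n x))\<^sup>2)" for n
    by (intro set_integral_add set_integrable_mult_right gi)
  note ed = energy_dominated[OF \<Omega> wg fi norm_add_square_le]
  have "energy \<Omega> (\<lambda>x. g n x + h n x) \<le> 2 * energy \<Omega> (g n) + 2 * energy \<Omega> (h n)" for n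
    using ed(2)[of n] gi[of n] by (simp add: energy_def set_integral_add set_integrable_mult_right)
  moreover have "(\<lambda>n. 2 * energy \<Omega> (g n) + 2 * energy \<Omega> (h n)) \<longlonglongrightarrow> 2 * 0 + 2 * 0"
    using v w by (intro tendsto_intros) (auto simp: vanishing_def)
  ultimately have "(\<lambda>n. energy \<Omega> (\<lambda>x. g n x + h n x)) \<longlonglongrightarrow> 0"
    by (intro null_dominated[OF energy_nonneg]) simp_all
  then show ?thesis
    using v w wg ed(1) by (auto simp: vanishing_def intro!: continuous_intros)
qed

section \<open>The constants of the two potentials tend to 0\<close>

text \<open>\<open>F\<close> is itself a connected set that leaves a small square around
  \<open>p\<close>, so it contains points where \<open>v n\<close> is close to its constant; there
  \<open>v n\<close> is 0. Hence the constant tends to 0 near \<open>p\<close>, and then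
  everywhere.\<close>

lemma vanishing_on_continuum:
  assumes \<Omega>: "open \<Omega>" "connected \<Omega>" and v: "vanishing \<Omega> v g"
    and F: "connected F" "F \<subseteq> \<Omega>" "p \<in> F" "q \<in> F" "p \<noteq> q"
    and v0: "\<And>n x. x \<in> F \<Longrightarrow> v n x = 0"
    and K: "compact K" "K \<subseteq> \<Omega>"
  shows "L2null K v (\<lambda>_. 0)"
proof -
  \<comment> \<open>A square that avoids \<open>q\<close> cannot contain \<open>F\<close>; this is
    where the second point of \<open>F\<close> is used.\<close>
  have "open (\<Omega> - {q})" "p \<in> \<Omega> - {q}" using \<Omega> F by auto
  then obtain s where s: "s > 0" "sq p s \<subseteq> \<Omega> - {q}" by (rule open_contains_sq)
  define r where "r = s / 2"
  have r: "r > 0" "sq p (2 * r) \<subseteq> \<Omega>" "sq p r \<subseteq> \<Omega> - {q}"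
    using s sq_mono[of r s p] by (auto simp: r_def)
  obtain m where m: "L2null (sq p r) v m"
    "\<And>S. (\<And>n. connected (S n)) \<Longrightarrow> (\<And>n. p \<in> S n) \<Longrightarrow> (\<And>n. \<not> S n \<subseteq> sq p r) \<Longrightarrow>
      \<exists>z. (\<forall>n. z n \<in> S n \<inter> sq p r) \<and> (\<lambda>n. v n (z n) - m n) \<longlonglongrightarrow> 0"
    by (rule vanishing_local[OF \<Omega>(1) v r(1,2)]) presburger
  have "\<not> F \<subseteq> sq p r" using r(3) F by blast
  then obtain z where z: "\<And>n. z n \<in> F" "(\<lambda>n. v n (z n) - m n) \<longlonglongrightarrow> 0"
    using m(2)[of "\<lambda>_. F"] F by blast
  then have "(\<lambda>n. 0 - m n) \<longlonglongrightarrow> 0" using v0[OF z(1)] by simp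
  moreover have "continuous_on (sq p r) (v n)" for n
    using v r(3) continuous_on_subset[of \<Omega> "v n" "sq p r"] by (auto simp: vanishing_def)
  ultimately have "L2null (sq p r) v (\<lambda>_. 0)"
    using r(1) by (intro L2null_change_mean[OF m(1)]) auto
  moreover have "p \<in> \<Omega>" "sq p r \<subseteq> \<Omega>" using F r by auto
  ultimately show ?thesis using vanishing_global[OF \<Omega> v _ r(1) _ _ K] by blast
qed

text \<open>Here \<open>v\<close> is the potential called \<open>w\<close> in the overview. The
  comparison works because the competitor has energy governed by that of \<open>v n\<close> and by
  the mean square distance of \<open>v n\<close> to its constant on the compact set
  \<open>K'\<close> outside which the cutoff vanishes, and \<open>vanishing_global\<close> makes the
  latter small.\<close>

lemma vanishing_at_boundary:
  assumes \<Omega>: "open \<Omega>" "connected \<Omega>" and v: "vanishing \<Omega> v g"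
    and F: "compact F" "F \<subseteq> \<Omega>" "F \<noteq> {}" and cap: "conf_cap (frontier \<Omega>) F \<Omega> > 0"
    and vnn: "\<And>n x. x \<in> \<Omega> \<Longrightarrow> 0 \<le> v n x"
    and v0: "\<And>n. \<exists>U. open U \<and> frontier \<Omega> \<subseteq> U \<and> (\<forall>x\<in>U \<inter> \<Omega>. v n x = 0)"
    and K: "compact K" "K \<subseteq> \<Omega>"
  shows "L2null K v (\<lambda>_. 0)"
proof -
  obtain p where p: "p \<in> \<Omega>" using F by blast
  obtain s where s: "s > 0" "sq p s \<subseteq> \<Omega>" using open_contains_sq[OF \<Omega>(1) p] by blast
  define r where "r = s / 2"
  have r: "r > 0" "sq p (2 * r) \<subseteq> \<Omega>" "sq p r \<subseteq> \<Omega>"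
    using s sq_mono[of r s p] by (auto simp: r_def)
  obtain m where m: "\<And>n. m n \<in> v n ` \<Omega>" "L2null (sq p r) v m"
    by (rule vanishing_local[OF \<Omega>(1) v r(1,2)]) presburger
  have mnn: "0 \<le> m n" for n using m(1)[of n] vnn by auto
  have null: "L2null A v m" if "compact A" "A \<subseteq> \<Omega>" for A
    by (rule vanishing_global[OF \<Omega> v p r(1,3) m(2) that])
  have vc: "continuous_on A (v n)" if "A \<subseteq> \<Omega>" for A n
    using v that continuous_on_subset unfolding vanishing_def by blast
  obtain \<eta> U K' where \<eta>: "smooth_fun \<eta>" "\<And>x. 0 \<le> \<eta> x" "\<And>x. \<eta> x \<le> 1" "open U" "F \<subseteq> U"
    "\<And>x. x \<in> U \<Longrightarrow> \<eta> x = 1" "compact K'" "K' \<subseteq> \<Omega>" "\<And>x. x \<notin> K' \<Longrightarrow> \<eta> x = 0"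
    by (rule smooth_cutoff_exists[OF F(1) \<Omega>(1) F(2)]) presburger
  have gz: "grad \<eta> x = 0" if "x \<notin> K'" for x
    by (rule grad_eq_0_outside[OF compact_imp_closed[OF \<eta>(7)] \<eta>(9) that])
  have "bounded (grad \<eta> ` K')"
    by (intro compact_imp_bounded compact_continuous_image grad_continuous \<eta>)
  then obtain C0 where C0: "\<And>x. x \<in> K' \<Longrightarrow> norm (grad \<eta> x) \<le> C0" unfolding bounded_iff by blast
  define C where "C = \<bar>C0\<bar>"
  have C: "norm (grad \<eta> x) \<le> C * indicator K' x" for x
    using C0[of x] gz[of x] by (cases "x \<in> K'") (auto simp: C_def)
  define c0 where "c0 = conf_cap (frontier \<Omega>) F \<Omega>"
  \<comment> \<open>The inequality is multiplied by \<open>(m n)\<^sup>2\<close> so that it remains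
    meaningful, and is trivially true, when the constant is 0.\<close>
  have key: "c0 * (m n)\<^sup>2 \<le> 2 * energy \<Omega> (g n) + 2 * C\<^sup>2 * (LINT x:K'|lborel. (v n x - m n)\<^sup>2)" for n
  proof (cases "m n = 0")
    case True
    then show ?thesis using energy_nonneg[of \<Omega> "g n"] set_lint_nonneg[of "\<lambda>x. (v n x - m n)\<^sup>2" K'] by simp
  next
    case False
    then have mp: "m n > 0" using mnn[of n] by simp
    define \<mu> where "\<mu> = m n"
    have \<mu>: "\<mu> > 0" using mp by (simp add: \<mu>_def)
    define c where "c x = (1 / \<mu>) * (1 - \<eta> x)" for x
    have sc: "smooth_fun c" unfolding c_def[abs_def]
      by (intro smooth_fun_mult smooth_fun_diff smooth_fun_const \<eta>)
    have gc: "grad c x = - (1 / \<mu>) *\<^sub>R grad \<eta> x" for x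
    proof -
      have "grad (\<lambda>x. (1 / \<mu>) + (- (1 / \<mu>)) * \<eta> x) x = - (1 / \<mu>) *\<^sub>R grad \<eta> x"
        by (subst grad_add) (auto intro!: smooth_fun_mult smooth_fun_const \<eta>(1) simp only: grad_const grad_cmult[OF \<eta>(1)] add_0)
      moreover have "c = (\<lambda>x. (1 / \<mu>) + (- (1 / \<mu>)) * \<eta> x)" by (auto simp: c_def fun_eq_iff algebra_simps)
      ultimately show ?thesis by simp
    qed
    define w where "w x = \<eta> x + c x * v n x" for x
    define h where "h x = grad \<eta> x + (c x *\<^sub>R g n x + v n x *\<^sub>R grad c x)" for x
    have wg: "weak_gradient \<Omega> w h"
      unfolding w_def[abs_def] h_def[abs_def]
      by (intro weak_gradient_add weak_gradient_smooth weak_gradient_mult_smooth \<eta> sc) (use v in \<open>auto simp: vanishing_def\<close>)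
    \<comment> \<open>Collecting terms shows that \<open>grad \<eta>\<close> occurs only with the
      factor \<open>\<mu> - v n x\<close>, the quantity that is small in mean square.\<close>
    have heq: "h x = (1 / \<mu>) *\<^sub>R ((1 - \<eta> x) *\<^sub>R g n x + (\<mu> - v n x) *\<^sub>R grad \<eta> x)" for x
      unfolding h_def gc c_def using \<mu> by (simp add: vec_eq_iff field_simps)
    define f where "f x = (1 / \<mu>)\<^sup>2 * (2 * (norm (g n x))\<^sup>2 + 2 * C\<^sup>2 * (indicator K' x * (v n x - \<mu>)\<^sup>2))" for x
    have hf: "(norm (h x))\<^sup>2 \<le> f x" for x
    proof -
      have "(norm ((1 - \<eta> x) *\<^sub>R g n x))\<^sup>2 \<le> (norm (g n x))\<^sup>2"
        using \<eta>(2,3)[of x] by (intro power_mono) (auto intro: mult_left_le_one_le)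
      moreover have "(norm ((\<mu> - v n x) *\<^sub>R grad \<eta> x))\<^sup>2 \<le> C\<^sup>2 * (indicator K' x * (v n x - \<mu>)\<^sup>2)"
      proof -
        have "(norm ((\<mu> - v n x) *\<^sub>R grad \<eta> x))\<^sup>2 = (v n x - \<mu>)\<^sup>2 * (norm (grad \<eta> x))\<^sup>2"
          by (simp add: power_mult_distrib power2_commute)
        also have "\<dots> \<le> (v n x - \<mu>)\<^sup>2 * (C * indicator K' x)\<^sup>2"
          by (intro mult_left_mono power_mono C) auto
        also have "\<dots> = C\<^sup>2 * (indicator K' x * (v n x - \<mu>)\<^sup>2)"
          by (cases "x \<in> K'") (auto simp: power_mult_distrib)
        finally show ?thesis .
      qed
      ultimately have "(norm ((1 - \<eta> x) *\<^sub>R g n x + (\<mu> - v n x) *\<^sub>R grad \<eta> x))\<^sup>2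
          \<le> 2 * (norm (g n x))\<^sup>2 + 2 * C\<^sup>2 * (indicator K' x * (v n x - \<mu>)\<^sup>2)"
        using norm_add_square_le[of "(1 - \<eta> x) *\<^sub>R g n x" "(\<mu> - v n x) *\<^sub>R grad \<eta> x"] by linarith
      then have "(1 / \<mu>)\<^sup>2 * (norm ((1 - \<eta> x) *\<^sub>R g n x + (\<mu> - v n x) *\<^sub>R grad \<eta> x))\<^sup>2 \<le> f x"
        unfolding f_def by (rule mult_left_mono) simp
      then show ?thesis unfolding heq by (simp add: power_mult_distrib power_divide)
    qed
    have ig: "set_integrable lborel \<Omega> (\<lambda>x. (norm (g n x))\<^sup>2)" using v by (simp add: vanishing_def)
    have iv: "set_integrable lborel K' (\<lambda>x. (v n x - \<mu>)\<^sup>2)"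
      by (intro set_integrable_continuous \<eta> continuous_intros vc)
    have eqO: "indicator \<Omega> x *\<^sub>R (indicator K' x * (v n x - \<mu>)\<^sup>2) = indicator K' x *\<^sub>R (v n x - \<mu>)\<^sup>2" for x
      using \<eta>(8) by (auto simp: indicator_def)
    have iv': "set_integrable lborel \<Omega> (\<lambda>x. indicator K' x * (v n x - \<mu>)\<^sup>2)"
      using iv unfolding set_integrable_def eqO .
    have ev': "(LINT x:\<Omega>|lborel. indicator K' x * (v n x - \<mu>)\<^sup>2) = (LINT x:K'|lborel. (v n x - \<mu>)\<^sup>2)"
      unfolding set_lebesgue_integral_def eqO ..
    have if': "set_integrable lborel \<Omega> f"
      unfolding f_def[abs_def] by (intro set_integrable_mult_right set_integral_add ig iv')
    have "admissible (frontier \<Omega>) F \<Omega> w h"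
      unfolding admissible_def
    proof (intro conjI)
      show "continuous_on \<Omega> w" unfolding w_def
        by (intro continuous_on_add continuous_on_mult smooth_fun_continuous \<eta>(1) sc vc) simp
      show "\<forall>x\<in>\<Omega>. 0 \<le> w x"
        unfolding w_def c_def using \<eta>(2,3) vnn \<mu> by (auto intro!: add_nonneg_nonneg mult_nonneg_nonneg)
      show "weak_gradient \<Omega> w h" by (rule wg)
      show "set_integrable lborel \<Omega> (\<lambda>x. (norm (h x))\<^sup>2)"
        by (rule energy_dominated(1)[OF \<Omega>(1) wg if' hf])
      obtain U0 where U0: "open U0" "frontier \<Omega> \<subseteq> U0" "\<forall>x\<in>U0 \<inter> \<Omega>. v n x = 0" using v0 by blast
      \<comment> \<open>Off \<open>K'\<close> the cutoff is 0 and the competitor is a multiple of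
        \<open>v n\<close>, so it vanishes on \<open>U0 - K'\<close>, which still contains the
        frontier.\<close>
      have "frontier \<Omega> \<inter> K' = {}" using \<eta>(8) \<Omega>(1) frontier_disjoint_eq by blast
      then show "\<exists>U. open U \<and> frontier \<Omega> \<subseteq> U \<and> (\<forall>x\<in>U \<inter> \<Omega>. w x = 0)"
        using U0 \<eta>(9) compact_imp_closed[OF \<eta>(7)] by (intro exI[of _ "U0 - K'"]) (auto simp: w_def)
      show "\<exists>U. open U \<and> F \<subseteq> U \<and> (\<forall>x\<in>U \<inter> \<Omega>. 1 \<le> w x)"
        using \<eta>(4-6) by (intro exI[of _ U]) (auto simp: w_def c_def)
    qed
    from conf_cap_le[OF this] have "c0 \<le> (LINT x:\<Omega>|lborel. f x)"
      using energy_dominated(2)[OF \<Omega>(1) wg if' hf] by (simp add: c0_def)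
    also have "\<dots> = (1 / \<mu>)\<^sup>2 * (2 * energy \<Omega> (g n) + 2 * C\<^sup>2 * (LINT x:K'|lborel. (v n x - \<mu>)\<^sup>2))"
      unfolding f_def energy_def ev'[symmetric]
      using ig iv' by (simp add: set_integral_add set_integrable_mult_right)
    finally show ?thesis using \<mu> unfolding \<mu>_def[symmetric] by (simp add: field_simps power_divide)
  qed
  have "(\<lambda>n. 2 * energy \<Omega> (g n) + 2 * C\<^sup>2 * (LINT x:K'|lborel. (v n x - m n)\<^sup>2)) \<longlonglongrightarrow> 2 * 0 + 2 * C\<^sup>2 * 0"
    using v null[OF \<eta>(7,8)] by (intro tendsto_intros) (auto simp: vanishing_def L2null_def)
  then have "(\<lambda>n. c0 * (m n)\<^sup>2) \<longlonglongrightarrow> 0"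
    using cap by (intro null_dominated[OF _ key]) (auto simp: c0_def)
  then have "(\<lambda>n. (1 / c0) * (c0 * (m n)\<^sup>2)) \<longlonglongrightarrow> (1 / c0) * 0" by (intro tendsto_intros)
  then have "(\<lambda>n. (m n)\<^sup>2) \<longlonglongrightarrow> 0" using cap by (simp add: c0_def)
  then have "(\<lambda>n. sqrt ((m n)\<^sup>2)) \<longlonglongrightarrow> sqrt 0" by (rule tendsto_real_sqrt)
  then have "m \<longlonglongrightarrow> 0" using mnn by simp
  then have "(\<lambda>n. 0 - m n) \<longlonglongrightarrow> 0 - 0" by (intro tendsto_intros)
  then have "L2null (sq p r) v (\<lambda>_. 0)"
    using r(1) by (intro L2null_change_mean[OF m(2)] vc[OF r(3)]) auto
  then show ?thesis by (rule vanishing_global[OF \<Omega> v p r(1,3) _ K])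
qed

text \<open>The selection of good points has to be applied to the sum: chosen separately for
  \<open>v n\<close> and \<open>w n\<close>, the points of the curve could differ, and the curve may
  cross the frontier of \<open>V\<close> many times. The local constant of the sum is a new one; it
  is identified with 0 by comparing mean square limits on \<open>sq x r\<close>.\<close>

lemma capacity_of_path_bounded_below:
  assumes \<Omega>: "open \<Omega>" "connected \<Omega>"
    and F: "compact F" "connected F" "F \<subseteq> \<Omega>" "p \<in> F" "q \<in> F" "p \<noteq> q"
    and cap: "conf_cap (frontier \<Omega>) F \<Omega> > 0"
    and a: "\<And>n. admissible F (\<gamma> n - V) \<Omega> (v n) (g n)" "\<And>n. admissible (frontier \<Omega>) (\<gamma> n \<inter> V) \<Omega> (w n) (h n)"
    and e: "(\<lambda>n. energy \<Omega> (g n)) \<longlonglongrightarrow> 0" "(\<lambda>n. energy \<Omega> (h n)) \<longlonglongrightarrow> 0"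
    and x: "r > 0" "sq x (2 * r) \<subseteq> \<Omega>"
    and \<gamma>: "\<And>n. connected (\<gamma> n)" "\<And>n. x \<in> \<gamma> n"
  obtains n where "\<gamma> n \<subseteq> sq x r"
proof (rule ccontr)
  assume "\<not> thesis"
  then have out: "\<not> \<gamma> n \<subseteq> sq x r" for n using that by blast
  have v: "vanishing \<Omega> v g" and w: "vanishing \<Omega> w h"
    using a e by (auto simp: vanishing_def admissible_def)
  have nn: "0 \<le> v n y" "0 \<le> w n y" if "y \<in> \<Omega>" for n y
    using a that by (auto simp: admissible_def)
  have rO: "sq x r \<subseteq> \<Omega>" using x sq_mono[of r "2 * r" x] by auto
  have c: "continuous_on (sq x r) (v n)" "continuous_on (sq x r) (w n)" for n
    using v w rO continuous_on_subset unfolding vanishing_def by blast+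
  have "L2null (sq x r) v (\<lambda>_. 0)"
  proof (rule vanishing_on_continuum[OF \<Omega> v F(2-6) _ compact_sq rO])
    show "v n y = 0" if "y \<in> F" for n y
      using a(1)[of n] that F(3) unfolding admissible_def by blast
  qed
  moreover have "L2null (sq x r) w (\<lambda>_. 0)"
  proof (rule vanishing_at_boundary[OF \<Omega> w F(1,3) _ cap _ _ compact_sq rO])
    show "F \<noteq> {}" using F by blast
    show "0 \<le> w n y" if "y \<in> \<Omega>" for n y using nn that by blast
    show "\<exists>U. open U \<and> frontier \<Omega> \<subseteq> U \<and> (\<forall>x\<in>U \<inter> \<Omega>. w n x = 0)" for n
      using a(2)[of n] unfolding admissible_def by blast
  qed
  ultimately have lim: "(\<lambda>n. 2 * (LINT y:sq x r|lborel. (v n y - 0)\<^sup>2) + 2 * (LINT y:sq x r|lborel. (w n y - 0)\<^sup>2)) \<longlonglongrightarrow> 2 * 0 + 2 * 0"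
    unfolding L2null_def by (intro tendsto_intros)
  define u where "u n y = v n y + w n y" for n y
  have uv: "vanishing \<Omega> u (\<lambda>n y. g n y + h n y)" unfolding u_def by (rule vanishing_add[OF \<Omega>(1) v w])
  have u0: "L2null (sq x r) u (\<lambda>_. 0)"
  proof (rule L2null_dominated)
    show "(LINT y:sq x r|lborel. (u n y - 0)\<^sup>2) \<le> 2 * (LINT y:sq x r|lborel. (v n y - 0)\<^sup>2) + 2 * (LINT y:sq x r|lborel. (w n y - 0)\<^sup>2)" for n
      using set_lint_square_add_le[OF compact_sq c(1)[of n] c(2)[of n], of "u n"] by (simp add: u_def)
    show "(\<lambda>n. 2 * (LINT y:sq x r|lborel. (v n y - 0)\<^sup>2) + 2 * (LINT y:sq x r|lborel. (w n y - 0)\<^sup>2)) \<longlonglongrightarrow> 0"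
      using lim by simp
  qed
  obtain m where m: "L2null (sq x r) u m"
    "\<And>S. (\<And>n. connected (S n)) \<Longrightarrow> (\<And>n. x \<in> S n) \<Longrightarrow> (\<And>n. \<not> S n \<subseteq> sq x r) \<Longrightarrow>
      \<exists>z. (\<forall>n. z n \<in> S n \<inter> sq x r) \<and> (\<lambda>n. u n (z n) - m n) \<longlonglongrightarrow> 0"
    by (rule vanishing_local[OF \<Omega>(1) uv x]) presburger
  have "continuous_on (sq x r) (u n)" for n unfolding u_def by (intro continuous_intros c)
  from L2null_means_close[OF m(1) u0 x(1) this] have "m \<longlonglongrightarrow> 0" by simp
  moreover obtain z where z: "\<And>n. z n \<in> \<gamma> n \<inter> sq x r" "(\<lambda>n. u n (z n) - m n) \<longlonglongrightarrow> 0"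
    using m(2)[of \<gamma>, OF \<gamma> out] by blast
  ultimately have "(\<lambda>n. (u n (z n) - m n) + m n) \<longlonglongrightarrow> 0 + 0" by (intro tendsto_add)
  then have l0: "(\<lambda>n. u n (z n)) \<longlonglongrightarrow> 0" by simp
  have "1 \<le> u n (z n)" for n
  proof -
    have zO: "z n \<in> \<Omega>" using z(1) rO by blast
    show ?thesis
    proof (cases "z n \<in> V")
      case True
      then have "1 \<le> w n (z n)" using a(2)[of n] z(1)[of n] zO unfolding admissible_def by blast
      then show ?thesis using nn(1)[OF zO, of n] by (simp add: u_def)
    next
      case False
      then have "1 \<le> v n (z n)" using a(1)[of n] z(1)[of n] zO unfolding admissible_def by blast
      then show ?thesis using nn(2)[OF zO, of n] by (simp add: u_def)
    qed
  qed
  then have "1 \<le> (0::real)" using LIMSEQ_le_const[OF l0] by blast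
  then show False by simp
qed

section \<open>Rectifiable paths and the capacitary metric\<close>

lemma rectifiable_path_Lipschitz:
  assumes L: "\<And>s t. s \<in> {0..1} \<Longrightarrow> t \<in> {0..1} \<Longrightarrow> dist (\<gamma> s) (\<gamma> t) \<le> C * dist s t" and "path \<gamma>"
  shows "rectifiable_path \<gamma>"
proof -
  have C: "0 \<le> C" using order_trans[OF zero_le_dist L[of 0 1]] by (simp add: dist_real_def)
  \<comment> \<open>For nonempty lists the increments of the parameter telescope to at most 1. The
    empty list is treated apart, since \<open>ts ! 0\<close> is meaningless there.\<close>
  have "(\<Sum>i<length ts - 1. dist (\<gamma> (ts ! i)) (\<gamma> (ts ! Suc i))) \<le> C" if ts: "sorted ts" "set ts \<subseteq> {0..1}" for ts :: "real list"
  proof (cases "length ts = 0")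
    case False
    have "(\<Sum>i<length ts - 1. dist (\<gamma> (ts ! i)) (\<gamma> (ts ! Suc i))) \<le> (\<Sum>i<length ts - 1. C * (ts ! Suc i - ts ! i))"
    proof (rule sum_mono)
      fix i assume "i \<in> {..<length ts - 1}"
      then have i: "i < length ts" "Suc i < length ts" by auto
      have "ts ! i \<le> ts ! Suc i" using sorted_nth_mono[OF ts(1), of i "Suc i"] i by simp
      moreover have "ts ! i \<in> {0..1}" "ts ! Suc i \<in> {0..1}" using ts(2) i nth_mem by blast+
      ultimately show "dist (\<gamma> (ts ! i)) (\<gamma> (ts ! Suc i)) \<le> C * (ts ! Suc i - ts ! i)"
        using L[of "ts ! i" "ts ! Suc i"] by (simp add: dist_real_def)
    qed
    also have "\<dots> = C * (ts ! (length ts - 1) - ts ! 0)"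
      unfolding sum_distrib_left[symmetric] using sum_lessThan_telescope[of "\<lambda>i. ts ! i" "length ts - 1"] by simp
    also have "\<dots> \<le> C * 1"
    proof (rule mult_left_mono[OF _ C])
      have "ts ! (length ts - 1) \<in> {0..1}" "ts ! 0 \<in> {0..1}" using ts(2) False nth_mem[of _ ts] by (meson subsetD diff_less length_greater_0_conv zero_less_one length_0_conv gr0I)+
      then show "ts ! (length ts - 1) - ts ! 0 \<le> 1" by auto
    qed
    finally show ?thesis by simp
  qed (use C in simp)
  then show ?thesis unfolding rectifiable_path_def using assms(2) by blast
qed

lemma rectifiable_linepath: "rectifiable_path (linepath x y)"
proof (rule rectifiable_path_Lipschitz)
  fix s t :: real
  have "linepath x y s - linepath x y t = (s - t) *\<^sub>R (y - x)" by (simp add: linepath_def algebra_simps)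
  then show "dist (linepath x y s) (linepath x y t) \<le> norm (y - x) * dist s t"
    by (simp add: dist_norm mult.commute)
qed simp

text \<open>Polynomial paths join the points of an open connected set, and their derivative is
  bounded on the unit interval, so they are Lipschitz. This keeps the infimum in the metric from
  ranging over the empty set.\<close>

lemma rectifiable_path_exists:
  fixes \<Omega> :: "R2 set"
  assumes "open \<Omega>" "connected \<Omega>" "x \<in> \<Omega>" "y \<in> \<Omega>"
  obtains \<gamma> where "rectifiable_path \<gamma>" "path_image \<gamma> \<subseteq> \<Omega>" "pathstart \<gamma> = x" "pathfinish \<gamma> = y"
proof -
  obtain \<gamma> where \<gamma>: "polynomial_function \<gamma>" "path_image \<gamma> \<subseteq> \<Omega>" "pathstart \<gamma> = x" "pathfinish \<gamma> = y"
    using connected_open_polynomial_connected[OF assms] by blast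
  obtain \<gamma>' where \<gamma>': "polynomial_function \<gamma>'" "\<And>t. (\<gamma> has_vector_derivative \<gamma>' t) (at t)"
    using has_vector_derivative_polynomial_function[OF \<gamma>(1)] by blast
  have "bounded (\<gamma>' ` {0..1})"
    by (intro compact_imp_bounded compact_continuous_image continuous_on_polymonial_function \<gamma>') simp
  then obtain B where B: "\<And>t. t \<in> {0..1} \<Longrightarrow> norm (\<gamma>' t) \<le> B" unfolding bounded_iff by blast
  have "rectifiable_path \<gamma>"
  proof (rule rectifiable_path_Lipschitz)
    show "path \<gamma>" unfolding path_def by (rule continuous_on_polymonial_function[OF \<gamma>(1)])
    fix s t :: real assume st: "s \<in> {0..1}" "t \<in> {0..1}"
    have "norm (\<gamma> s - \<gamma> t) \<le> B * norm (s - t)"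
    proof (rule differentiable_bound[of "{0..1}" \<gamma> "\<lambda>t h. h *\<^sub>R \<gamma>' t"])
      show "(\<gamma> has_derivative (\<lambda>h. h *\<^sub>R \<gamma>' t)) (at t within {0..1})" for t
        using \<gamma>'(2)[of t] unfolding has_vector_derivative_def by (rule has_derivative_at_withinI)
      show "onorm (\<lambda>h. h *\<^sub>R \<gamma>' t) \<le> B" if "t \<in> {0..1}" for t
        using B[OF that] by (intro onorm_le) (simp add: mult.commute[of B] mult_left_mono)
    qed (use st in auto)
    then show "dist (\<gamma> s) (\<gamma> t) \<le> B * dist s t" by (simp add: dist_norm)
  qed
  then show ?thesis using that \<gamma> by blast
qed

theorem theorem2p7:
  fixes \<Omega> F V :: "R2 set"
  assumes "open \<Omega>" and "connected \<Omega>"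
    and "compact F" and "connected F" and "F \<noteq> {}" and "F \<subseteq> \<Omega>"
    and "conf_cap (frontier \<Omega>) F \<Omega> > 0"
    and "open V" and "connected V" and "F \<subseteq> V" and "closure V \<subseteq> \<Omega>"
    and "compact (closure V)"
    and "\<exists>h. quasiconformal_homeo h \<and> frontier V = h ` sphere 0 1"
  shows "\<forall>U \<subseteq> \<Omega>. openin (top_of_set \<Omega>) U \<longleftrightarrow>
           (\<forall>x\<in>U. \<exists>r>0. \<forall>y\<in>\<Omega>. cap_metric \<Omega> F V x y < r \<longrightarrow> y \<in> U)"
proof -
  note \<Omega> = assms(1,2)
  define cost where "cost \<gamma> = sqrt (conf_cap F (path_image \<gamma> - V) \<Omega>)
        + sqrt (conf_cap (frontier \<Omega>) (path_image \<gamma> \<inter> V) \<Omega>)" for \<gamma>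
  define paths where "paths x y = {\<gamma>. rectifiable_path \<gamma> \<and> path_image \<gamma> \<subseteq> \<Omega> \<and> pathstart \<gamma> = x \<and> pathfinish \<gamma> = y}" for x y
  have metric: "cap_metric \<Omega> F V x y = Inf (cost ` paths x y)" for x y
    unfolding cap_metric_def cost_def paths_def by (rule arg_cong[of _ _ Inf]) blast
  have fr: "frontier \<Omega> \<inter> \<Omega> = {}" using \<Omega>(1) frontier_disjoint_eq by blast
  \<comment> \<open>The part of the curve outside the open set \<open>V\<close> is compact and
    misses \<open>F\<close>, because \<open>F\<close> lies in \<open>V\<close>.\<close>
  have adm1: "\<exists>v g. admissible F (path_image \<gamma> - V) \<Omega> v g" if "\<gamma> \<in> paths x y" for \<gamma> x y
  proof -
    have "compact (path_image \<gamma>)"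
      using that unfolding paths_def rectifiable_path_def by (auto intro: compact_path_image)
    then have "compact (path_image \<gamma> - V)" using assms(8) by (rule compact_diff)
    then show ?thesis
      using admissible_exists[OF \<Omega>(1) compact_imp_closed[OF assms(3)], of "path_image \<gamma> - V" "path_image \<gamma> - V"] assms(10) by blast
  qed
  \<comment> \<open>The part of the curve inside \<open>V\<close> need not be compact;
    \<open>closure V\<close> serves as its compact hull and misses the frontier of \<Omega>.\<close>
  have adm2: "\<exists>v g. admissible (frontier \<Omega>) (path_image \<gamma> \<inter> V) \<Omega> v g" for \<gamma> :: "real \<Rightarrow> R2"
  proof -
    have "path_image \<gamma> \<inter> V \<subseteq> closure V" using closure_subset by blast
    moreover have "frontier \<Omega> \<inter> closure V = {}" using fr assms(11) by blast
    ultimately show ?thesis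
      using admissible_exists[OF \<Omega>(1) frontier_closed assms(12)] by blast
  qed
  have nn1: "0 \<le> conf_cap F (path_image \<gamma> - V) \<Omega>" if "\<gamma> \<in> paths x y" for \<gamma> x y
    using adm1[OF that] conf_cap_nonneg by blast
  have nn2: "0 \<le> conf_cap (frontier \<Omega>) (path_image \<gamma> \<inter> V) \<Omega>" for \<gamma> :: "real \<Rightarrow> R2"
    using adm2 conf_cap_nonneg by blast
  have upper: "cap_metric \<Omega> F V x y \<le> cost \<gamma>" if "\<gamma> \<in> paths x y" for \<gamma> x y
    unfolding metric
  proof (rule cInf_lower)
    show "bdd_below (cost ` paths x y)"
      using nn1 nn2 by (intro bdd_belowI[of _ 0]) (auto simp: cost_def)
  qed (use that in blast)
  have small: "\<exists>d>0. \<forall>y\<in>ball x d. cap_metric \<Omega> F V x y < r" if x: "x \<in> \<Omega>" and r: "r > 0" for x r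
  proof -
    have r2: "(r / 2)\<^sup>2 > 0" using r by simp
    obtain d0 where d0: "d0 > 0" "ball x d0 \<subseteq> \<Omega>" using \<Omega>(1) x openE by blast
    \<comment> \<open>If \<open>x\<close> lies in \<open>V\<close>, short segments stay in
      \<open>V\<close> and the capacity is that of the empty set. This case is separate because
      \<open>x\<close> may belong to \<open>F\<close>; otherwise \<open>x\<close> is off
      \<open>F\<close> and points have capacity 0.\<close>
    have "\<exists>d>0. \<forall>S\<subseteq>ball x d. conf_cap F (S - V) \<Omega> < (r / 2)\<^sup>2"
    proof (cases "x \<in> V")
      case True
      then obtain d where d: "d > 0" "ball x d \<subseteq> V" using assms(8) openE by blast
      have "conf_cap F (S - V) \<Omega> < (r / 2)\<^sup>2" if "S \<subseteq> ball x d" for S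
      proof -
        have "S - V = {}" using that d by blast
        then show ?thesis using conf_cap_empty[OF \<Omega>(1), of F] r2 by (simp only:)
      qed
      then show ?thesis using d(1) by blast
    next
      case False
      then have "x \<notin> F" using assms(10) by blast
      then obtain d where d: "d > 0" "\<And>S. S \<subseteq> ball x d \<Longrightarrow> conf_cap F S \<Omega> < (r / 2)\<^sup>2"
        using conf_cap_small[OF \<Omega>(1) compact_imp_closed[OF assms(3)] _ r2] by metis
      have "conf_cap F (S - V) \<Omega> < (r / 2)\<^sup>2" if "S \<subseteq> ball x d" for S
        using that by (intro d(2)) blast
      then show ?thesis using d(1) by blast
    qed
    then obtain d1 where d1: "d1 > 0" "\<And>S. S \<subseteq> ball x d1 \<Longrightarrow> conf_cap F (S - V) \<Omega> < (r / 2)\<^sup>2" by blast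
    have "x \<notin> frontier \<Omega>" using fr x by blast
    then obtain d2 where d2: "d2 > 0" "\<And>S. S \<subseteq> ball x d2 \<Longrightarrow> conf_cap (frontier \<Omega>) S \<Omega> < (r / 2)\<^sup>2"
      using conf_cap_small[OF \<Omega>(1) frontier_closed _ r2] by metis
    define d where "d = min d0 (min d1 d2)"
    have "cap_metric \<Omega> F V x y < r" if y: "y \<in> ball x d" for y
    proof -
      have seg: "path_image (linepath x y) \<subseteq> ball x d"
        using y d0 d1 d2 by (simp add: path_image_linepath closed_segment_subset d_def)
      then have sub: "path_image (linepath x y) \<subseteq> ball x d0" "path_image (linepath x y) \<subseteq> ball x d1"
        "path_image (linepath x y) \<inter> V \<subseteq> ball x d2"
        unfolding d_def by auto
      have "sqrt (conf_cap F (path_image (linepath x y) - V) \<Omega>) < r / 2"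
        using d1(2)[OF sub(2)] r by (intro real_less_lsqrt) auto
      moreover have "sqrt (conf_cap (frontier \<Omega>) (path_image (linepath x y) \<inter> V) \<Omega>) < r / 2"
        using d2(2)[OF sub(3)] r by (intro real_less_lsqrt) auto
      ultimately have "cost (linepath x y) < r" by (simp add: cost_def)
      moreover have "linepath x y \<in> paths x y"
        using sub(1) d0(2) rectifiable_linepath by (simp add: paths_def)
      ultimately show ?thesis using upper le_less_trans by blast
    qed
    then show ?thesis using d0(1) d1(1) d2(1) by (intro exI[of _ d]) (auto simp: d_def)
  qed
  obtain p where p: "p \<in> F" using assms(5) by blast
  \<comment> \<open>Sets in small balls around a point have capacity below any positive number; a
    one-point \<open>F\<close> would have capacity smaller than itself.\<close>
  have "\<exists>q\<in>F. q \<noteq> p"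
  proof (rule ccontr)
    assume "\<not> ?thesis"
    then have Fp: "F = {p}" using p by blast
    have "p \<notin> frontier \<Omega>" using fr p assms(6) by blast
    then obtain d where d: "d > 0" "\<And>S. S \<subseteq> ball p d \<Longrightarrow> conf_cap (frontier \<Omega>) S \<Omega> < conf_cap (frontier \<Omega>) F \<Omega>"
      using conf_cap_small[OF \<Omega>(1) frontier_closed _ assms(7)] by metis
    have "F \<subseteq> ball p d" using Fp d(1) by simp
    from d(2)[OF this] show False by simp
  qed
  then obtain q where q: "q \<in> F" "p \<noteq> q" by blast
  \<comment> \<open>If no radius works, there are points \<open>y n\<close> outside \<open>U\<close>
    with metric distance to \<open>x\<close> tending to 0. Almost optimal curves to them, and almost
    optimal functions for both capacities of each curve, form the sequences for
    \<open>capacity_of_path_bounded_below\<close>.\<close>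
  have away: "\<exists>r>0. \<forall>y\<in>\<Omega>. cap_metric \<Omega> F V x y < r \<longrightarrow> y \<in> U" if U: "open U" "U \<subseteq> \<Omega>" and x: "x \<in> U" for U x
  proof (rule ccontr)
    assume no: "\<not> ?thesis"
    have "\<exists>y. y \<in> \<Omega> \<and> cap_metric \<Omega> F V x y < 1 / real (Suc n) \<and> y \<notin> U" for n
    proof -
      have "1 / real (Suc n) > 0" by simp
      then show ?thesis using no by blast
    qed
    then obtain y where y: "\<And>n. y n \<in> \<Omega>" "\<And>n. cap_metric \<Omega> F V x (y n) < 1 / real (Suc n)" "\<And>n. y n \<notin> U" by metis
    obtain s where s: "s > 0" "sq x s \<subseteq> U" using open_contains_sq[OF U(1) x] by blast
    \<comment> \<open>The square \<open>sq x r\<close> lies in \<open>U\<close>, so it cannot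
      contain a curve ending at \<open>y n\<close>; its double lies in \<Omega>, as the local
      estimate requires.\<close>
    define r where "r = s / 2"
    have r: "r > 0" "sq x (2 * r) \<subseteq> \<Omega>" "sq x r \<subseteq> U"
      using s U(2) sq_mono[of r s x] by (auto simp: r_def)
    have "\<exists>\<gamma>. \<gamma> \<in> paths x (y n) \<and> cost \<gamma> < 1 / real (Suc n)" for n
    proof -
      obtain \<gamma> where "\<gamma> \<in> paths x (y n)"
        using rectifiable_path_exists[OF \<Omega> _ y(1)[of n], of x] x U(2) unfolding paths_def by blast
      then have "cost ` paths x (y n) \<noteq> {}" by blast
      from cInf_lessD[OF this y(2)[of n, unfolded metric]] show ?thesis by blast
    qed
    then obtain \<gamma> where \<gamma>: "\<And>n. \<gamma> n \<in> paths x (y n)" "\<And>n. cost (\<gamma> n) < 1 / real (Suc n)" by metis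
    \<comment> \<open>Both roots in the cost are nonnegative, so each of them alone is below the
      bound for the sum.\<close>
    have c1: "conf_cap F (path_image (\<gamma> n) - V) \<Omega> < (1 / real (Suc n))\<^sup>2"
      and c2: "conf_cap (frontier \<Omega>) (path_image (\<gamma> n) \<inter> V) \<Omega> < (1 / real (Suc n))\<^sup>2" for n
    proof -
      have lt: "c < e\<^sup>2" if "sqrt c < e" "0 \<le> c" for c e :: real
        using that power_strict_mono[of "sqrt c" e 2] by simp
      have "sqrt (conf_cap F (path_image (\<gamma> n) - V) \<Omega>) < 1 / real (Suc n)"
        "sqrt (conf_cap (frontier \<Omega>) (path_image (\<gamma> n) \<inter> V) \<Omega>) < 1 / real (Suc n)"
        using \<gamma>(2)[of n] nn1[OF \<gamma>(1)] nn2[of "\<gamma> n"] real_sqrt_ge_zero unfolding cost_def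
        by (smt (verit))+
      then show "conf_cap F (path_image (\<gamma> n) - V) \<Omega> < (1 / real (Suc n))\<^sup>2"
        "conf_cap (frontier \<Omega>) (path_image (\<gamma> n) \<inter> V) \<Omega> < (1 / real (Suc n))\<^sup>2"
        using lt nn1[OF \<gamma>(1)] nn2 by blast+
    qed
    have "\<exists>v g. admissible F (path_image (\<gamma> n) - V) \<Omega> v g \<and> energy \<Omega> g < (1 / real (Suc n))\<^sup>2" for n
      using adm1[OF \<gamma>(1)] conf_cap_lessD[OF c1] by metis
    then obtain v g where vg: "\<And>n. admissible F (path_image (\<gamma> n) - V) \<Omega> (v n) (g n)"
      "\<And>n. energy \<Omega> (g n) < (1 / real (Suc n))\<^sup>2" by metis
    have "\<exists>w h. admissible (frontier \<Omega>) (path_image (\<gamma> n) \<inter> V) \<Omega> w h \<and> energy \<Omega> h < (1 / real (Suc n))\<^sup>2" for n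
      using adm2[of "\<gamma> n"] conf_cap_lessD[OF c2] by metis
    then obtain w h where wh: "\<And>n. admissible (frontier \<Omega>) (path_image (\<gamma> n) \<inter> V) \<Omega> (w n) (h n)"
      "\<And>n. energy \<Omega> (h n) < (1 / real (Suc n))\<^sup>2" by metis
    have "(\<lambda>n. 1 / real (Suc n)) \<longlonglongrightarrow> 0" using LIMSEQ_inverse_real_of_nat by (simp add: inverse_eq_divide)
    from tendsto_power[OF this, of 2] have l0: "(\<lambda>n. (1 / real (Suc n))\<^sup>2) \<longlonglongrightarrow> 0" by simp
    have e: "(\<lambda>n. energy \<Omega> (g n)) \<longlonglongrightarrow> 0" "(\<lambda>n. energy \<Omega> (h n)) \<longlonglongrightarrow> 0"
      by (rule null_dominated[OF energy_nonneg less_imp_le[OF vg(2)] l0])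
         (rule null_dominated[OF energy_nonneg less_imp_le[OF wh(2)] l0])
    have \<gamma>c: "connected (path_image (\<gamma> n))" "x \<in> path_image (\<gamma> n)" "y n \<in> path_image (\<gamma> n)" for n
      using \<gamma>(1)[of n] pathstart_in_path_image[of "\<gamma> n"] pathfinish_in_path_image[of "\<gamma> n"]
      unfolding paths_def rectifiable_path_def by (auto intro: connected_path_image)
    obtain n where "path_image (\<gamma> n) \<subseteq> sq x r"
      by (rule capacity_of_path_bounded_below[OF \<Omega> assms(3,4,6) p q assms(7) vg(1) wh(1) e r(1,2) \<gamma>c(1,2)])
    then show False using \<gamma>c(3)[of n] y(3)[of n] r(3) by blast
  qed
  show ?thesis
  proof (intro allI impI iffI)
    fix U assume "U \<subseteq> \<Omega>" "openin (top_of_set \<Omega>) U"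
    then have "open U" using \<Omega>(1) openin_open_eq by blast
    then show "\<forall>x\<in>U. \<exists>r>0. \<forall>y\<in>\<Omega>. cap_metric \<Omega> F V x y < r \<longrightarrow> y \<in> U" using away \<open>U \<subseteq> \<Omega>\<close> by blast
  next
    fix U assume U: "U \<subseteq> \<Omega>" "\<forall>x\<in>U. \<exists>r>0. \<forall>y\<in>\<Omega>. cap_metric \<Omega> F V x y < r \<longrightarrow> y \<in> U"
    have "open U"
    proof (rule openI)
      fix x assume x: "x \<in> U"
      then obtain r where r: "r > 0" "\<And>y. y \<in> \<Omega> \<Longrightarrow> cap_metric \<Omega> F V x y < r \<Longrightarrow> y \<in> U" using U(2) by blast
      have xO: "x \<in> \<Omega>" using x U(1) by blast
      obtain d where d: "d > 0" "\<And>y. y \<in> ball x d \<Longrightarrow> cap_metric \<Omega> F V x y < r" using small[OF xO r(1)] by blast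
      obtain d' where d': "d' > 0" "ball x d' \<subseteq> \<Omega>" using \<Omega>(1) xO openE by blast
      have "ball x (min d d') \<subseteq> U" using d(2) d'(2) r(2) by auto
      then show "\<exists>e>0. ball x e \<subseteq> U" using d(1) d'(1) by (intro exI[of _ "min d d'"]) auto
    qed
    then show "openin (top_of_set \<Omega>) U" using U(1) \<Omega>(1) openin_open_eq by blast
  qed
qed

end
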